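(* Let $1\leq p\leq\infty$, let $\alpha,\beta\geq-\frac12$, let $w_{(\alpha,\beta)}(t)=(1-t)^\alpha(1+t)^\beta$ for $t\in(-1,1)$, and let $$T_{(\alpha,\beta)}=(1-t^2)\frac{d^2}{dt^2}+[\beta-\alpha-(\alpha+\beta+2)t]\frac{d}{dt}.$$ Let $\mathcal D=C^\infty[-1,1]$. View $T_{(\alpha,\beta)}$ as an operator on $L^p([-1,1],w_{(\alpha,\beta)}\,dt)$ with domain $\mathcal D$. Let $T_{(\alpha,\beta),c}$ be its maximal (distributional) extension on this space (defined in the context), and let $T_e$ be a linear operator on $L^p([-1,1],w_{(\alpha,\beta)}\,dt)$ with $T_{(\alpha,\beta)}\subset T_e\subset T_{(\alpha,\beta),c}$. Then $T_e$ has the single-valued extension property. Let $f\in\mathcal D$, and let $\mathcal F_{(\alpha,\beta)}f:\mathbb N_0\to\mathbb C$, $\mathcal F_{(\alpha,\beta)}f(n)=\int_{-1}^1f(t)\,p_n^{(\alpha,\beta)}(t)\,w_{(\alpha,\beta)}(t)\,dt$, be the Jacobi transform of $f$, where $p_n^{(\alpha,\beta)}$ is the normalised Jacobi polynomial of order $n$. Then the following limit exists in the extended positive real numbers $[0,\infty]$ and $$\lim_{n\to\infty}\|T_e^nf\|_p^{1/n}=\sup\left\{|z| : z\in\{-n(n+\alpha+\beta+1) : n\in\mathbb N_0,\ \mathcal F_{(\alpha,\beta)}f(n)\neq0\}\right\}.$$ Moreover, $$\sigma_{T_e}(f)=\{-n(n+\alpha+\beta+1) : n\in\mathbb N_0,\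 \mathcal F_{(\alpha,\beta)}f(n)\neq0\},$$ so that the former equality is a local spectral radius formula $\lim_{n\to\infty}\|T_e^nf\|_p^{1/n}=\sup\{|z| : z\in\sigma_{T_e}(f)\}$ for $T_e$ at $f$.
   Context: $\mathbb N_0=\{0,1,2,\ldots\}$; $\sup\emptyset=0$. For $n\in\mathbb N_0$, $$p_n^{(\alpha,\beta)}(t)=\left(\frac{(2n+\alpha+\beta+1)\Gamma(n+\alpha+\beta+1)\,n!}{2^{\alpha+\beta+1}\Gamma(n+\alpha+1)\Gamma(n+\beta+1)}\right)^{1/2}P_n^{(\alpha,\beta)}(t),$$ where $P_n^{(\alpha,\beta)}$ is the Jacobi polynomial of order $n$, standardised by $P_n^{(\alpha,\beta)}(1)=\binom{n+\alpha}{n}$ (for $n=0$ and $\alpha+\beta+1=0$, the product $(2n+\alpha+\beta+1)\Gamma(n+\alpha+\beta+1)$ is read as $\Gamma(\alpha+\beta+2)=1$). The $p_n^{(\alpha,\beta)}$ are orthonormal in $L^2([-1,1],w_{(\alpha,\beta)}\,dt)$. $T_{(\alpha,\beta),c}$ is the operator on $X=L^p([-1,1],w_{(\alpha,\beta)}\,dt)$ whose domain consists of all $f\in X$ for which there is $h\in X$ (necessarily unique) with $\int_{-1}^1h\,g\,w_{(\alpha,\beta)}\,dt=\int_{-1}^1f\,(T_{(\alpha,\beta)}g)\,w_{(\alpha,\beta)}\,dt$ for all $g\in C^\infty[-1,1]$; then $T_{(\alpha,\beta),c}f=h$. For operators, $A\subset B$ means that $B$ extends $A$. For a linear operator $S$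 on a complex Banach space $X$ with domain $\mathcal D(S)\subset X$: $S$ has the single-valued extension property if, for every non-empty open $U\subset\mathbb C$, the only analytic $\phi:U\to\mathcal D(S)$ with $(S-z)\phi_z=0$ for all $z\in U$ is zero. For $x\in X$, $z_0\in\mathbb C$ is in the local resolvent set $\rho_S(x)$ if there are an open neighborhood $U$ of $z_0$ and an analytic $\phi:U\to\mathcal D(S)$ with $(S-z)\phi_z=x$ for all $z\in U$; the local spectrum is $\sigma_S(x)=\mathbb C\setminus\rho_S(x)$. Analyticity is with respect to the norm of $X$ (an analytic $X$-valued function with values in $\mathcal D(S)$). *)

theory Defs
  imports "HOL-Probability.Essential_Supremum"
begin

text \<open>
  Elements of \<open>L\<^sup>p(M)\<close>, \<open>1 \<le> p \<le> \<infinity>\<close>, are represented by measurable functions; equality in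
  \<open>L\<^sup>p(M)\<close> is equality almost everywhere.
\<close>

definition Lp :: "ennreal \<Rightarrow> 'a measure \<Rightarrow> ('a \<Rightarrow> complex) set" where
  "Lp p M = {f \<in> borel_measurable M.
     if p = \<infinity> then esssup M (\<lambda>t. ennreal (norm (f t))) < \<infinity>
     else integrable M (\<lambda>t. norm (f t) powr enn2real p)}"

definition Lp_norm :: "ennreal \<Rightarrow> 'a measure \<Rightarrow> ('a \<Rightarrow> complex) \<Rightarrow> real" where
  "Lp_norm p M f =
     (if p = \<infinity> then enn2real (esssup M (\<lambda>t. ennreal (norm (f t))))
      else (\<integral>t. norm (f t) powr enn2real p \<partial>M) powr (1 / enn2real p))"

text \<open>
  A linear operator on \<open>L\<^sup>p(M)\<close> with domain a subspace of \<open>L\<^sup>p(M)\<close> is represented by its graph,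
  pulled back to representatives: a relation that is invariant under changing either component
  on a null set, is single-valued up to null sets, and is linear. Extension of operators is
  inclusion of graphs, the domain is \<^const>\<open>Domain\<close>, and the \<open>n\<close>-th power of an operator (with its
  maximal domain) is the \<open>n\<close>-th relational power.
\<close>

type_synonym 'a fun_op = "(('a \<Rightarrow> complex) \<times> ('a \<Rightarrow> complex)) set"

definition linear_operator :: "ennreal \<Rightarrow> 'a measure \<Rightarrow> 'a fun_op \<Rightarrow> bool" where
  "linear_operator p M S \<longleftrightarrow>
     S \<subseteq> Lp p M \<times> Lp p M \<and>
     (\<forall>f h f' h'. (f, h) \<in> S \<and> f' \<in> Lp p M \<and> h' \<in> Lp p M \<and>
        (AE t in M. f' t = f t) \<and> (AE t in M. h' t = h t) \<longrightarrow> (f', h') \<in> S) \<and>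
     (\<forall>f h h'. (f, h) \<in> S \<and> (f, h') \<in> S \<longrightarrow> (AE t in M. h t = h' t)) \<and>
     (\<lambda>_. 0, \<lambda>_. 0) \<in> S \<and>
     (\<forall>f h f' h'. (f, h) \<in> S \<and> (f', h') \<in> S \<longrightarrow> (\<lambda>t. f t + f' t, \<lambda>t. h t + h' t) \<in> S) \<and>
     (\<forall>c f h. (f, h) \<in> S \<longrightarrow> (\<lambda>t. c * f t, \<lambda>t. c * h t) \<in> S)"

text \<open>The value \<open>S f\<close> for \<open>f\<close> in the domain of \<open>S\<close>, determined up to a null set.\<close>

definition op_apply :: "'a fun_op \<Rightarrow> ('a \<Rightarrow> complex) \<Rightarrow> ('a \<Rightarrow> complex)" where
  "op_apply S f = (SOME h. (f, h) \<in> S)"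

definition op_shift :: "'a fun_op \<Rightarrow> complex \<Rightarrow> 'a fun_op" where
  "op_shift S z = {(f, \<lambda>t. h t - z * f t) | f h. (f, h) \<in> S}"

text \<open>Analyticity of \<open>\<phi> : U \<rightarrow> L\<^sup>p(M)\<close>: complex differentiability in norm on the open set \<open>U\<close>.\<close>

definition Lp_analytic_on ::
    "ennreal \<Rightarrow> 'a measure \<Rightarrow> (complex \<Rightarrow> 'a \<Rightarrow> complex) \<Rightarrow> complex set \<Rightarrow> bool" where
  "Lp_analytic_on p M \<phi> U \<longleftrightarrow>
     (\<forall>z\<in>U. \<phi> z \<in> Lp p M \<and>
        (\<exists>d\<in>Lp p M. ((\<lambda>w. Lp_norm p M (\<lambda>t. (\<phi> w t - \<phi> z t) / (w - z) - d t)) \<longlongrightarrow> 0)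
                      (at z within U)))"

definition has_svep :: "ennreal \<Rightarrow> 'a measure \<Rightarrow> 'a fun_op \<Rightarrow> bool" where
  "has_svep p M S \<longleftrightarrow>
     (\<forall>U \<phi>. open U \<and> U \<noteq> {} \<and> Lp_analytic_on p M \<phi> U \<and>
        (\<forall>z\<in>U. (\<phi> z, \<lambda>_. 0) \<in> op_shift S z) \<longrightarrow>
        (\<forall>z\<in>U. AE t in M. \<phi> z t = 0))"

text \<open>
  In the next definition as in the previous one, the shifted graph need only be tested with one
  representative of the right-hand side, since \<open>S\<close> is invariant under null-set changes.
\<close>

definition local_resolvent_set ::
    "ennreal \<Rightarrow> 'a measure \<Rightarrow> 'a fun_op \<Rightarrow> ('a \<Rightarrow> complex) \<Rightarrow> complex set" where
  "local_resolvent_set p M S x =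
     {z\<^sub>0. \<exists>U \<phi>. open U \<and> z\<^sub>0 \<in> U \<and> Lp_analytic_on p M \<phi> U \<and>
        (\<forall>z\<in>U. (\<phi> z, x) \<in> op_shift S z)}"

definition local_spectrum ::
    "ennreal \<Rightarrow> 'a measure \<Rightarrow> 'a fun_op \<Rightarrow> ('a \<Rightarrow> complex) \<Rightarrow> complex set" where
  "local_spectrum p M S x = UNIV - local_resolvent_set p M S x"

definition jacobi_weight :: "real \<Rightarrow> real \<Rightarrow> real \<Rightarrow> real" where
  "jacobi_weight \<alpha> \<beta> t = (1 - t) powr \<alpha> * (1 + t) powr \<beta>"

definition jacobi_measure :: "real \<Rightarrow> real \<Rightarrow> real measure" where
  "jacobi_measure \<alpha> \<beta> = density (lebesgue_on {-1..1}) (\<lambda>t. ennreal (jacobi_weight \<alpha> \<beta> t))"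

text \<open>
  \<open>C\<^sup>\<infinity>[-1,1]\<close>, with one-sided derivatives at the endpoints. Values outside \<open>[-1,1]\<close> are irrelevant.
\<close>

definition ivl_deriv :: "(real \<Rightarrow> complex) \<Rightarrow> real \<Rightarrow> complex" where
  "ivl_deriv f t = vector_derivative f (at t within {-1..1})"

definition smooth_ivl :: "(real \<Rightarrow> complex) set" where
  "smooth_ivl = {f. \<forall>n. (ivl_deriv ^^ n) f differentiable_on {-1..1}}"

definition jacobi_diff :: "real \<Rightarrow> real \<Rightarrow> (real \<Rightarrow> complex) \<Rightarrow> real \<Rightarrow> complex" where
  "jacobi_diff \<alpha> \<beta> f t =
     complex_of_real (1 - t\<^sup>2) * ivl_deriv (ivl_deriv f) t +
     complex_of_real (\<beta> - \<alpha> - (\<alpha> + \<beta> + 2) * t) * ivl_deriv f t"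

definition jacobi_op :: "ennreal \<Rightarrow> real \<Rightarrow> real \<Rightarrow> real fun_op" where
  "jacobi_op p \<alpha> \<beta> =
     {(f, h). f \<in> Lp p (jacobi_measure \<alpha> \<beta>) \<and> h \<in> Lp p (jacobi_measure \<alpha> \<beta>) \<and>
        (\<exists>g\<in>smooth_ivl. (AE t in jacobi_measure \<alpha> \<beta>. f t = g t) \<and>
           (AE t in jacobi_measure \<alpha> \<beta>. h t = jacobi_diff \<alpha> \<beta> g t))}"

definition jacobi_op_max :: "ennreal \<Rightarrow> real \<Rightarrow> real \<Rightarrow> real fun_op" where
  "jacobi_op_max p \<alpha> \<beta> =
     {(f, h). f \<in> Lp p (jacobi_measure \<alpha> \<beta>) \<and> h \<in> Lp p (jacobi_measure \<alpha> \<beta>) \<and>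
        (\<forall>g\<in>smooth_ivl. (\<integral>t. h t * g t \<partial>jacobi_measure \<alpha> \<beta>) =
           (\<integral>t. f t * jacobi_diff \<alpha> \<beta> g t \<partial>jacobi_measure \<alpha> \<beta>))}"

text \<open>
  The Jacobi polynomial \<open>P\<^sub>n(t) = (n + \<alpha> choose n) F(-n, n + \<alpha> + \<beta> + 1; \<alpha> + 1; (1 - t) / 2)\<close>,
  where \<open>F\<close> is the Gauss hypergeometric function; here \<open>\<alpha> > -1\<close>.
\<close>

definition jacobi_P :: "real \<Rightarrow> real \<Rightarrow> nat \<Rightarrow> real \<Rightarrow> real" where
  "jacobi_P \<alpha> \<beta> n t = ((real n + \<alpha>) gchoose n) *
     (\<Sum>k\<le>n. pochhammer (- real n) k * pochhammer (real n + \<alpha> + \<beta> + 1) k /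
        (pochhammer (\<alpha> + 1) k * fact k) * ((1 - t) / 2) ^ k)"

lemma jacobi_P_at_1: "jacobi_P \<alpha> \<beta> n 1 = ((real n + \<alpha>) gchoose n)"
proof -
  have "(\<Sum>k\<le>n. c k * 0 ^ k) = c 0" for c :: "nat \<Rightarrow> real"
    by (induction n) auto
  then show ?thesis
    by (simp add: jacobi_P_def)
qed

text \<open>The normalised Jacobi polynomials. The case distinction is the convention at the removable
  singularity \<open>n = 0\<close>, \<open>\<alpha> + \<beta> + 1 = 0\<close>, where \<^const>\<open>Gamma\<close> is evaluated at a pole.\<close>

definition jacobi_p :: "real \<Rightarrow> real \<Rightarrow> nat \<Rightarrow> real \<Rightarrow> real" where
  "jacobi_p \<alpha> \<beta> n t = sqrt
     ((if n = 0 \<and> \<alpha> + \<beta> + 1 = 0 then Gamma (\<alpha> + \<beta> + 2)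
       else (2 * real n + \<alpha> + \<beta> + 1) * Gamma (real n + \<alpha> + \<beta> + 1)) * fact n /
      (2 powr (\<alpha> + \<beta> + 1) * Gamma (real n + \<alpha> + 1) * Gamma (real n + \<beta> + 1))) *
     jacobi_P \<alpha> \<beta> n t"

definition jacobi_transform :: "real \<Rightarrow> real \<Rightarrow> (real \<Rightarrow> complex) \<Rightarrow> nat \<Rightarrow> complex" where
  "jacobi_transform \<alpha> \<beta> f n =
     (\<integral>t. f t * complex_of_real (jacobi_p \<alpha> \<beta> n t) \<partial>jacobi_measure \<alpha> \<beta>)"

end

theory Submission
  imports Defs
begin

text \<open>
  Write \<open>T\<close> for the Jacobi operator, \<open>\<lambda>\<^sub>n = - n (n + \<alpha> + \<beta> + 1)\<close>, and \<open>\<F> f(n)\<close> for the Jacobi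
  transform. The polynomials \<open>p\<^sub>n\<close> are eigenfunctions of \<open>T\<close> for the eigenvalues \<open>\<lambda>\<^sub>n\<close>, which are
  pairwise distinct because \<open>\<alpha> + \<beta> + 1 \<ge> 0\<close>. They are smooth, so they are admissible test functions
  in the definition of the maximal operator; hence every operator \<open>S\<close> between \<open>T\<close> and the maximal
  operator satisfies \<open>\<F> (S f)(n) = \<lambda>\<^sub>n \<F> f(n)\<close> (\<open>jacobi_transform_max\<close>), and \<open>\<F>\<close> is injective on
  \<open>L\<^sup>1\<close> and therefore on \<open>L\<^sup>p\<close> (\<open>AE_zero_if_jacobi_transform_zero\<close>). On the transform side the
  operator is thus diagonal, and half of the statement is read off from this.

  If \<open>(S - z) \<phi>\<^sub>z = 0\<close> on an open set, then \<open>\<F> \<phi>\<^sub>z(n)\<close> vanishes for \<open>z \<noteq> \<lambda>\<^sub>n\<close>, and also at \<open>z = \<lambda>\<^sub>n\<close> by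
  continuity; this is the single-valued extension property. If \<open>(S - z) \<phi>\<^sub>z = f\<close> is solvable at
  \<open>z = \<lambda>\<^sub>n\<close>, then \<open>\<F> f(n) = 0\<close>, so the support of \<open>\<F> f\<close> contributes to the local spectrum. Finally
  \<open>\<bar>\<lambda>\<^sub>n\<bar>\<^sup>k \<bar>\<F> f(n)\<bar>\<close> is at most a constant times \<open>\<parallel>T\<^sup>k f\<parallel>\<^sub>p\<close>, which is the lower bound for the limit.

  The other half asks for solutions of \<open>(S - z) \<phi>\<^sub>z = f\<close>. The domain of \<open>S\<close> need not contain more than
  the smooth functions, so the solution
  \<open>\<phi>\<^sub>z = \<Sum> c\<^sub>n (\<lambda>\<^sub>n - z)\<^sup>-\<^sup>1 p\<^sub>n\<close> with \<open>f = \<Sum> c\<^sub>n p\<^sub>n\<close> must be shown to be smooth up to the endpoints.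
  The coefficients decrease faster than any power of \<open>\<lambda>\<^sub>n\<close> because \<open>\<F> (T\<^sup>k f)(n) = \<lambda>\<^sub>n\<^sup>k \<F> f(n)\<close>. What is
  needed is that the derivatives of \<open>p\<^sub>n\<close> grow at most polynomially in \<open>\<lambda>\<^sub>n\<close>, and this is a consequence
  of the differential equation. In divergence form the operator bounds
  \<open>\<parallel>u'\<parallel>\<^sub>\<infinity>\<close> by a constant times \<open>\<parallel>T u\<parallel>\<^sub>\<infinity>\<close> (\<open>jacobi_diff_controls_deriv\<close>); since the derivative of an
  eigenfunction is an eigenfunction for the parameters \<open>(\<alpha> + 1, \<beta> + 1)\<close>, this iterates to all
  derivatives (\<open>jacobi_eigenfunction_deriv_bound\<close>). A Nikolskii-type inequality
  (\<open>jacobi_L2_lower_bound\<close>) then compares the supremum of \<open>p\<^sub>n\<close> with its \<open>L\<^sup>2\<close> norm. The same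
  expansion dominates \<open>\<parallel>T\<^sup>k f\<parallel>\<^sub>p\<close> by \<open>\<rho>\<^sup>k\<close> when the eigenvalues in the support of \<open>\<F> f\<close> are bounded
  by \<open>\<rho>\<close>, which is the upper bound for the limit.
\<close>

section \<open>Smooth functions on the closed interval\<close>

lemma ivl_deriv_eqI:
  assumes "(f has_vector_derivative d) (at t within {-1..1})" "t \<in> {-1..1}"
  shows "ivl_deriv f t = d"
  unfolding ivl_deriv_def
  using vector_derivative_within_closed_interval[OF _ assms(2,1)] by simp

lemma ivl_deriv_cong:
  assumes "\<And>x. x \<in> {-1..1} \<Longrightarrow> f x = g x" "t \<in> {-1..1}"
  shows "ivl_deriv f t = ivl_deriv g t"
proof -
  have "(f has_vector_derivative d) (at t within {-1..1}) \<longleftrightarrow>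
        (g has_vector_derivative d) (at t within {-1..1})" for d
    using assms by (metis has_vector_derivative_transform)
  then show ?thesis
    unfolding ivl_deriv_def vector_derivative_def by simp
qed

lemma smooth_ivl_has_deriv:
  assumes "f \<in> smooth_ivl" "t \<in> {-1..1}"
  shows "((ivl_deriv ^^ k) f has_vector_derivative (ivl_deriv ^^ Suc k) f t) (at t within {-1..1})"
proof -
  have "(ivl_deriv ^^ k) f differentiable (at t within {-1..1})"
    using assms unfolding smooth_ivl_def differentiable_on_def by blast
  then show ?thesis
    by (simp add: vector_derivative_works ivl_deriv_def)
qed

lemma smooth_ivl_has_deriv1:
  assumes "f \<in> smooth_ivl" "t \<in> {-1..1}"
  shows "(f has_vector_derivative ivl_deriv f t) (at t within {-1..1})"
  using smooth_ivl_has_deriv[OF assms, of 0] by simp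

lemma smooth_ivl_deriv: "f \<in> smooth_ivl \<Longrightarrow> ivl_deriv f \<in> smooth_ivl"
  unfolding smooth_ivl_def by (auto simp: funpow_swap1) (metis funpow_Suc_right o_apply)

lemma smooth_ivl_continuous: "f \<in> smooth_ivl \<Longrightarrow> continuous_on {-1..1} f"
  using differentiable_imp_continuous_on[of f "{-1..1}"] unfolding smooth_ivl_def
  by (metis (mono_tags, lifting) funpow_0 mem_Collect_eq)

text \<open>
  Exhibiting the whole sequence of derivatives shows smoothness and at the same time identifies the
  iterated one-sided derivatives; this is the form in which both are used below.
\<close>

lemma ivl_deriv_funpow_eqI:
  assumes "\<And>t. t \<in> {-1..1} \<Longrightarrow> f t = D 0 t"
    and "\<And>k t. t \<in> {-1..1} \<Longrightarrow> (D k has_vector_derivative D (Suc k) t) (at t within {-1..1})"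
  shows "t \<in> {-1..1} \<Longrightarrow> (ivl_deriv ^^ k) f t = D k t"
proof (induction k arbitrary: t)
  case (Suc k)
  have "ivl_deriv ((ivl_deriv ^^ k) f) t = ivl_deriv (D k) t"
    using Suc by (intro ivl_deriv_cong) auto
  also have "\<dots> = D (Suc k) t"
    by (intro ivl_deriv_eqI assms Suc)
  finally show ?case by simp
qed (use assms in auto)

lemma smooth_ivlI:
  assumes "\<And>t. t \<in> {-1..1} \<Longrightarrow> f t = D 0 t"
    and "\<And>k t. t \<in> {-1..1} \<Longrightarrow> (D k has_vector_derivative D (Suc k) t) (at t within {-1..1})"
  shows "f \<in> smooth_ivl"
  unfolding smooth_ivl_def differentiable_on_def
proof safe
  fix k t assume t: "t \<in> {-1..1::real}"
  have "((ivl_deriv ^^ k) f has_vector_derivative D (Suc k) t) (at t within {-1..1})"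
    using assms(2)[OF t, of k] t ivl_deriv_funpow_eqI[of f D, OF assms]
    by (metis has_vector_derivative_transform)
  then show "(ivl_deriv ^^ k) f differentiable at t within {-1..1}"
    by (auto simp: has_vector_derivative_def differentiable_def)
qed

lemma smooth_ivl_lincomb:
  assumes "finite A" "\<And>i. i \<in> A \<Longrightarrow> g i \<in> smooth_ivl"
  shows "(\<lambda>t. \<Sum>i\<in>A. c i * g i t) \<in> smooth_ivl"
    and "t \<in> {-1..1} \<Longrightarrow>
      (ivl_deriv ^^ k) (\<lambda>t. \<Sum>i\<in>A. c i * g i t) t = (\<Sum>i\<in>A. c i * (ivl_deriv ^^ k) (g i) t)"
proof -
  define D where "D k t = (\<Sum>i\<in>A. c i * (ivl_deriv ^^ k) (g i) t)" for k t
  have D: "(D k has_vector_derivative D (Suc k) t) (at t within {-1..1})"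
    if "t \<in> {-1..1}" for k t
    unfolding D_def
    by (intro has_vector_derivative_sum has_vector_derivative_mult_right smooth_ivl_has_deriv assms that)
  show "(\<lambda>t. \<Sum>i\<in>A. c i * g i t) \<in> smooth_ivl"
    by (rule smooth_ivlI[of _ D]) (rule D | simp add: D_def)+
  show "(ivl_deriv ^^ k) (\<lambda>t. \<Sum>i\<in>A. c i * g i t) t = (\<Sum>i\<in>A. c i * (ivl_deriv ^^ k) (g i) t)"
    if "t \<in> {-1..1}"
    using ivl_deriv_funpow_eqI[of "\<lambda>t. \<Sum>i\<in>A. c i * g i t" D t k] D that by (simp add: D_def)
qed

lemma smooth_ivl_add:
  assumes "f \<in> smooth_ivl" "g \<in> smooth_ivl"
  shows "(\<lambda>t. f t + g t) \<in> smooth_ivl"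
  using smooth_ivl_lincomb(1)[of "{0::nat, 1}" "\<lambda>i. if i = 0 then f else g" "\<lambda>_. 1"] assms by simp

lemma smooth_ivl_cmult: "f \<in> smooth_ivl \<Longrightarrow> (\<lambda>t. c * f t) \<in> smooth_ivl"
  using smooth_ivl_lincomb(1)[of "{0::nat}" "\<lambda>i. f" "\<lambda>_. c"] by simp

lemma smooth_ivl_const: "(\<lambda>t. c) \<in> smooth_ivl"
  by (rule smooth_ivlI[of _ "\<lambda>k t. if k = 0 then c else 0"]) (auto intro!: derivative_eq_intros)

text \<open>By Leibniz's rule only two terms survive in each derivative of \<open>t f(t)\<close>. For \<open>k = 0\<close> the
  truncated index \<open>k - 1\<close> does no harm, as its term carries the factor \<open>k\<close>.\<close>

lemma smooth_ivl_times_var: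
  assumes "f \<in> smooth_ivl"
  shows "(\<lambda>t. complex_of_real t * f t) \<in> smooth_ivl"
proof (rule smooth_ivlI[of _ "\<lambda>k t. complex_of_real t * (ivl_deriv ^^ k) f t
                                  + of_nat k * (ivl_deriv ^^ (k - 1)) f t"])
  fix k and t :: real assume t: "t \<in> {-1..1}"
  have 1: "((\<lambda>t. complex_of_real t * (ivl_deriv ^^ k) f t) has_vector_derivative
     (complex_of_real t * (ivl_deriv ^^ Suc k) f t + 1 * (ivl_deriv ^^ k) f t)) (at t within {-1..1})"
    by (intro has_vector_derivative_mult smooth_ivl_has_deriv[OF assms t])
       (auto intro!: derivative_eq_intros)
  have 2: "((\<lambda>t. of_nat k * (ivl_deriv ^^ (k - 1)) f t) has_vector_derivative
     (of_nat k * (ivl_deriv ^^ k) f t)) (at t within {-1..1})"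
    using smooth_ivl_has_deriv[OF assms t, of "k - 1"]
    by (cases k) (auto intro!: has_vector_derivative_mult_right)
  show "((\<lambda>t. complex_of_real t * (ivl_deriv ^^ k) f t + of_nat k * (ivl_deriv ^^ (k - 1)) f t)
     has_vector_derivative (complex_of_real t * (ivl_deriv ^^ Suc k) f t
       + of_nat (Suc k) * (ivl_deriv ^^ (Suc k - 1)) f t)) (at t within {-1..1})"
    using has_vector_derivative_add[OF 1 2] by (simp add: algebra_simps)
qed auto

lemma smooth_ivl_affine_mult:
  assumes "f \<in> smooth_ivl"
  shows "(\<lambda>t. complex_of_real (a + b * t) * f t) \<in> smooth_ivl"
proof -
  have "(\<lambda>t. of_real a * f t + of_real b * (of_real t * f t)) \<in> smooth_ivl"
    by (intro smooth_ivl_add smooth_ivl_cmult smooth_ivl_times_var assms)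
  then show ?thesis by (simp add: algebra_simps)
qed

text \<open>The bounds on each derivative make the differentiated series converge uniformly, so that
  differentiation and summation commute at every order.\<close>

lemma smooth_ivl_series:
  fixes g :: "nat \<Rightarrow> real \<Rightarrow> complex"
  assumes g: "\<And>n. g n \<in> smooth_ivl"
    and M: "\<And>k. summable (M k)"
    and bd: "\<And>k n t. t \<in> {-1..1} \<Longrightarrow> norm ((ivl_deriv ^^ k) (g n) t) \<le> M k n"
  shows "(\<lambda>t. \<Sum>n. g n t) \<in> smooth_ivl"
    and "t \<in> {-1..1} \<Longrightarrow> (ivl_deriv ^^ k) (\<lambda>t. \<Sum>n. g n t) t = (\<Sum>n. (ivl_deriv ^^ k) (g n) t)"
proof -
  define D where "D k t = (\<Sum>n. (ivl_deriv ^^ k) (g n) t)" for k t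
  have sm: "summable (\<lambda>n. (ivl_deriv ^^ k) (g n) t)" if "t \<in> {-1..1}" for k t
    by (rule summable_comparison_test'[OF M[of k], of 0]) (rule bd[OF that])
  have D: "(D k has_vector_derivative D (Suc k) t) (at t within {-1..1})"
    if t: "t \<in> {-1..1}" for k t
  proof -
    have ul: "uniform_limit {-1..1} (\<lambda>n t. \<Sum>i<n. (ivl_deriv ^^ Suc k) (g i) t) (D (Suc k)) sequentially"
      unfolding D_def by (rule Weierstrass_m_test[OF bd M])
    have "\<exists>G. \<forall>x\<in>{-1..1}. (\<lambda>n. (ivl_deriv ^^ k) (g n) x) sums (G x) \<and>
       (G has_derivative (\<lambda>h. h *\<^sub>R D (Suc k) x)) (at x within {-1..1})"
    proof (rule has_derivative_series[where f' = "\<lambda>n x h. h *\<^sub>R (ivl_deriv ^^ Suc k) (g n) x"])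
      show "convex {-1..1::real}" by simp
      show "((ivl_deriv ^^ k) (g n) has_derivative (\<lambda>h. h *\<^sub>R (ivl_deriv ^^ Suc k) (g n) x))
          (at x within {-1..1})" if "x \<in> {-1..1}" for n x
        using smooth_ivl_has_deriv[OF g that] unfolding has_vector_derivative_def .
      show "\<forall>\<^sub>F n in sequentially. \<forall>x\<in>{-1..1}. \<forall>h.
         norm ((\<Sum>i<n. h *\<^sub>R (ivl_deriv ^^ Suc k) (g i) x) - h *\<^sub>R D (Suc k) x) \<le> e * norm h"
        if "e > 0" for e
      proof -
        have "\<forall>\<^sub>F n in sequentially. \<forall>x\<in>{-1..1}.
            dist (\<Sum>i<n. (ivl_deriv ^^ Suc k) (g i) x) (D (Suc k) x) < e"
          using ul that by (simp add: uniform_limit_iff)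
        then show ?thesis
        proof eventually_elim
          case (elim n)
          show ?case
          proof safe
            fix x h :: real assume x: "x \<in> {-1..1}"
            have "(\<Sum>i<n. h *\<^sub>R (ivl_deriv ^^ Suc k) (g i) x) - h *\<^sub>R D (Suc k) x
               = h *\<^sub>R ((\<Sum>i<n. (ivl_deriv ^^ Suc k) (g i) x) - D (Suc k) x)"
              by (simp add: scaleR_sum_right scaleR_diff_right)
            also have "norm \<dots> \<le> \<bar>h\<bar> * e"
              using elim x by (auto simp: dist_norm intro!: mult_left_mono[OF less_imp_le])
            finally show "norm ((\<Sum>i<n. h *\<^sub>R (ivl_deriv ^^ Suc k) (g i) x) - h *\<^sub>R D (Suc k) x)
               \<le> e * norm h" by (simp add: mult.commute)
          qed
        qed
      qed
      show "t \<in> {-1..1}" by (rule t)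
      show "(\<lambda>n. (ivl_deriv ^^ k) (g n) t) sums (\<Sum>n. (ivl_deriv ^^ k) (g n) t)"
        using sm[OF t] by (simp add: summable_sums)
    qed
    then obtain G where G: "\<And>x. x \<in> {-1..1} \<Longrightarrow> (\<lambda>n. (ivl_deriv ^^ k) (g n) x) sums (G x)"
      "\<And>x. x \<in> {-1..1} \<Longrightarrow> (G has_vector_derivative D (Suc k) x) (at x within {-1..1})"
      unfolding has_vector_derivative_def by blast
    have "D k x = G x" if "x \<in> {-1..1}" for x
      using G(1)[OF that] by (simp add: D_def sums_iff)
    with G(2)[OF t] t show ?thesis
      by (metis has_vector_derivative_transform)
  qed
  show "(\<lambda>t. \<Sum>n. g n t) \<in> smooth_ivl"
    by (rule smooth_ivlI[of _ D]) (rule D | simp add: D_def)+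
  show "(ivl_deriv ^^ k) (\<lambda>t. \<Sum>n. g n t) t = (\<Sum>n. (ivl_deriv ^^ k) (g n) t)" if "t \<in> {-1..1}"
    using ivl_deriv_funpow_eqI[of "\<lambda>t. \<Sum>n. g n t" D t k] D that by (simp add: D_def)
qed

lemma jacobi_diff_lincomb:
  assumes "finite A" "\<And>i. i \<in> A \<Longrightarrow> g i \<in> smooth_ivl" "t \<in> {-1..1}"
  shows "jacobi_diff \<alpha> \<beta> (\<lambda>t. \<Sum>i\<in>A. c i * g i t) t = (\<Sum>i\<in>A. c i * jacobi_diff \<alpha> \<beta> (g i) t)"
proof -
  define a b where "a = complex_of_real (1 - t\<^sup>2)"
    and "b = complex_of_real (\<beta> - \<alpha> - (\<alpha> + \<beta> + 2) * t)"
  have "jacobi_diff \<alpha> \<beta> (\<lambda>t. \<Sum>i\<in>A. c i * g i t) t =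
      a * (\<Sum>i\<in>A. c i * ivl_deriv (ivl_deriv (g i)) t) + b * (\<Sum>i\<in>A. c i * ivl_deriv (g i) t)"
    using smooth_ivl_lincomb(2)[of A g t 1 c, OF assms] smooth_ivl_lincomb(2)[of A g t 2 c, OF assms]
    unfolding jacobi_diff_def a_def[symmetric] b_def[symmetric] by (simp add: numeral_2_eq_2)
  also have "\<dots> = (\<Sum>i\<in>A. c i * (a * ivl_deriv (ivl_deriv (g i)) t + b * ivl_deriv (g i) t))"
    by (simp add: sum_distrib_left sum.distrib distrib_left mult.left_commute)
  finally show ?thesis
    unfolding jacobi_diff_def a_def b_def .
qed

lemma smooth_ivl_jacobi_diff:
  assumes "f \<in> smooth_ivl"
  shows "jacobi_diff \<alpha> \<beta> f \<in> smooth_ivl"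
proof -
  let ?f1 = "ivl_deriv f" and ?f2 = "ivl_deriv (ivl_deriv f)"
  have "(\<lambda>t. complex_of_real (1 + (-1) * t) * (complex_of_real (1 + 1 * t) * ?f2 t)
     + complex_of_real ((\<beta> - \<alpha>) + (-(\<alpha> + \<beta> + 2)) * t) * ?f1 t) \<in> smooth_ivl"
    by (intro smooth_ivl_add smooth_ivl_affine_mult smooth_ivl_deriv assms)
  moreover have "(\<lambda>t. complex_of_real (1 + (-1) * t) * (complex_of_real (1 + 1 * t) * ?f2 t)
     + complex_of_real ((\<beta> - \<alpha>) + (-(\<alpha> + \<beta> + 2)) * t) * ?f1 t) = jacobi_diff \<alpha> \<beta> f"
    by (rule ext) (simp add: jacobi_diff_def algebra_simps power2_eq_square)
  ultimately show ?thesis by simp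
qed

text \<open>Differentiating the coefficient \<open>1 - t\<^sup>2\<close> adds \<open>- 2 t\<close> to the first-order coefficient, which
  is exactly the effect of raising both parameters by one. This carries a bound for first
  derivatives over to all orders.\<close>

lemma jacobi_diff_deriv:
  assumes f: "f \<in> smooth_ivl" and t: "t \<in> {-1..1}"
  shows "ivl_deriv (jacobi_diff \<alpha> \<beta> f) t =
    jacobi_diff (\<alpha> + 1) (\<beta> + 1) (ivl_deriv f) t - complex_of_real (\<alpha> + \<beta> + 2) * ivl_deriv f t"
proof -
  let ?f1 = "ivl_deriv f" and ?f2 = "ivl_deriv (ivl_deriv f)"
  have 1: "((\<lambda>t. complex_of_real (1 - t\<^sup>2) * ?f2 t) has_vector_derivative
     (complex_of_real (1 - t\<^sup>2) * ivl_deriv ?f2 t + complex_of_real (-2 * t) * ?f2 t)) (at t within {-1..1})"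
    by (intro has_vector_derivative_mult smooth_ivl_has_deriv1[OF _ t] smooth_ivl_deriv f
          has_vector_derivative_of_real) (auto intro!: derivative_eq_intros)
  have 2: "((\<lambda>t. complex_of_real (\<beta> - \<alpha> - (\<alpha> + \<beta> + 2) * t) * ?f1 t) has_vector_derivative
     (complex_of_real (\<beta> - \<alpha> - (\<alpha> + \<beta> + 2) * t) * ?f2 t + complex_of_real (- (\<alpha> + \<beta> + 2)) * ?f1 t))
     (at t within {-1..1})"
    by (intro has_vector_derivative_mult smooth_ivl_has_deriv1[OF _ t] smooth_ivl_deriv f
          has_vector_derivative_of_real) (auto intro!: derivative_eq_intros)
  have "ivl_deriv (jacobi_diff \<alpha> \<beta> f) t =
    (complex_of_real (1 - t\<^sup>2) * ivl_deriv ?f2 t + complex_of_real (-2 * t) * ?f2 t) +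
    (complex_of_real (\<beta> - \<alpha> - (\<alpha> + \<beta> + 2) * t) * ?f2 t + complex_of_real (- (\<alpha> + \<beta> + 2)) * ?f1 t)"
    using has_vector_derivative_add[OF 1 2] unfolding jacobi_diff_def[abs_def]
    by (intro ivl_deriv_eqI t)
  then show ?thesis
    by (simp add: jacobi_diff_def algebra_simps)
qed

section \<open>The operator in divergence form\<close>

lemma powr_le_two_powr_abs:
  fixes x a :: real
  assumes "1 \<le> x" "x \<le> 2"
  shows "x powr a \<le> 2 powr \<bar>a\<bar>"
proof -
  have "x powr a \<le> x powr \<bar>a\<bar>"
    using assms by (intro powr_mono) auto
  also have "\<dots> \<le> 2 powr \<bar>a\<bar>"
    using assms by (intro powr_mono2) auto
  finally show ?thesis .
qed

lemma jacobi_weight_nonneg: "jacobi_weight \<alpha> \<beta> t \<ge> 0"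
  by (simp add: jacobi_weight_def)

lemma jacobi_weight_has_deriv:
  assumes t: "-1 < t" "t < 1" and G: "(G has_vector_derivative G') (at t)"
  shows "((\<lambda>t. jacobi_weight (\<alpha> + 1) (\<beta> + 1) t *\<^sub>R G t) has_vector_derivative
     jacobi_weight \<alpha> \<beta> t *\<^sub>R ((1 - t\<^sup>2) *\<^sub>R G' + (\<beta> - \<alpha> - (\<alpha> + \<beta> + 2) * t) *\<^sub>R G t)) (at t)"
proof -
  have p: "(1 - t) powr (\<alpha> + 1) = (1 - t) powr \<alpha> * (1 - t)"
    "(1 + t) powr (\<beta> + 1) = (1 + t) powr \<beta> * (1 + t)"
    using t by (simp_all add: powr_add)
  have "(jacobi_weight (\<alpha> + 1) (\<beta> + 1) has_field_derivative
      (\<alpha> + 1) * (1 - t) powr \<alpha> * (-1) * (1 + t) powr (\<beta> + 1)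
      + (1 - t) powr (\<alpha> + 1) * ((\<beta> + 1) * (1 + t) powr \<beta>)) (at t)"
    unfolding jacobi_weight_def[abs_def] using t
    by (auto intro!: derivative_eq_intros simp: field_simps)
  also have "(\<alpha> + 1) * (1 - t) powr \<alpha> * (-1) * (1 + t) powr (\<beta> + 1)
      + (1 - t) powr (\<alpha> + 1) * ((\<beta> + 1) * (1 + t) powr \<beta>)
     = jacobi_weight \<alpha> \<beta> t * (\<beta> - \<alpha> - (\<alpha> + \<beta> + 2) * t)"
    unfolding p jacobi_weight_def by algebra
  finally have W: "(jacobi_weight (\<alpha> + 1) (\<beta> + 1) has_field_derivative
      jacobi_weight \<alpha> \<beta> t * (\<beta> - \<alpha> - (\<alpha> + \<beta> + 2) * t)) (at t)" .
  have W1: "jacobi_weight (\<alpha> + 1) (\<beta> + 1) t = jacobi_weight \<alpha> \<beta> t * (1 - t\<^sup>2)"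
    unfolding p jacobi_weight_def by (simp add: algebra_simps power2_eq_square)
  show ?thesis
    using has_vector_derivative_scaleR[OF W G] unfolding W1 by (simp add: scaleR_add_right)
qed

lemma jacobi_weight_continuous:
  assumes "\<alpha> > -1" "\<beta> > -1"
  shows "continuous_on {-1..1} (jacobi_weight (\<alpha> + 1) (\<beta> + 1))"
  unfolding jacobi_weight_def[abs_def] using assms
  by (intro continuous_intros continuous_on_powr') auto

text \<open>
  In the comments below, \<open>w\<close> and \<open>W = (1 - t\<^sup>2) w\<close> are the Jacobi weights with parameters
  \<open>(\<alpha>, \<beta>)\<close> and \<open>(\<alpha> + 1, \<beta> + 1)\<close>. The first-order coefficient of \<open>T\<close> is \<open>W' / w\<close>, which is what
  makes \<open>w T u\<close> the derivative of \<open>W u'\<close>.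
\<close>

lemma jacobi_diff_divergence_form:
  assumes u: "u \<in> smooth_ivl" and t: "-1 < t" "t < 1"
  shows "((\<lambda>t. jacobi_weight (\<alpha> + 1) (\<beta> + 1) t *\<^sub>R ivl_deriv u t) has_vector_derivative
     jacobi_weight \<alpha> \<beta> t *\<^sub>R jacobi_diff \<alpha> \<beta> u t) (at t)"
proof -
  have "(ivl_deriv u has_vector_derivative ivl_deriv (ivl_deriv u) t) (at t)"
    using smooth_ivl_has_deriv1[OF smooth_ivl_deriv[OF u], of t] t by (simp add: at_within_Icc_at)
  from jacobi_weight_has_deriv[OF t this, of \<alpha> \<beta>] show ?thesis
    unfolding jacobi_diff_def scaleR_conv_of_real .
qed

text \<open>
  Integrating the divergence form from the nearer endpoint bounds \<open>W u'\<close> by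
  \<open>sup \<bar>T u\<bar>\<close> times the integral of \<open>w\<close>, and near each endpoint that integral is of
  the order of \<open>W\<close>. The bound is thus uniform up to the endpoints.
\<close>

lemma jacobi_diff_controls_deriv:
  assumes "\<alpha> > -1" "\<beta> > -1"
  shows "\<exists>C\<ge>0. \<forall>u\<in>smooth_ivl. \<forall>M. (\<forall>t\<in>{-1..1}. norm (jacobi_diff \<alpha> \<beta> u t) \<le> M) \<longrightarrow>
     (\<forall>t\<in>{-1..1}. norm (ivl_deriv u t) \<le> C * M)"
proof -
  define K1 K2 where "K1 = 2 powr \<bar>\<alpha>\<bar> / (\<beta> + 1)" and "K2 = 2 powr \<bar>\<beta>\<bar> / (\<alpha> + 1)"
  have K: "K1 > 0" "K2 > 0" using assms by (auto simp: K1_def K2_def)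
  have two: "1 \<le> 2 powr \<bar>x\<bar>" for x :: real by (simp add: ge_one_powr_ge_zero)
  have "norm (ivl_deriv u t) \<le> (K1 + K2) * M"
    if u: "u \<in> smooth_ivl" and M: "\<And>t. t \<in> {-1..1} \<Longrightarrow> norm (jacobi_diff \<alpha> \<beta> u t) \<le> M"
      and t: "t \<in> {-1..1}" for u M t
  proof -
    have M0: "M \<ge> 0" using order_trans[OF norm_ge_zero M[of 0]] by simp
    let ?W = "jacobi_weight (\<alpha> + 1) (\<beta> + 1)" and ?f = "\<lambda>t. jacobi_weight (\<alpha> + 1) (\<beta> + 1) t *\<^sub>R ivl_deriv u t"
    have cont: "continuous_on {-1..1} ?f"
      by (intro continuous_on_scaleR jacobi_weight_continuous smooth_ivl_continuous smooth_ivl_deriv u assms)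
    have bound: "norm (jacobi_weight \<alpha> \<beta> x *\<^sub>R jacobi_diff \<alpha> \<beta> u x) \<le> jacobi_weight \<alpha> \<beta> x * M"
      if "-1 < x" "x < 1" for x
      using M[of x] that by (simp add: jacobi_weight_nonneg mult_left_mono)
    consider "t = -1" | "t = 1" | "-1 < t" "t \<le> 0" | "0 < t" "t < 1"
      using t by fastforce
    then have "norm (ivl_deriv u t) \<le> K1 * M \<or> norm (ivl_deriv u t) \<le> K2 * M"
    proof cases
      case 1
      have "jacobi_diff \<alpha> \<beta> u (-1) = complex_of_real (2 * (\<beta> + 1)) * ivl_deriv u (-1)"
        by (simp add: jacobi_diff_def algebra_simps)
      then have "2 * (\<beta> + 1) * norm (ivl_deriv u (-1)) \<le> M"
        using M[of "-1"] assms by (simp add: norm_mult del: of_real_mult of_real_add)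
      moreover have "M \<le> 2 * 2 powr \<bar>\<alpha>\<bar> * M"
        using two[of \<alpha>] M0 mult_right_mono[of 1 "2 * 2 powr \<bar>\<alpha>\<bar>" M] by simp
      ultimately have "norm (ivl_deriv u (-1)) \<le> K1 * M"
        using assms by (simp add: K1_def field_simps)
      then show ?thesis using 1 by simp
    next
      case 2
      have "jacobi_diff \<alpha> \<beta> u 1 = - (complex_of_real (2 * (\<alpha> + 1)) * ivl_deriv u 1)"
        by (simp add: jacobi_diff_def algebra_simps)
      then have "2 * (\<alpha> + 1) * norm (ivl_deriv u 1) \<le> M"
        using M[of 1] assms by (simp add: norm_mult del: of_real_mult of_real_add)
      moreover have "M \<le> 2 * 2 powr \<bar>\<beta>\<bar> * M"
        using two[of \<beta>] M0 mult_right_mono[of 1 "2 * 2 powr \<bar>\<beta>\<bar>" M] by simp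
      ultimately have "norm (ivl_deriv u 1) \<le> K2 * M"
        using assms by (simp add: K2_def field_simps)
      then show ?thesis using 2 by simp
    next
      case 3
      have "norm (?f t - ?f (-1)) \<le> K1 * M * (1 + t) powr (\<beta> + 1) - K1 * M * (1 + - 1) powr (\<beta> + 1)"
      proof (rule differentiable_bound_general)
        show "-1 < t" by fact
        show "continuous_on {-1..t} ?f"
          by (rule continuous_on_subset[OF cont]) (use 3 in auto)
        show "continuous_on {-1..t} (\<lambda>t. K1 * M * (1 + t) powr (\<beta> + 1))"
          using assms by (intro continuous_intros continuous_on_powr') auto
        fix x assume x: "-1 < x" "x < t"
        then show "(?f has_vector_derivative jacobi_weight \<alpha> \<beta> x *\<^sub>R jacobi_diff \<alpha> \<beta> u x) (at x)"
          using 3 by (intro jacobi_diff_divergence_form u) auto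
        show "((\<lambda>t. K1 * M * (1 + t) powr (\<beta> + 1)) has_vector_derivative
             2 powr \<bar>\<alpha>\<bar> * (1 + x) powr \<beta> * M) (at x)"
          using x assms unfolding has_real_derivative_iff_has_vector_derivative[symmetric] K1_def
          by (auto intro!: derivative_eq_intros)
        have "(1 - x) powr \<alpha> \<le> 2 powr \<bar>\<alpha>\<bar>"
          using x 3 by (intro powr_le_two_powr_abs) auto
        then have "jacobi_weight \<alpha> \<beta> x \<le> 2 powr \<bar>\<alpha>\<bar> * (1 + x) powr \<beta>"
          by (simp add: jacobi_weight_def mult_right_mono)
        from mult_right_mono[OF this M0]
        show "norm (jacobi_weight \<alpha> \<beta> x *\<^sub>R jacobi_diff \<alpha> \<beta> u x) \<le> 2 powr \<bar>\<alpha>\<bar> * (1 + x) powr \<beta> * M"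
          using bound[of x] x 3 by linarith
      qed
      then have "?W t * norm (ivl_deriv u t) \<le> K1 * M * (1 + t) powr (\<beta> + 1)"
        using assms by (simp add: jacobi_weight_def)
      note upper = this
      have "(1 + t) powr (\<beta> + 1) \<le> ?W t"
        unfolding jacobi_weight_def using 3 assms mult_right_mono[of 1 "(1 - t) powr (\<alpha> + 1)" "(1 + t) powr (\<beta> + 1)"]
        by (simp add: ge_one_powr_ge_zero)
      from mult_right_mono[OF this norm_ge_zero[of "ivl_deriv u t"]] upper
      have "(1 + t) powr (\<beta> + 1) * norm (ivl_deriv u t) \<le> (1 + t) powr (\<beta> + 1) * (K1 * M)"
        by (simp add: mult_ac)
      then show ?thesis using 3 by simp
    next
      case 4
      have "norm (?f 1 - ?f t) \<le> - (K2 * M * (1 - 1) powr (\<alpha> + 1)) - - (K2 * M * (1 - t) powr (\<alpha> + 1))"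
      proof (rule differentiable_bound_general)
        show "t < 1" by fact
        show "continuous_on {t..1} ?f"
          by (rule continuous_on_subset[OF cont]) (use 4 in auto)
        show "continuous_on {t..1} (\<lambda>t. - (K2 * M * (1 - t) powr (\<alpha> + 1)))"
          using assms by (intro continuous_intros continuous_on_powr') auto
        fix x assume x: "t < x" "x < 1"
        then show "(?f has_vector_derivative jacobi_weight \<alpha> \<beta> x *\<^sub>R jacobi_diff \<alpha> \<beta> u x) (at x)"
          using 4 by (intro jacobi_diff_divergence_form u) auto
        show "((\<lambda>t. - (K2 * M * (1 - t) powr (\<alpha> + 1))) has_vector_derivative
             2 powr \<bar>\<beta>\<bar> * (1 - x) powr \<alpha> * M) (at x)"
          using x assms unfolding has_real_derivative_iff_has_vector_derivative[symmetric] K2_def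
          by (auto intro!: derivative_eq_intros)
        have "(1 + x) powr \<beta> \<le> 2 powr \<bar>\<beta>\<bar>"
          using x 4 by (intro powr_le_two_powr_abs) auto
        then have "jacobi_weight \<alpha> \<beta> x \<le> 2 powr \<bar>\<beta>\<bar> * (1 - x) powr \<alpha>"
          by (simp add: jacobi_weight_def mult_left_mono mult.commute)
        from mult_right_mono[OF this M0]
        show "norm (jacobi_weight \<alpha> \<beta> x *\<^sub>R jacobi_diff \<alpha> \<beta> u x) \<le> 2 powr \<bar>\<beta>\<bar> * (1 - x) powr \<alpha> * M"
          using bound[of x] x 4 by linarith
      qed
      then have "?W t * norm (ivl_deriv u t) \<le> K2 * M * (1 - t) powr (\<alpha> + 1)"
        using assms by (simp add: jacobi_weight_def)
      note upper = this
      have "(1 - t) powr (\<alpha> + 1) \<le> ?W t"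
        unfolding jacobi_weight_def using 4 assms mult_left_mono[of 1 "(1 + t) powr (\<beta> + 1)" "(1 - t) powr (\<alpha> + 1)"]
        by (simp add: ge_one_powr_ge_zero)
      from mult_right_mono[OF this norm_ge_zero[of "ivl_deriv u t"]] upper
      have "(1 - t) powr (\<alpha> + 1) * norm (ivl_deriv u t) \<le> (1 - t) powr (\<alpha> + 1) * (K2 * M)"
        by (simp add: mult_ac)
      then show ?thesis using 4 by simp
    qed
    moreover have "K1 * M \<le> (K1 + K2) * M" "K2 * M \<le> (K1 + K2) * M"
      using K M0 by (auto simp: algebra_simps)
    ultimately show ?thesis by linarith
  qed
  then show ?thesis
    using K by (intro exI[of _ "K1 + K2"]) auto
qed

text \<open>
  The derivative of an eigenfunction is again an eigenfunction, for the operator with raised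
  parameters, so the first-order bound iterates.
\<close>

lemma jacobi_eigenfunction_deriv_bound:
  assumes "\<alpha> > -1" "\<beta> > -1"
  shows "\<exists>C\<ge>0. \<forall>l. \<forall>u\<in>smooth_ivl. \<forall>B.
     (\<forall>t\<in>{-1..1}. jacobi_diff \<alpha> \<beta> u t = l * u t) \<longrightarrow> (\<forall>t\<in>{-1..1}. norm (u t) \<le> B) \<longrightarrow>
     (\<forall>t\<in>{-1..1}. norm ((ivl_deriv ^^ k) u t) \<le> C * (1 + norm l) ^ k * B)"
  using assms
proof (induction k arbitrary: \<alpha> \<beta>)
  case 0
  show ?case by (rule exI[of _ 1]) auto
next
  case (Suc k)
  obtain C1 where C1: "C1 \<ge> 0" "\<forall>u\<in>smooth_ivl. \<forall>M. (\<forall>t\<in>{-1..1}. norm (jacobi_diff \<alpha> \<beta> u t) \<le> M) \<longrightarrow>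
     (\<forall>t\<in>{-1..1}. norm (ivl_deriv u t) \<le> C1 * M)"
    using jacobi_diff_controls_deriv[OF Suc.prems] by (elim exE conjE)
  have "\<alpha> + 1 > -1" "\<beta> + 1 > -1" using Suc.prems by auto
  from Suc.IH[OF this] obtain C2 where C2: "C2 \<ge> 0" "\<forall>l. \<forall>u\<in>smooth_ivl. \<forall>B.
     (\<forall>t\<in>{-1..1}. jacobi_diff (\<alpha> + 1) (\<beta> + 1) u t = l * u t) \<longrightarrow> (\<forall>t\<in>{-1..1}. norm (u t) \<le> B) \<longrightarrow>
     (\<forall>t\<in>{-1..1}. norm ((ivl_deriv ^^ k) u t) \<le> C2 * (1 + norm l) ^ k * B)"
    by (elim exE conjE)
  define c where "c = \<alpha> + \<beta> + 2"
  have c: "c \<ge> 0" using Suc.prems by (simp add: c_def)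
  have "norm ((ivl_deriv ^^ Suc k) u t) \<le> (C2 * (1 + c) ^ k * C1) * (1 + norm l) ^ Suc k * B"
    if u: "u \<in> smooth_ivl" and eig: "\<And>t. t \<in> {-1..1} \<Longrightarrow> jacobi_diff \<alpha> \<beta> u t = l * u t"
     and B: "\<And>t. t \<in> {-1..1} \<Longrightarrow> norm (u t) \<le> B" and t: "t \<in> {-1..1}" for l u B t
  proof -
    have B0: "B \<ge> 0" using order_trans[OF norm_ge_zero B[of 0]] by simp
    have 1: "norm (ivl_deriv u x) \<le> C1 * (norm l * B)" if "x \<in> {-1..1}" for x
      using that B by (intro C1(2)[rule_format] u) (auto simp: eig norm_mult mult_left_mono)
    have 2: "jacobi_diff (\<alpha> + 1) (\<beta> + 1) (ivl_deriv u) x = (l + complex_of_real c) * ivl_deriv u x"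
      if x: "x \<in> {-1..1}" for x
    proof -
      have "ivl_deriv (jacobi_diff \<alpha> \<beta> u) x = ivl_deriv (\<lambda>t. l * u t) x"
        using eig x by (rule ivl_deriv_cong)
      also have "\<dots> = l * ivl_deriv u x"
        by (intro ivl_deriv_eqI has_vector_derivative_mult_right smooth_ivl_has_deriv1 u x)
      finally show ?thesis
        unfolding jacobi_diff_deriv[OF u x] c_def by (simp add: algebra_simps)
    qed
    have "norm ((ivl_deriv ^^ k) (ivl_deriv u) t) \<le>
        C2 * (1 + norm (l + complex_of_real c)) ^ k * (C1 * (norm l * B))"
      using C2(2) smooth_ivl_deriv[OF u] 2 1 t by simp
    also have "\<dots> \<le> C2 * ((1 + c) * (1 + norm l)) ^ k * (C1 * ((1 + norm l) * B))"
    proof -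
      have "norm (l + complex_of_real c) \<le> norm l + c"
        using norm_triangle_ineq[of l "complex_of_real c"] c by simp
      then have "1 + norm (l + complex_of_real c) \<le> (1 + c) * (1 + norm l)"
        using c mult_nonneg_nonneg[OF c norm_ge_zero[of l]] unfolding ring_distribs by linarith
      then have "(1 + norm (l + complex_of_real c)) ^ k \<le> ((1 + c) * (1 + norm l)) ^ k"
        by (intro power_mono) auto
      moreover have "C1 * (norm l * B) \<le> C1 * ((1 + norm l) * B)"
        using C1(1) B0 by (simp add: mult_left_mono algebra_simps)
      ultimately show ?thesis
        using C1(1) C2(1) B0 c by (intro mult_mono mult_left_mono) auto
    qed
    finally show ?thesis
      by (simp add: funpow_swap1 power_mult_distrib mult_ac)
  qed
  moreover have "C2 * (1 + c) ^ k * C1 \<ge> 0" using C1(1) C2(1) c by simp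
  ultimately show ?case
    by (intro exI[of _ "C2 * (1 + c) ^ k * C1"] conjI allI ballI impI) auto
qed

section \<open>The weighted measure\<close>

lemma jacobi_weight_measurable [measurable]: "jacobi_weight \<alpha> \<beta> \<in> borel_measurable borel"
  unfolding jacobi_weight_def[abs_def] by measurable

lemma jacobi_weight_measurable_lebesgue [measurable]:
  "jacobi_weight \<alpha> \<beta> \<in> borel_measurable (lebesgue_on {-1..1})"
  by (intro measurable_restrict_space1 measurable_completion) simp

lemma space_jacobi_measure [simp]: "space (jacobi_measure \<alpha> \<beta>) = {-1..1}"
  by (simp add: jacobi_measure_def)

lemma measurable_jacobi_measure_iff:
  "f \<in> borel_measurable (jacobi_measure \<alpha> \<beta>) \<longleftrightarrow> f \<in> borel_measurable (lebesgue_on {-1..1})"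
  by (simp add: jacobi_measure_def)

lemma continuous_on_measurable_jacobi_measure:
  fixes f :: "real \<Rightarrow> 'b::euclidean_space"
  assumes "continuous_on {-1..1} f"
  shows "f \<in> borel_measurable (jacobi_measure \<alpha> \<beta>)"
  unfolding measurable_jacobi_measure_iff
  by (rule continuous_imp_measurable_on_sets_lebesgue[OF assms]) simp

lemma integral_jacobi_measure:
  fixes f :: "real \<Rightarrow> 'b::{banach, second_countable_topology}"
  assumes "f \<in> borel_measurable (jacobi_measure \<alpha> \<beta>)"
  shows "(\<integral>t. f t \<partial>jacobi_measure \<alpha> \<beta>) = (\<integral>t. jacobi_weight \<alpha> \<beta> t *\<^sub>R f t \<partial>lebesgue_on {-1..1})"
  using assms unfolding measurable_jacobi_measure_iff jacobi_measure_def
  by (intro integral_density) (auto simp: jacobi_weight_nonneg)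

lemma integrable_jacobi_measure_iff:
  fixes f :: "real \<Rightarrow> 'b::{banach, second_countable_topology}"
  assumes "f \<in> borel_measurable (jacobi_measure \<alpha> \<beta>)"
  shows "integrable (jacobi_measure \<alpha> \<beta>) f \<longleftrightarrow>
     integrable (lebesgue_on {-1..1}) (\<lambda>t. jacobi_weight \<alpha> \<beta> t *\<^sub>R f t)"
  using assms unfolding measurable_jacobi_measure_iff jacobi_measure_def
  by (intro integrable_density) (auto simp: jacobi_weight_nonneg)

lemma AE_jacobi_measureI:
  assumes "AE t in lebesgue. t \<in> {-1..1} \<longrightarrow> P t"
  shows "AE t in jacobi_measure \<alpha> \<beta>. P t"
proof -
  have "AE t in lebesgue_on {-1..1}. P t"
    using assms by (subst AE_restrict_space_iff) auto
  then show ?thesis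
    unfolding jacobi_measure_def by (subst AE_density) auto
qed

lemma integrable_jacobi_weight:
  assumes "\<alpha> > -1" "\<beta> > -1"
  shows "integrable (lebesgue_on {-1..1}) (jacobi_weight \<alpha> \<beta>)"
proof -
  have 1: "((\<lambda>t. (1 + t) powr \<beta>) has_integral
      ((1 + 1) powr (\<beta> + 1) / (\<beta> + 1) - (1 + -1) powr (\<beta> + 1) / (\<beta> + 1))) {-1..1::real}"
    using assms by (intro fundamental_theorem_of_calculus_interior)
      (auto intro!: derivative_eq_intros continuous_intros continuous_on_powr'
         simp: has_real_derivative_iff_has_vector_derivative[symmetric])
  have 2: "((\<lambda>t. (1 - t) powr \<alpha>) has_integral
      (- ((1 - 1) powr (\<alpha> + 1) / (\<alpha> + 1)) - - ((1 - -1) powr (\<alpha> + 1) / (\<alpha> + 1)))) {-1..1::real}"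
    using assms by (intro fundamental_theorem_of_calculus_interior)
      (auto intro!: derivative_eq_intros continuous_intros continuous_on_powr'
         simp: has_real_derivative_iff_has_vector_derivative[symmetric])
  have i: "integrable (lebesgue_on {-1..1}) f"
    if "(f has_integral I) {-1..1::real}" "\<And>t. f t \<ge> 0" for f :: "real \<Rightarrow> real" and I
    using that by (intro absolutely_integrable_imp_integrable nonnegative_absolutely_integrable_1) auto
  have "integrable (lebesgue_on {-1..1})
      (\<lambda>t. 2 powr \<bar>\<alpha>\<bar> * (1 + t) powr \<beta> + 2 powr \<bar>\<beta>\<bar> * (1 - t) powr \<alpha>)"
    using i[OF 1] i[OF 2] by simp
  then show ?thesis
  proof (rule Bochner_Integration.integrable_bound)
    show "AE t in lebesgue_on {-1..1}. norm (jacobi_weight \<alpha> \<beta> t)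
       \<le> norm (2 powr \<bar>\<alpha>\<bar> * (1 + t) powr \<beta> + 2 powr \<bar>\<beta>\<bar> * (1 - t) powr \<alpha>)"
    proof (intro AE_I2)
      fix t :: real assume "t \<in> space (lebesgue_on {-1..1})"
      then have t: "-1 \<le> t" "t \<le> 1" by auto
      have "jacobi_weight \<alpha> \<beta> t \<le> 2 powr \<bar>\<alpha>\<bar> * (1 + t) powr \<beta> + 2 powr \<bar>\<beta>\<bar> * (1 - t) powr \<alpha>"
      proof (cases "t \<le> 0")
        case True
        then have "(1 - t) powr \<alpha> * (1 + t) powr \<beta> \<le> 2 powr \<bar>\<alpha>\<bar> * (1 + t) powr \<beta>"
          using t by (intro mult_right_mono powr_le_two_powr_abs) auto
        then show ?thesis by (simp add: jacobi_weight_def add_increasing2)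
      next
        case False
        then have "(1 - t) powr \<alpha> * (1 + t) powr \<beta> \<le> (1 - t) powr \<alpha> * 2 powr \<bar>\<beta>\<bar>"
          using t by (intro mult_left_mono powr_le_two_powr_abs) auto
        then show ?thesis by (simp add: jacobi_weight_def add_increasing mult.commute)
      qed
      then show "norm (jacobi_weight \<alpha> \<beta> t)
       \<le> norm (2 powr \<bar>\<alpha>\<bar> * (1 + t) powr \<beta> + 2 powr \<bar>\<beta>\<bar> * (1 - t) powr \<alpha>)"
        using jacobi_weight_nonneg[of \<alpha> \<beta> t] by simp
    qed
  qed simp
qed

lemma finite_measure_jacobi_measure:
  assumes "\<alpha> > -1" "\<beta> > -1"
  shows "finite_measure (jacobi_measure \<alpha> \<beta>)"
proof -
  have "integrable (jacobi_measure \<alpha> \<beta>) (\<lambda>_. 1::real)"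
    using integrable_jacobi_weight[OF assms] by (subst integrable_jacobi_measure_iff) auto
  then have "emeasure (jacobi_measure \<alpha> \<beta>) (space (jacobi_measure \<alpha> \<beta>)) < \<infinity>"
    by (simp add: integrable_iff_bounded)
  then show ?thesis by (intro finite_measureI) auto
qed

lemma continuous_on_integrable_jacobi_measure:
  fixes f :: "real \<Rightarrow> 'b::euclidean_space"
  assumes "\<alpha> > -1" "\<beta> > -1" and f: "continuous_on {-1..1} f"
  shows "integrable (jacobi_measure \<alpha> \<beta>) f"
proof -
  interpret finite_measure "jacobi_measure \<alpha> \<beta>" by (rule finite_measure_jacobi_measure) fact+
  have "bounded (f ` {-1..1})"
    using f compact_continuous_image compact_imp_bounded by blast
  then obtain B where "\<forall>t\<in>{-1..1}. norm (f t) \<le> B"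
    unfolding bounded_iff by (auto simp: ball_simps)
  then show ?thesis
    by (intro integrable_const_bound[where B = B] continuous_on_measurable_jacobi_measure f AE_I2) auto
qed

text \<open>
  Green's formula: \<open>w (v T u - u T v)\<close> is the derivative of \<open>W (u' v - u v')\<close>, and \<open>W\<close>
  vanishes at both endpoints.
\<close>

lemma jacobi_diff_symmetric:
  assumes ab: "\<alpha> > -1" "\<beta> > -1" and u: "u \<in> smooth_ivl" and v: "v \<in> smooth_ivl"
  shows "(\<integral>t. jacobi_diff \<alpha> \<beta> u t * v t \<partial>jacobi_measure \<alpha> \<beta>) =
         (\<integral>t. u t * jacobi_diff \<alpha> \<beta> v t \<partial>jacobi_measure \<alpha> \<beta>)"
proof -
  let ?M = "jacobi_measure \<alpha> \<beta>" and ?T = "jacobi_diff \<alpha> \<beta>"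
  define G where "G t = ivl_deriv u t * v t - u t * ivl_deriv v t" for t
  define h where "h t = ?T u t * v t - u t * ?T v t" for t
  note cont = smooth_ivl_continuous smooth_ivl_deriv smooth_ivl_jacobi_diff
  have "((\<lambda>t. jacobi_weight \<alpha> \<beta> t *\<^sub>R h t) has_integral
      (jacobi_weight (\<alpha> + 1) (\<beta> + 1) 1 *\<^sub>R G 1 - jacobi_weight (\<alpha> + 1) (\<beta> + 1) (-1) *\<^sub>R G (-1))) {-1..1}"
  proof (rule fundamental_theorem_of_calculus_interior)
    show "continuous_on {-1..1} (\<lambda>t. jacobi_weight (\<alpha> + 1) (\<beta> + 1) t *\<^sub>R G t)"
      unfolding G_def by (intro continuous_intros jacobi_weight_continuous ab cont u v)
    fix t :: real assume "t \<in> {-1<..<1}"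
    then have t: "-1 < t" "t < 1" by auto
    have d: "(f has_vector_derivative ivl_deriv f t) (at t)" if "f \<in> smooth_ivl" for f
      using smooth_ivl_has_deriv1[OF that, of t] t by (simp add: at_within_Icc_at)
    have "(G has_vector_derivative (ivl_deriv u t * ivl_deriv v t + ivl_deriv (ivl_deriv u) t * v t
       - (u t * ivl_deriv (ivl_deriv v) t + ivl_deriv u t * ivl_deriv v t))) (at t)"
      unfolding G_def[abs_def]
      by (intro has_vector_derivative_diff has_vector_derivative_mult d smooth_ivl_deriv u v)
    then have G: "(G has_vector_derivative (ivl_deriv (ivl_deriv u) t * v t - u t * ivl_deriv (ivl_deriv v) t)) (at t)"
      by simp
    have "(1 - t\<^sup>2) *\<^sub>R (ivl_deriv (ivl_deriv u) t * v t - u t * ivl_deriv (ivl_deriv v) t)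
       + (\<beta> - \<alpha> - (\<alpha> + \<beta> + 2) * t) *\<^sub>R G t = h t"
      unfolding h_def G_def jacobi_diff_def scaleR_conv_of_real by algebra
    then show "((\<lambda>t. jacobi_weight (\<alpha> + 1) (\<beta> + 1) t *\<^sub>R G t) has_vector_derivative
        jacobi_weight \<alpha> \<beta> t *\<^sub>R h t) (at t)"
      using jacobi_weight_has_deriv[OF t G, of \<alpha> \<beta>] by simp
  qed simp
  then have "((\<lambda>t. jacobi_weight \<alpha> \<beta> t *\<^sub>R h t) has_integral 0) {-1..1}"
    using ab by (simp add: jacobi_weight_def)
  moreover have hc: "continuous_on {-1..1} h"
    unfolding h_def by (intro continuous_intros cont u v)
  then have "integrable (lebesgue_on {-1..1}) (\<lambda>t. jacobi_weight \<alpha> \<beta> t *\<^sub>R h t)"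
    using continuous_on_integrable_jacobi_measure[OF ab hc]
    by (simp add: integrable_jacobi_measure_iff continuous_on_measurable_jacobi_measure)
  ultimately have "(\<integral>t. h t \<partial>?M) = 0"
    using integral_jacobi_measure[OF continuous_on_measurable_jacobi_measure[OF hc], of \<alpha> \<beta>]
    by (simp add: lebesgue_integral_eq_integral integral_unique)
  moreover have "integrable ?M (\<lambda>t. ?T u t * v t)" "integrable ?M (\<lambda>t. u t * ?T v t)"
    by (intro continuous_on_integrable_jacobi_measure ab continuous_intros cont u v)+
  ultimately show ?thesis by (simp add: h_def)
qed

lemma smooth_ivl_mean_value:
  assumes u: "u \<in> smooth_ivl" and K: "\<And>t. t \<in> {-1..1} \<Longrightarrow> norm (ivl_deriv u t) \<le> K"
    and "x \<in> {-1..1}" "y \<in> {-1..1}"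
  shows "norm (u x - u y) \<le> K * \<bar>x - y\<bar>"
proof -
  have "norm (u x - u y) \<le> K * norm (x - y)"
  proof (rule differentiable_bound[of "{-1..1}" u "\<lambda>t h. h *\<^sub>R ivl_deriv u t"])
    fix t :: real assume t: "t \<in> {-1..1}"
    show "(u has_derivative (\<lambda>h. h *\<^sub>R ivl_deriv u t)) (at t within {-1..1})"
      using smooth_ivl_has_deriv1[OF u t] unfolding has_vector_derivative_def .
    show "onorm (\<lambda>h. h *\<^sub>R ivl_deriv u t) \<le> K"
      by (rule onorm_le) (use mult_right_mono[OF K[OF t] abs_ge_zero] in \<open>simp add: mult.commute\<close>)
  qed (use assms in auto)
  then show ?thesis by simp
qed

lemma powr_ge_eighth_powr_abs:
  fixes d x a :: real
  assumes "0 < d" "d \<le> 1" "d / 4 \<le> x" "x \<le> 2"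
  shows "(d / 8) powr \<bar>a\<bar> \<le> x powr a"
proof (cases "a \<ge> 0")
  case True
  then show ?thesis using assms by (auto intro: powr_mono2)
next
  case False
  have "(d / 8) powr \<bar>a\<bar> \<le> (1 / 2) powr \<bar>a\<bar>"
    using assms by (intro powr_mono2) auto
  also have "\<dots> = 2 powr a"
    using False by (simp add: powr_divide powr_minus_divide)
  also have "\<dots> \<le> x powr a"
    using False assms by (intro powr_mono2') auto
  finally show ?thesis .
qed

text \<open>
  A Nikolskii-type inequality. Since \<open>\<bar>u'\<bar> \<le> L \<bar>u(t\<^sub>0)\<bar>\<close>, the function stays above half its maximum
  on an interval of length \<open>1 / (2 L)\<close> that has \<open>t\<^sub>0\<close> as an endpoint, and the weight of the middle half of
  that interval is at least a fixed power of its length.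
\<close>

lemma jacobi_L2_lower_bound:
  fixes K :: nat
  assumes ab: "\<alpha> > -1" "\<beta> > -1" and u: "u \<in> smooth_ivl"
    and B: "\<And>t. t \<in> {-1..1} \<Longrightarrow> norm (u t) \<le> norm (u t0)" and t0: "t0 \<in> {-1..1}"
    and d: "\<And>t. t \<in> {-1..1} \<Longrightarrow> norm (ivl_deriv u t) \<le> L * norm (u t0)" and L: "L \<ge> 1"
    and K: "\<bar>\<alpha>\<bar> + \<bar>\<beta>\<bar> + 1 \<le> real K"
  shows "(\<integral>t. (norm (u t))\<^sup>2 \<partial>jacobi_measure \<alpha> \<beta>) \<ge> (norm (u t0))\<^sup>2 / 4 * (1 / (16 * L)) ^ K"
proof -
  define \<delta> where "\<delta> = 1 / (2 * L)"
  have \<delta>: "0 < \<delta>" "\<delta> \<le> 1 / 2" using L by (auto simp: \<delta>_def)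
  \<comment> \<open>The interval extends from \<open>t\<^sub>0\<close> towards the centre, to stay inside \<open>[-1, 1]\<close>; keeping only its
    middle half \<open>J\<close> bounds the distance to both endpoints from below, where \<open>w\<close> may vanish.\<close>
  define c where "c = (if t0 \<le> 0 then t0 + \<delta> / 4 else t0 - 3 * \<delta> / 4)"
  define J where "J = {c..c + \<delta> / 2}"
  have J: "t \<in> {-1..1}" "\<bar>t - t0\<bar> \<le> \<delta>" "1 - t \<ge> \<delta> / 4" "1 - t \<le> 2" "1 + t \<ge> \<delta> / 4" "1 + t \<le> 2" if "t \<in> J" for t
    using that t0 \<delta> by (auto simp: J_def c_def abs_if split: if_splits)
  define m where "m = (norm (u t0))\<^sup>2 / 4 * (\<delta> / 8) powr (\<bar>\<alpha>\<bar> + \<bar>\<beta>\<bar>)"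
  let ?L = "lebesgue_on {-1..1::real}"
  have ucont: "continuous_on {-1..1} (\<lambda>t. (norm (u t))\<^sup>2)"
    by (intro continuous_intros smooth_ivl_continuous u)
  have ms: "emeasure ?L J = ennreal (\<delta> / 2)"
    using J(1) \<delta> by (subst emeasure_restrict_space) (auto simp: J_def)
  have Jsets: "J \<in> sets ?L"
    using J(1) by (auto simp: sets_restrict_space_iff J_def)
  have "(norm (u t0))\<^sup>2 / 4 * (1 / (16 * L)) ^ K = (norm (u t0))\<^sup>2 / 4 * (\<delta> / 8) powr real K"
    using \<delta> by (simp add: powr_realpow \<delta>_def)
  also have "\<dots> \<le> (norm (u t0))\<^sup>2 / 4 * (\<delta> / 8) powr (\<bar>\<alpha>\<bar> + \<bar>\<beta>\<bar> + 1)"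
    using \<delta> K by (intro mult_left_mono powr_mono') auto
  also have "\<dots> \<le> m * (\<delta> / 2)"
    using \<delta> by (simp add: m_def powr_add mult_left_mono)
  also have "\<dots> = (\<integral>t. m * indicator J t \<partial>?L)"
    using ms Jsets \<delta> Int_absorb2[of J "{-1..1}"] J(1) by (simp add: measure_def subset_iff)
  also have "\<dots> \<le> (\<integral>t. jacobi_weight \<alpha> \<beta> t *\<^sub>R (norm (u t))\<^sup>2 \<partial>?L)"
  proof (rule integral_mono)
    show "integrable ?L (\<lambda>t. m * indicator J t)"
      using ms Jsets by (intro integrable_mult_right integrable_real_indicator) auto
    show "integrable ?L (\<lambda>t. jacobi_weight \<alpha> \<beta> t *\<^sub>R (norm (u t))\<^sup>2)"
      using continuous_on_integrable_jacobi_measure[OF ab ucont]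
      by (simp add: integrable_jacobi_measure_iff continuous_on_measurable_jacobi_measure[OF ucont])
    fix t assume "t \<in> space ?L"
    show "m * indicator J t \<le> jacobi_weight \<alpha> \<beta> t *\<^sub>R (norm (u t))\<^sup>2"
    proof (cases "t \<in> J")
      case True
      have "norm (u t0 - u t) \<le> L * norm (u t0) * \<bar>t0 - t\<bar>"
        using smooth_ivl_mean_value[OF u d t0 J(1)[OF True]] .
      also have "\<dots> \<le> L * norm (u t0) * \<delta>"
        using J(2)[OF True] L by (intro mult_left_mono) auto
      also have "\<dots> = norm (u t0) / 2"
        using L by (simp add: \<delta>_def)
      finally have "norm (u t0) / 2 \<le> norm (u t)"
        using norm_triangle_sub[of "u t0" "u t"] by linarith
      then have 1: "(norm (u t0))\<^sup>2 / 4 \<le> (norm (u t))\<^sup>2"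
        using power_mono[of "norm (u t0) / 2" "norm (u t)" 2] by (simp add: power_divide)
      have 2: "(\<delta> / 8) powr (\<bar>\<alpha>\<bar> + \<bar>\<beta>\<bar>) \<le> jacobi_weight \<alpha> \<beta> t"
        unfolding jacobi_weight_def powr_add using J[OF True] \<delta>
        by (intro mult_mono powr_ge_eighth_powr_abs) auto
      have "m \<le> (norm (u t))\<^sup>2 * jacobi_weight \<alpha> \<beta> t"
        unfolding m_def by (intro mult_mono 1 2) auto
      then show ?thesis using True by (simp add: mult.commute)
    qed (simp add: jacobi_weight_nonneg)
  qed
  also have "\<dots> = (\<integral>t. (norm (u t))\<^sup>2 \<partial>jacobi_measure \<alpha> \<beta>)"
    by (rule integral_jacobi_measure[symmetric, OF continuous_on_measurable_jacobi_measure[OF ucont]])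
  finally show ?thesis .
qed

text \<open>
  An integrable function orthogonal to all powers is orthogonal to all continuous functions by
  Weierstrass approximation, and then to all bounded measurable functions by dominated
  convergence, in particular to the signs of its real and imaginary parts.
\<close>

lemma AE_zero_if_moments_zero:
  fixes f :: "real \<Rightarrow> complex"
  assumes ab: "\<alpha> > -1" "\<beta> > -1" and f: "integrable (jacobi_measure \<alpha> \<beta>) f"
    and mom: "\<And>k. (\<integral>t. f t * complex_of_real (t ^ k) \<partial>jacobi_measure \<alpha> \<beta>) = 0"
  shows "AE t in jacobi_measure \<alpha> \<beta>. f t = 0"
proof -
  let ?M = "jacobi_measure \<alpha> \<beta>"
  have [measurable]: "f \<in> borel_measurable ?M" using f by auto
  have nb: "norm (z * complex_of_real r) \<le> norm (C *\<^sub>R z)" if "\<bar>r\<bar> \<le> C" for z r C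
    using that by (simp add: norm_mult mult.commute[of "norm z"] mult_right_mono)
  have int: "integrable ?M (\<lambda>t. f t * complex_of_real (s t))"
    if "s \<in> borel_measurable ?M" "\<And>t. t \<in> {-1..1} \<Longrightarrow> \<bar>s t\<bar> \<le> C" for s C
  proof (rule Bochner_Integration.integrable_bound)
    show "integrable ?M (\<lambda>t. C *\<^sub>R f t)" using f by simp
    show "AE t in ?M. norm (f t * complex_of_real (s t)) \<le> norm (C *\<^sub>R f t)"
      by (intro AE_I2 nb that(2)) simp
  qed (use that in measurable)
  have lim: "(\<integral>t. f t * complex_of_real (s t) \<partial>?M) = 0"
    if [measurable]: "\<And>n. S n \<in> borel_measurable ?M" "s \<in> borel_measurable ?M"
      and bd: "\<And>n t. t \<in> {-1..1} \<Longrightarrow> \<bar>S n t\<bar> \<le> C"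
      and z: "\<And>n::nat. (\<integral>t. f t * complex_of_real (S n t) \<partial>?M) = 0"
      and conv: "AE t in ?M. (\<lambda>n. S n t) \<longlonglongrightarrow> s t" for S s and C :: real
  proof -
    have "(\<lambda>n. \<integral>t. f t * complex_of_real (S n t) \<partial>?M) \<longlonglongrightarrow> (\<integral>t. f t * complex_of_real (s t) \<partial>?M)"
    proof (rule integral_dominated_convergence)
      show "integrable ?M (\<lambda>t. norm (C *\<^sub>R f t))" using f by simp
      show "AE t in ?M. (\<lambda>n. f t * complex_of_real (S n t)) \<longlonglongrightarrow> f t * complex_of_real (s t)"
        using conv by eventually_elim (intro tendsto_intros)
      show "AE t in ?M. norm (f t * complex_of_real (S n t)) \<le> norm (C *\<^sub>R f t)" for n
        by (intro AE_I2 nb bd) simp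
    qed measurable
    then show ?thesis using z by (simp add: LIMSEQ_const_iff)
  qed
  have poly: "(\<integral>t. f t * complex_of_real (q t) \<partial>?M) = 0" if pq: "real_polynomial_function q" for q
  proof -
    obtain a n where q: "q = (\<lambda>x. \<Sum>i\<le>n. a i * x ^ i)"
      using pq unfolding real_polynomial_function_iff_sum by blast
    have m: "integrable ?M (\<lambda>t. f t * complex_of_real (t ^ i))" for i
    proof (rule int)
      show "(\<lambda>t. t ^ i) \<in> borel_measurable ?M"
        by (intro continuous_on_measurable_jacobi_measure continuous_intros)
      show "\<bar>t ^ i\<bar> \<le> 1" if "t \<in> {-1..1}" for t :: real
        using power_le_one[of "\<bar>t\<bar>" i] that by (auto simp: power_abs)
    qed
    have "(\<integral>t. f t * complex_of_real (q t) \<partial>?M)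
        = (\<integral>t. (\<Sum>i\<le>n. of_real (a i) * (f t * complex_of_real (t ^ i))) \<partial>?M)"
      by (intro Bochner_Integration.integral_cong refl) (simp add: q sum_distrib_left mult_ac)
    also have "\<dots> = (\<Sum>i\<le>n. of_real (a i) * (\<integral>t. f t * complex_of_real (t ^ i) \<partial>?M))"
      using m by (subst Bochner_Integration.integral_sum) auto
    finally show ?thesis unfolding mom by simp
  qed
  have contz: "(\<integral>t. f t * complex_of_real (g t) \<partial>?M) = 0" if g: "continuous_on {-1..1} g" for g
  proof -
    have "\<exists>q. real_polynomial_function q \<and> (\<forall>x\<in>{-1..1}. \<bar>g x - q x\<bar> < 1 / real (Suc n))" for n
      by (rule Stone_Weierstrass_real_polynomial_function[OF _ g, of "1 / real (Suc n)"]) auto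
    then obtain Q where Q: "\<And>n. real_polynomial_function (Q n)"
       "\<And>n x. x \<in> {-1..1} \<Longrightarrow> \<bar>g x - Q n x\<bar> < 1 / real (Suc n)" by metis
    have "bounded (g ` {-1..1})"
      using g compact_continuous_image compact_imp_bounded by blast
    then obtain B where B: "\<forall>t\<in>{-1..1}. \<bar>g t\<bar> \<le> B"
      unfolding bounded_iff by (auto simp: ball_simps)
    show ?thesis
    proof (rule lim[of Q g "B + 1"])
      show "Q n \<in> borel_measurable ?M" for n
      proof (intro continuous_on_measurable_jacobi_measure)
        show "continuous_on {-1..1} (Q n)"
          using continuous_on_polymonial_function[of "Q n"] Q(1)[of n]
          by (simp add: real_polynomial_function_eq)
      qed
      show "g \<in> borel_measurable ?M" by (intro continuous_on_measurable_jacobi_measure g)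
      show "\<bar>Q n t\<bar> \<le> B + 1" if "t \<in> {-1..1}" for n t
      proof -
        have "1 / real (Suc n) \<le> 1" by simp
        then show ?thesis using Q(2)[OF that, of n] B[rule_format, OF that] by linarith
      qed
      show "AE t in ?M. (\<lambda>n. Q n t) \<longlonglongrightarrow> g t"
      proof (intro AE_I2)
        fix t assume "t \<in> space ?M"
        then have t: "t \<in> {-1..1}" by simp
        have "(\<lambda>n. Q n t - g t) \<longlonglongrightarrow> 0"
        proof (rule Lim_null_comparison)
          show "\<forall>\<^sub>F n in sequentially. norm (Q n t - g t) \<le> 1 / real (Suc n)"
            using Q(2)[OF t] by (simp add: abs_minus_commute less_imp_le)
          show "(\<lambda>n. 1 / real (Suc n)) \<longlonglongrightarrow> 0"
            using LIMSEQ_inverse_real_of_nat by (simp add: inverse_eq_divide)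
        qed
        then show "(\<lambda>n. Q n t) \<longlonglongrightarrow> g t" by (simp add: LIM_zero_iff)
      qed
    qed (use poly Q(1) in blast)
  qed
  have bdd: "(\<integral>t. f t * complex_of_real (s t) \<partial>?M) = 0"
    if s: "s \<in> borel_measurable ?M" and s1: "\<And>t. \<bar>s t\<bar> \<le> 1" for s
  proof -
    have "s measurable_on {-1..1}"
      using s unfolding measurable_jacobi_measure_iff by (subst measurable_on_iff_borel_measurable) auto
    then obtain N G where N: "negligible N" and G: "\<And>n. continuous_on UNIV (G n)"
      and GN: "\<And>x. x \<notin> N \<Longrightarrow> (\<lambda>n. G n x) \<longlonglongrightarrow> (if x \<in> {-1..1} then s x else 0)"
      unfolding measurable_on_def by blast
    \<comment> \<open>Truncation gives a common bound and keeps the limit, because \<open>\<bar>s\<bar> \<le> 1\<close>.\<close>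
    define S where "S n t = max (-1) (min 1 (G n t))" for n t
    have Sc: "continuous_on {-1..1} (S n)" for n
      unfolding S_def by (intro continuous_intros continuous_on_subset[OF G]) auto
    show ?thesis
    proof (rule lim[of S s 1])
      show "S n \<in> borel_measurable ?M" for n by (intro continuous_on_measurable_jacobi_measure Sc)
      show "\<bar>S n t\<bar> \<le> 1" for n t by (auto simp: S_def)
      show "(\<integral>t. f t * complex_of_real (S n t) \<partial>?M) = 0" for n by (intro contz Sc)
      show "AE t in ?M. (\<lambda>n. S n t) \<longlonglongrightarrow> s t"
      proof (intro AE_jacobi_measureI)
        have "AE t in lebesgue. t \<notin> N"
          using N by (intro AE_not_in) (simp add: negligible_iff_null_sets)
        then show "AE t in lebesgue. t \<in> {-1..1} \<longrightarrow> (\<lambda>n. S n t) \<longlonglongrightarrow> s t"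
        proof eventually_elim
          case (elim t)
          show ?case
          proof
            assume "t \<in> {-1..1}"
            then have "(\<lambda>n. G n t) \<longlonglongrightarrow> s t" using GN[OF elim] by simp
            then have "(\<lambda>n. S n t) \<longlonglongrightarrow> max (-1) (min 1 (s t))"
              unfolding S_def by (intro tendsto_intros)
            moreover have "max (-1) (min 1 (s t)) = s t" using s1[of t] by linarith
            ultimately show "(\<lambda>n. S n t) \<longlonglongrightarrow> s t" by simp
          qed
        qed
      qed
    qed (use s in auto)
  qed
  have part: "AE t in ?M. T (f t) = 0"
    if T: "bounded_linear T" "\<And>z r. T (z * complex_of_real r) = T z * r" for T :: "complex \<Rightarrow> real"
  proof -
    have [measurable]: "T \<in> borel_measurable borel"
      using T(1) by (intro borel_measurable_continuous_onI bounded_linear.continuous_on[OF _ continuous_on_id])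
    let ?s = "\<lambda>t. sgn (T (f t))"
    have s: "?s \<in> borel_measurable ?M" by measurable
    have s1: "\<And>t. \<bar>?s t\<bar> \<le> 1" by (simp add: abs_sgn_eq)
    have i: "integrable ?M (\<lambda>t. f t * complex_of_real (?s t))" by (rule int) (use s s1 in auto)
    have "(\<integral>t. \<bar>T (f t)\<bar> \<partial>?M) = (\<integral>t. T (f t * complex_of_real (?s t)) \<partial>?M)"
      by (simp add: T(2) abs_sgn)
    also have "\<dots> = T (\<integral>t. f t * complex_of_real (?s t) \<partial>?M)"
      by (rule integral_bounded_linear[OF T(1) i])
    also have "\<dots> = 0"
      using bdd[OF s s1] T(1) by (simp add: linear_simps)
    finally have "(\<integral>t. \<bar>T (f t)\<bar> \<partial>?M) = 0" .
    moreover have "integrable ?M (\<lambda>t. \<bar>T (f t)\<bar>)"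
      using integrable_bounded_linear[OF T(1) f] by simp
    ultimately show ?thesis by (subst (asm) integral_nonneg_eq_0_iff_AE) auto
  qed
  have "AE t in ?M. Re (f t) = 0" "AE t in ?M. Im (f t) = 0"
    by (rule part; simp add: bounded_linear_Re bounded_linear_Im)+
  then show ?thesis
    by eventually_elim (simp add: complex_eq_iff)
qed

section \<open>Jacobi polynomials\<close>

abbreviation (input) jacobi_ev :: "real \<Rightarrow> real \<Rightarrow> nat \<Rightarrow> complex" where
  "jacobi_ev \<alpha> \<beta> n \<equiv> complex_of_real (- (real n * (real n + \<alpha> + \<beta> + 1)))"

lemma norm_jacobi_ev:
  assumes "\<alpha> + \<beta> + 1 \<ge> 0"
  shows "norm (jacobi_ev \<alpha> \<beta> n) = real n * (real n + (\<alpha> + \<beta> + 1))"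
  unfolding norm_of_real abs_minus_cancel using assms by (subst abs_of_nonneg) (auto simp: add_ac)

lemma norm_jacobi_ev_ge: "\<alpha> + \<beta> + 1 \<ge> 0 \<Longrightarrow> (real n)\<^sup>2 \<le> norm (jacobi_ev \<alpha> \<beta> n)"
  by (simp only: norm_jacobi_ev) (simp add: power2_eq_square mult_left_mono)

lemma jacobi_ev_inject:
  assumes "\<alpha> + \<beta> + 1 \<ge> 0"
  shows "jacobi_ev \<alpha> \<beta> m = jacobi_ev \<alpha> \<beta> n \<longleftrightarrow> m = n"
proof -
  have less: "real i * (real i + (\<alpha> + \<beta> + 1)) < real j * (real j + (\<alpha> + \<beta> + 1))" if "i < j" for i j
    using that assms by (intro mult_strict_mono') auto
  have "norm (jacobi_ev \<alpha> \<beta> m) \<noteq> norm (jacobi_ev \<alpha> \<beta> n)" if "m \<noteq> n"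
    using less[of m n] less[of n m] that unfolding norm_jacobi_ev[OF assms] by linarith
  then show ?thesis by metis
qed

lemma finite_jacobi_ev_bounded:
  assumes "\<alpha> + \<beta> + 1 \<ge> 0"
  shows "finite {n. norm (jacobi_ev \<alpha> \<beta> n) \<le> R}"
proof (rule finite_subset)
  show "{n. norm (jacobi_ev \<alpha> \<beta> n) \<le> R} \<subseteq> {..nat \<lceil>R\<rceil>}"
  proof safe
    fix n assume n: "norm (jacobi_ev \<alpha> \<beta> n) \<le> R"
    have "real n \<le> (real n)\<^sup>2" by (cases n) (auto simp: power2_eq_square)
    also have "\<dots> \<le> R" using norm_jacobi_ev_ge[OF assms, of n] n by linarith
    finally show "n \<le> nat \<lceil>R\<rceil>" by linarith
  qed
qed simp

subsection \<open>The eigenvalue equation\<close>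

lemma smooth_ivl_power: "(\<lambda>t. complex_of_real (((1 - t) / 2) ^ k)) \<in> smooth_ivl"
proof (induction k)
  case (Suc k)
  show ?case
    using smooth_ivl_affine_mult[OF Suc, of "1 / 2" "- 1 / 2"] by (simp add: diff_divide_distrib)
qed (simp add: smooth_ivl_const)

lemma jacobi_diff_power:
  assumes t: "t \<in> {-1..1}"
  shows "jacobi_diff \<alpha> \<beta> (\<lambda>t. complex_of_real (((1 - t) / 2) ^ k)) t = complex_of_real
     (real k * (real k + \<alpha>) * ((1 - t) / 2) ^ (k - 1)
       - real k * (real k + (\<alpha> + \<beta> + 1)) * ((1 - t) / 2) ^ k)"
proof -
  have d1: "ivl_deriv (\<lambda>t. complex_of_real (((1 - t) / 2) ^ k)) t =
      complex_of_real (- (real k / 2) * ((1 - t) / 2) ^ (k - 1))" if "t \<in> {-1..1}" for t k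
    by (intro ivl_deriv_eqI that has_vector_derivative_of_real)
       (auto intro!: derivative_eq_intros)
  have d2: "ivl_deriv (ivl_deriv (\<lambda>t. complex_of_real (((1 - t) / 2) ^ k))) t =
      complex_of_real (real k / 2 * (real (k - 1) / 2) * ((1 - t) / 2) ^ (k - 2))"
  proof -
    have "ivl_deriv (ivl_deriv (\<lambda>t. complex_of_real (((1 - t) / 2) ^ k))) t =
        ivl_deriv (\<lambda>t. complex_of_real (- (real k / 2) * ((1 - t) / 2) ^ (k - 1))) t"
      using t by (intro ivl_deriv_cong d1) auto
    also have "\<dots> = complex_of_real (real k / 2 * (real (k - 1) / 2) * ((1 - t) / 2) ^ (k - 2))"
      by (intro ivl_deriv_eqI t has_vector_derivative_of_real)
         (auto intro!: derivative_eq_intros simp: numeral_2_eq_2)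
    finally show ?thesis .
  qed
  define x where "x = (1 - t) / 2"
  have tx: "t = 1 - 2 * x" by (simp add: x_def field_simps)
  have "(1 - t\<^sup>2) * (real k / 2 * (real (k - 1) / 2) * x ^ (k - 2))
      + (\<beta> - \<alpha> - (\<alpha> + \<beta> + 2) * t) * (- (real k / 2) * x ^ (k - 1))
      = real k * (real k + \<alpha>) * x ^ (k - 1) - real k * (real k + (\<alpha> + \<beta> + 1)) * x ^ k"
  proof -
    consider "k = 0" | "k = 1" | j where "k = Suc (Suc j)"
      by (metis One_nat_def not0_implies_Suc)
    then show ?thesis
    proof cases
      case 3
      have k: "real k = real j + 2" "real (k - 1) = real j + 1" "k - 1 = Suc j" "k - 2 = j"
        using 3 by auto
      show ?thesis unfolding k 3 power_Suc tx by (simp add: field_simps power2_eq_square)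
    qed (simp_all add: tx field_simps)
  qed
  then show ?thesis
    unfolding jacobi_diff_def d1[OF t] d2 of_real_mult[symmetric] of_real_add[symmetric] x_def by simp
qed

text \<open>The value at \<open>1\<close> collects the normalising constant and the binomial coefficient.\<close>

definition jacobi_coeff :: "real \<Rightarrow> real \<Rightarrow> nat \<Rightarrow> nat \<Rightarrow> real" where
  "jacobi_coeff \<alpha> \<beta> n k = jacobi_p \<alpha> \<beta> n 1 *
     (pochhammer (- real n) k * pochhammer (real n + \<alpha> + \<beta> + 1) k / (pochhammer (\<alpha> + 1) k * fact k))"

lemma jacobi_p_eq_sum: "jacobi_p \<alpha> \<beta> n t = (\<Sum>k\<le>n. jacobi_coeff \<alpha> \<beta> n k * ((1 - t) / 2) ^ k)"
proof -
  have "jacobi_p \<alpha> \<beta> n t = jacobi_p \<alpha> \<beta> n 1 *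
     (\<Sum>k\<le>n. pochhammer (- real n) k * pochhammer (real n + \<alpha> + \<beta> + 1) k /
        (pochhammer (\<alpha> + 1) k * fact k) * ((1 - t) / 2) ^ k)"
    by (simp only: jacobi_p_def jacobi_P_at_1) (simp only: jacobi_P_def mult.assoc)
  then show ?thesis
    by (simp only: jacobi_coeff_def sum_distrib_left mult.assoc)
qed

lemma jacobi_p_at_1_pos:
  assumes "\<alpha> > -1" "\<beta> > -1" "\<alpha> + \<beta> + 1 \<ge> 0"
  shows "jacobi_p \<alpha> \<beta> n 1 > 0"
proof -
  have "(real n + \<alpha>) gchoose n = pochhammer (\<alpha> + 1) n / fact n"
    by (simp add: gbinomial_pochhammer')
  also have "\<dots> > 0" using assms by (simp add: pochhammer_pos)
  finally have 1: "jacobi_P \<alpha> \<beta> n 1 > 0" unfolding jacobi_P_at_1 .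
  have 2: "(if n = 0 \<and> \<alpha> + \<beta> + 1 = 0 then Gamma (\<alpha> + \<beta> + 2)
       else (2 * real n + \<alpha> + \<beta> + 1) * Gamma (real n + \<alpha> + \<beta> + 1)) > 0"
    using assms by (cases "n = 0") (auto intro!: mult_pos_pos Gamma_real_pos)
  have 3: "Gamma (real n + \<alpha> + 1) > 0" "Gamma (real n + \<beta> + 1) > 0"
    using assms by (auto intro!: Gamma_real_pos)
  show ?thesis
    unfolding jacobi_p_def using 1 2 3
    by (intro mult_pos_pos) (auto intro!: divide_pos_pos mult_pos_pos simp del: split_paired_All)
qed

lemma jacobi_coeff_Suc:
  assumes "\<alpha> > -1"
  shows "jacobi_coeff \<alpha> \<beta> n (Suc k) * (real (Suc k) * (real (Suc k) + \<alpha>)) =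
     jacobi_coeff \<alpha> \<beta> n k * ((real k - real n) * (real k + real n + (\<alpha> + \<beta> + 1)))"
proof -
  have cancel: "J * (A * a * (B * b) / (C * c * (m * F))) * (m * c) = J * (A * B / (C * F)) * (a * b)"
    if "c \<noteq> 0" "m \<noteq> 0" for J A B C F a b c m :: real
    using that by simp
  have c: "real (Suc k) + \<alpha> = \<alpha> + 1 + real k" by simp
  have "\<alpha> + 1 + real k \<noteq> 0" using assms by linarith
  moreover have "real (Suc k) \<noteq> 0" by simp
  ultimately have "jacobi_coeff \<alpha> \<beta> n (Suc k) * (real (Suc k) * (real (Suc k) + \<alpha>)) =
     jacobi_coeff \<alpha> \<beta> n k * ((- real n + real k) * (real n + \<alpha> + \<beta> + 1 + real k))"
    unfolding jacobi_coeff_def pochhammer_Suc fact_Suc c by (rule cancel)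
  then show ?thesis by (simp add: add_ac)
qed

lemma jacobi_coeff_lead:
  assumes "\<alpha> > -1" "\<beta> > -1" "\<alpha> + \<beta> + 1 \<ge> 0"
  shows "jacobi_coeff \<alpha> \<beta> n n \<noteq> 0"
proof -
  have "pochhammer (- real n) n \<noteq> 0" by (auto simp: pochhammer_eq_0_iff)
  moreover have "pochhammer (real n + \<alpha> + \<beta> + 1) n > 0"
    using assms by (cases "n = 0") (auto intro!: pochhammer_pos)
  moreover have "pochhammer (\<alpha> + 1) n > 0" using assms by (intro pochhammer_pos) auto
  ultimately show ?thesis
    using jacobi_p_at_1_pos[OF assms, of n] by (simp add: jacobi_coeff_def)
qed

text \<open>These are the \<open>p\<^sub>n\<close> of the comments, as complex-valued functions.\<close>

abbreviation (input) jacobi_e :: "real \<Rightarrow> real \<Rightarrow> nat \<Rightarrow> real \<Rightarrow> complex" where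
  "jacobi_e \<alpha> \<beta> n t \<equiv> complex_of_real (jacobi_p \<alpha> \<beta> n t)"

lemma jacobi_e_eq_sum:
  "jacobi_e \<alpha> \<beta> n = (\<lambda>t. \<Sum>k\<le>n. complex_of_real (jacobi_coeff \<alpha> \<beta> n k) * complex_of_real (((1 - t) / 2) ^ k))"
  by (rule ext) (simp add: jacobi_p_eq_sum)

lemma smooth_ivl_jacobi_e: "jacobi_e \<alpha> \<beta> n \<in> smooth_ivl"
  unfolding jacobi_e_eq_sum by (intro smooth_ivl_lincomb smooth_ivl_power) auto

text \<open>In the variable \<open>x = (1 - t) / 2\<close> the operator maps \<open>x\<^sup>k\<close> to a combination of \<open>x\<^sup>k\<^sup>-\<^sup>1\<close> and \<open>x\<^sup>k\<close>, so
  the eigenvalue equation is a two-term recursion, which is that of the hypergeometric coefficients.\<close>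

lemma jacobi_diff_jacobi_e:
  assumes "\<alpha> > -1" and t: "t \<in> {-1..1}"
  shows "jacobi_diff \<alpha> \<beta> (jacobi_e \<alpha> \<beta> n) t = jacobi_ev \<alpha> \<beta> n * jacobi_e \<alpha> \<beta> n t"
proof -
  define x where "x = (1 - t) / 2"
  define c where "c = jacobi_coeff \<alpha> \<beta> n"
  have rec: "c (Suc k) * (real (Suc k) * (real (Suc k) + \<alpha>)) =
      c k * ((real k - real n) * (real k + real n + (\<alpha> + \<beta> + 1)))" for k
    unfolding c_def by (rule jacobi_coeff_Suc[OF assms(1)])
  have "(\<Sum>k\<le>n. c k * (real k * (real k + \<alpha>)) * x ^ (k - 1))
      = (\<Sum>k<n. c (Suc k) * (real (Suc k) * (real (Suc k) + \<alpha>)) * x ^ k)"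
    by (simp add: sum.atMost_shift)
  also have "\<dots> = (\<Sum>k<n. c k * ((real k - real n) * (real k + real n + (\<alpha> + \<beta> + 1))) * x ^ k)"
    unfolding rec ..
  also have "\<dots> = (\<Sum>k\<le>n. c k * ((real k - real n) * (real k + real n + (\<alpha> + \<beta> + 1))) * x ^ k)"
    by (simp add: lessThan_Suc_atMost[symmetric])
  finally have shift: "(\<Sum>k\<le>n. c k * (real k * (real k + \<alpha>)) * x ^ (k - 1))
     = (\<Sum>k\<le>n. c k * ((real k - real n) * (real k + real n + (\<alpha> + \<beta> + 1))) * x ^ k)" .
  have "jacobi_diff \<alpha> \<beta> (jacobi_e \<alpha> \<beta> n) t = (\<Sum>k\<le>n. complex_of_real (c k) *
      complex_of_real (real k * (real k + \<alpha>) * x ^ (k - 1) - real k * (real k + (\<alpha> + \<beta> + 1)) * x ^ k))"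
    unfolding jacobi_e_eq_sum c_def x_def
    by (subst jacobi_diff_lincomb[OF _ smooth_ivl_power t]) (auto simp only: jacobi_diff_power[OF t] finite_atMost)
  also have "\<dots> = complex_of_real ((\<Sum>k\<le>n. c k * (real k * (real k + \<alpha>)) * x ^ (k - 1))
      - (\<Sum>k\<le>n. c k * (real k * (real k + (\<alpha> + \<beta> + 1))) * x ^ k))"
    unfolding sum_subtractf[symmetric] of_real_sum of_real_mult[symmetric]
    by (intro sum.cong refl arg_cong[where f = complex_of_real]) (simp add: algebra_simps)
  also have "(\<Sum>k\<le>n. c k * (real k * (real k + \<alpha>)) * x ^ (k - 1))
      - (\<Sum>k\<le>n. c k * (real k * (real k + (\<alpha> + \<beta> + 1))) * x ^ k)
      = - (real n * (real n + \<alpha> + \<beta> + 1)) * (\<Sum>k\<le>n. c k * x ^ k)"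
    unfolding shift sum_subtractf[symmetric] sum_distrib_left
    by (intro sum.cong refl) (simp add: algebra_simps)
  finally show ?thesis
    unfolding jacobi_p_eq_sum c_def x_def of_real_mult .
qed

subsection \<open>Orthogonality and completeness\<close>

lemma integrable_mult_continuous:
  fixes f g :: "real \<Rightarrow> complex"
  assumes f: "integrable (jacobi_measure \<alpha> \<beta>) f" and g: "continuous_on {-1..1} g"
  shows "integrable (jacobi_measure \<alpha> \<beta>) (\<lambda>t. f t * g t)"
proof -
  have [measurable]: "f \<in> borel_measurable (jacobi_measure \<alpha> \<beta>)" using f by auto
  have [measurable]: "g \<in> borel_measurable (jacobi_measure \<alpha> \<beta>)"
    by (intro continuous_on_measurable_jacobi_measure g)
  have "bounded (g ` {-1..1})"
    using g compact_continuous_image compact_imp_bounded by blast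
  then obtain B where B: "\<forall>t\<in>{-1..1}. norm (g t) \<le> B"
    unfolding bounded_iff by (auto simp: ball_simps)
  show ?thesis
  proof (rule Bochner_Integration.integrable_bound)
    show "integrable (jacobi_measure \<alpha> \<beta>) (\<lambda>t. B *\<^sub>R f t)" using f by simp
    show "AE t in jacobi_measure \<alpha> \<beta>. norm (f t * g t) \<le> norm (B *\<^sub>R f t)"
    proof (intro AE_I2)
      fix t assume "t \<in> space (jacobi_measure \<alpha> \<beta>)"
      then have "norm (g t) \<le> B" using B by simp
      then have "norm (g t) \<le> \<bar>B\<bar>" by linarith
      then show "norm (f t * g t) \<le> norm (B *\<^sub>R f t)"
        by (simp add: norm_mult mult.commute[of "norm (f t)"] mult_right_mono)
    qed
  qed measurable
qed

lemma continuous_on_jacobi_e: "continuous_on {-1..1} (jacobi_e \<alpha> \<beta> n)"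
  by (intro smooth_ivl_continuous smooth_ivl_jacobi_e)

lemma jacobi_transform_diff:
  assumes "\<alpha> > -1" "f \<in> smooth_ivl" "\<beta> > -1"
  shows "jacobi_transform \<alpha> \<beta> (jacobi_diff \<alpha> \<beta> f) n = jacobi_ev \<alpha> \<beta> n * jacobi_transform \<alpha> \<beta> f n"
proof -
  have "jacobi_transform \<alpha> \<beta> (jacobi_diff \<alpha> \<beta> f) n =
      (\<integral>t. f t * jacobi_diff \<alpha> \<beta> (jacobi_e \<alpha> \<beta> n) t \<partial>jacobi_measure \<alpha> \<beta>)"
    unfolding jacobi_transform_def by (rule jacobi_diff_symmetric) (use assms smooth_ivl_jacobi_e in auto)
  also have "\<dots> = (\<integral>t. jacobi_ev \<alpha> \<beta> n * (f t * jacobi_e \<alpha> \<beta> n t) \<partial>jacobi_measure \<alpha> \<beta>)"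
    by (intro Bochner_Integration.integral_cong refl) (simp add: jacobi_diff_jacobi_e[OF assms(1)] del: of_real_mult of_real_minus)
  finally show ?thesis unfolding jacobi_transform_def by simp
qed

text \<open>Eigenfunctions of a symmetric operator for distinct eigenvalues.\<close>

lemma jacobi_e_orthogonal:
  assumes "\<alpha> > -1" "\<beta> > -1" "\<alpha> + \<beta> + 1 \<ge> 0" "m \<noteq> n"
  shows "jacobi_transform \<alpha> \<beta> (jacobi_e \<alpha> \<beta> m) n = 0"
proof -
  have "jacobi_ev \<alpha> \<beta> n * jacobi_transform \<alpha> \<beta> (jacobi_e \<alpha> \<beta> m) n
      = jacobi_transform \<alpha> \<beta> (jacobi_diff \<alpha> \<beta> (jacobi_e \<alpha> \<beta> m)) n"
    using jacobi_transform_diff[OF assms(1) smooth_ivl_jacobi_e assms(2)] by simp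
  also have "\<dots> = (\<integral>t. jacobi_ev \<alpha> \<beta> m * (jacobi_e \<alpha> \<beta> m t * jacobi_e \<alpha> \<beta> n t) \<partial>jacobi_measure \<alpha> \<beta>)"
    unfolding jacobi_transform_def
    by (intro Bochner_Integration.integral_cong refl) (simp add: jacobi_diff_jacobi_e[OF assms(1)] del: of_real_mult of_real_minus)
  also have "\<dots> = jacobi_ev \<alpha> \<beta> m * jacobi_transform \<alpha> \<beta> (jacobi_e \<alpha> \<beta> m) n"
    unfolding jacobi_transform_def by simp
  finally show ?thesis
    using jacobi_ev_inject[OF assms(3), of n m] assms(4) by (metis mult_right_cancel)
qed

text \<open>Since the \<open>n\<close>-th polynomial has degree exactly \<open>n\<close>, the moments of a function with
  vanishing transform vanish one after the other.\<close>

lemma AE_zero_if_jacobi_transform_zero: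
  assumes ab: "\<alpha> > -1" "\<beta> > -1" "\<alpha> + \<beta> + 1 \<ge> 0" and f: "integrable (jacobi_measure \<alpha> \<beta>) f"
    and z: "\<And>n. jacobi_transform \<alpha> \<beta> f n = 0"
  shows "AE t in jacobi_measure \<alpha> \<beta>. f t = 0"
proof (rule AE_zero_if_moments_zero[OF ab(1,2) f])
  let ?M = "jacobi_measure \<alpha> \<beta>" and ?x = "\<lambda>t::real. complex_of_real ((1 - t) / 2)"
  have int: "integrable ?M (\<lambda>t. f t * (complex_of_real (t ^ k) * ?x t ^ j))" for k j
    by (intro integrable_mult_continuous f continuous_intros) auto
  have x: "(\<integral>t. f t * (complex_of_real (t ^ 0) * ?x t ^ n) \<partial>?M) = 0" for n
  proof (induction n rule: less_induct)
    case (less n)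
    let ?I = "\<lambda>k. \<integral>t. f t * (complex_of_real (t ^ 0) * ?x t ^ k) \<partial>?M"
    have "0 = (\<integral>t. (\<Sum>k\<le>n. complex_of_real (jacobi_coeff \<alpha> \<beta> n k) * (f t * (complex_of_real (t ^ 0) * ?x t ^ k))) \<partial>?M)"
      unfolding z[of n, symmetric] jacobi_transform_def
      by (intro Bochner_Integration.integral_cong refl) (simp add: jacobi_p_eq_sum sum_distrib_left mult_ac)
    also have "\<dots> = (\<Sum>k\<le>n. complex_of_real (jacobi_coeff \<alpha> \<beta> n k) * ?I k)"
      by (subst Bochner_Integration.integral_sum) (intro integrable_mult_right int, simp)
    also have "\<dots> = (\<Sum>k\<in>{n}. complex_of_real (jacobi_coeff \<alpha> \<beta> n k) * ?I k)"
      using less by (intro sum.mono_neutral_right) auto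
    finally show ?case using jacobi_coeff_lead[OF ab, of n] by simp
  qed
  have "(\<integral>t. f t * (complex_of_real (t ^ k) * ?x t ^ j) \<partial>?M) = 0" for k j
  proof (induction k arbitrary: j)
    case (Suc k)
    have "(\<integral>t. f t * (complex_of_real (t ^ Suc k) * ?x t ^ j) \<partial>?M) =
       (\<integral>t. f t * (complex_of_real (t ^ k) * ?x t ^ j) - 2 * (f t * (complex_of_real (t ^ k) * ?x t ^ Suc j)) \<partial>?M)"
      by (intro Bochner_Integration.integral_cong refl) (simp add: field_simps)
    also have "\<dots> = 0"
      unfolding Bochner_Integration.integral_diff[OF int integrable_mult_right[OF int]]
        integral_mult_right_zero Suc by simp
    finally show ?case .
  qed (rule x)
  from this[of _ 0] show "(\<integral>t. f t * complex_of_real (t ^ k) \<partial>?M) = 0" for k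
    by simp
qed

section \<open>Expansion of smooth functions\<close>

definition jacobi_sup :: "real \<Rightarrow> real \<Rightarrow> nat \<Rightarrow> real" where
  "jacobi_sup \<alpha> \<beta> n = (SUP t\<in>{-1..1}. norm (jacobi_e \<alpha> \<beta> n t))"

lemma jacobi_sup_attained: "\<exists>t0\<in>{-1..1}. jacobi_sup \<alpha> \<beta> n = norm (jacobi_e \<alpha> \<beta> n t0) \<and>
   (\<forall>t\<in>{-1..1}. norm (jacobi_e \<alpha> \<beta> n t) \<le> jacobi_sup \<alpha> \<beta> n)"
proof -
  have "\<exists>t0\<in>{-1..1}. \<forall>t\<in>{-1..1}. norm (jacobi_e \<alpha> \<beta> n t) \<le> norm (jacobi_e \<alpha> \<beta> n t0)"
    by (intro continuous_attains_sup continuous_on_norm continuous_on_jacobi_e) auto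
  then obtain t0 where t0: "t0 \<in> {-1..1}"
    "\<And>t. t \<in> {-1..1} \<Longrightarrow> norm (jacobi_e \<alpha> \<beta> n t) \<le> norm (jacobi_e \<alpha> \<beta> n t0)" by blast
  have "jacobi_sup \<alpha> \<beta> n = norm (jacobi_e \<alpha> \<beta> n t0)"
    unfolding jacobi_sup_def by (intro cSup_eq_maximum) (use t0 in auto)
  then show ?thesis using t0 by auto
qed

lemma norm_jacobi_e_le: "t \<in> {-1..1} \<Longrightarrow> norm (jacobi_e \<alpha> \<beta> n t) \<le> jacobi_sup \<alpha> \<beta> n"
  using jacobi_sup_attained by blast

lemma jacobi_sup_pos:
  assumes "\<alpha> > -1" "\<beta> > -1" "\<alpha> + \<beta> + 1 \<ge> 0"
  shows "jacobi_sup \<alpha> \<beta> n > 0"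
  using norm_jacobi_e_le[of 1 \<alpha> \<beta> n] jacobi_p_at_1_pos[OF assms, of n] by simp

text \<open>Its positivity and its size relative to the supremum are drawn from the Nikolskii-type inequality
  instead of a Gamma integral, which would give the value \<open>1\<close>.\<close>

definition jacobi_sqnorm :: "real \<Rightarrow> real \<Rightarrow> nat \<Rightarrow> real" where
  "jacobi_sqnorm \<alpha> \<beta> n = (\<integral>t. (norm (jacobi_e \<alpha> \<beta> n t))\<^sup>2 \<partial>jacobi_measure \<alpha> \<beta>)"

lemma jacobi_transform_self:
  "jacobi_transform \<alpha> \<beta> (jacobi_e \<alpha> \<beta> n) n = complex_of_real (jacobi_sqnorm \<alpha> \<beta> n)"
  unfolding jacobi_transform_def jacobi_sqnorm_def
  by (simp add: power2_eq_square flip: of_real_mult)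

lemma jacobi_e_deriv_bound:
  assumes "\<alpha> > -1" "\<beta> > -1"
  shows "\<exists>C\<ge>0. \<forall>n. \<forall>t\<in>{-1..1}. norm ((ivl_deriv ^^ k) (jacobi_e \<alpha> \<beta> n) t)
    \<le> C * (1 + norm (jacobi_ev \<alpha> \<beta> n)) ^ k * jacobi_sup \<alpha> \<beta> n"
proof -
  obtain C where C: "C \<ge> 0" "\<forall>l. \<forall>u\<in>smooth_ivl. \<forall>B.
     (\<forall>t\<in>{-1..1}. jacobi_diff \<alpha> \<beta> u t = l * u t) \<longrightarrow> (\<forall>t\<in>{-1..1}. norm (u t) \<le> B) \<longrightarrow>
     (\<forall>t\<in>{-1..1}. norm ((ivl_deriv ^^ k) u t) \<le> C * (1 + norm l) ^ k * B)"
    using jacobi_eigenfunction_deriv_bound[OF assms, of k] by (elim exE conjE)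
  have "norm ((ivl_deriv ^^ k) (jacobi_e \<alpha> \<beta> n) t)
    \<le> C * (1 + norm (jacobi_ev \<alpha> \<beta> n)) ^ k * jacobi_sup \<alpha> \<beta> n" if "t \<in> {-1..1}" for n t
    using that
    by (intro C(2)[rule_format] smooth_ivl_jacobi_e jacobi_diff_jacobi_e assms norm_jacobi_e_le) auto
  then show ?thesis using C(1) by blast
qed

text \<open>By the case \<open>k = 1\<close> of the preceding bound, the derivative is at most a multiple of
  \<open>1 + \<bar>\<lambda>\<^sub>n\<bar>\<close> times the supremum, as the Nikolskii-type inequality requires.\<close>

lemma jacobi_sup_le_sqnorm:
  assumes ab: "\<alpha> > -1" "\<beta> > -1" "\<alpha> + \<beta> + 1 \<ge> 0"
  shows "\<exists>C>0. \<exists>K. \<forall>n. (jacobi_sup \<alpha> \<beta> n)\<^sup>2 \<le>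
    C * (1 + norm (jacobi_ev \<alpha> \<beta> n)) ^ K * jacobi_sqnorm \<alpha> \<beta> n"
proof -
  obtain C where C: "C \<ge> 0" "\<forall>n. \<forall>t\<in>{-1..1}. norm ((ivl_deriv ^^ 1) (jacobi_e \<alpha> \<beta> n) t)
    \<le> C * (1 + norm (jacobi_ev \<alpha> \<beta> n)) ^ 1 * jacobi_sup \<alpha> \<beta> n"
    using jacobi_e_deriv_bound[OF ab(1,2), of 1] by (elim exE conjE)
  define K where "K = nat \<lceil>\<bar>\<alpha>\<bar> + \<bar>\<beta>\<bar> + 1\<rceil>"
  have K: "\<bar>\<alpha>\<bar> + \<bar>\<beta>\<bar> + 1 \<le> real K" unfolding K_def by (rule of_nat_ceiling)
  have "(jacobi_sup \<alpha> \<beta> n)\<^sup>2 \<le> 4 * (16 * (C + 1)) ^ K * (1 + norm (jacobi_ev \<alpha> \<beta> n)) ^ K * jacobi_sqnorm \<alpha> \<beta> n" for n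
  proof -
    define L where "L = (C + 1) * (1 + norm (jacobi_ev \<alpha> \<beta> n))"
    have L: "L \<ge> 1" "C * (1 + norm (jacobi_ev \<alpha> \<beta> n)) \<le> L"
      unfolding L_def using C(1) by (auto simp: algebra_simps add_increasing simp del: of_real_mult of_real_minus norm_of_real)
    obtain t0 where t0: "t0 \<in> {-1..1}" "jacobi_sup \<alpha> \<beta> n = norm (jacobi_e \<alpha> \<beta> n t0)"
      using jacobi_sup_attained by blast
    have "(norm (jacobi_e \<alpha> \<beta> n t0))\<^sup>2 / 4 * (1 / (16 * L)) ^ K \<le> jacobi_sqnorm \<alpha> \<beta> n"
      unfolding jacobi_sqnorm_def
    proof (rule jacobi_L2_lower_bound[OF ab(1,2) smooth_ivl_jacobi_e _ t0(1) _ L(1) K])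
      fix t :: real assume t: "t \<in> {-1..1}"
      show "norm (jacobi_e \<alpha> \<beta> n t) \<le> norm (jacobi_e \<alpha> \<beta> n t0)"
        using norm_jacobi_e_le[OF t, of \<alpha> \<beta> n] t0(2) by simp
      have "norm (ivl_deriv (jacobi_e \<alpha> \<beta> n) t) \<le> C * (1 + norm (jacobi_ev \<alpha> \<beta> n)) * jacobi_sup \<alpha> \<beta> n"
        using C(2) t by (simp del: of_real_mult of_real_minus norm_of_real)
      also have "\<dots> \<le> L * jacobi_sup \<alpha> \<beta> n"
        using L(2) jacobi_sup_pos[OF ab, of n] by (intro mult_right_mono) auto
      finally show "norm (ivl_deriv (jacobi_e \<alpha> \<beta> n) t) \<le> L * norm (jacobi_e \<alpha> \<beta> n t0)"
        unfolding t0(2) .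
    qed
    then have "(jacobi_sup \<alpha> \<beta> n)\<^sup>2 \<le> 4 * (16 * L) ^ K * jacobi_sqnorm \<alpha> \<beta> n"
      unfolding t0(2) using L(1) by (simp add: power_divide field_simps)
    then show ?thesis
      unfolding L_def by (simp only: power_mult_distrib mult_ac)
  qed
  then show ?thesis
    using C(1) by (intro exI[of _ "4 * (16 * (C + 1)) ^ K"] conjI exI[of _ K] allI) auto
qed

lemma jacobi_sqnorm_pos:
  assumes ab: "\<alpha> > -1" "\<beta> > -1" "\<alpha> + \<beta> + 1 \<ge> 0"
  shows "jacobi_sqnorm \<alpha> \<beta> n > 0"
proof -
  obtain C K where C: "C > 0" "\<forall>n. (jacobi_sup \<alpha> \<beta> n)\<^sup>2 \<le>
    C * (1 + norm (jacobi_ev \<alpha> \<beta> n)) ^ K * jacobi_sqnorm \<alpha> \<beta> n"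
    using jacobi_sup_le_sqnorm[OF ab] by (elim exE conjE)
  define X where "X = C * (1 + norm (jacobi_ev \<alpha> \<beta> n)) ^ K"
  have "X > 0" unfolding X_def using C(1) by (intro mult_pos_pos zero_less_power) (auto simp: add_pos_nonneg simp del: of_real_mult of_real_minus norm_of_real)
  moreover have "0 < (jacobi_sup \<alpha> \<beta> n)\<^sup>2" using jacobi_sup_pos[OF ab, of n] by simp
  then have "0 < X * jacobi_sqnorm \<alpha> \<beta> n" using C(2) unfolding X_def by (meson less_le_trans)
  ultimately show ?thesis by (simp add: zero_less_mult_iff)
qed

subsection \<open>Rapidly decreasing coefficients\<close>

text \<open>
  The condition is imposed on the terms of the series rather than on the coefficients, since this
  is the form in which termwise differentiation uses it.
\<close>

definition rapidly_decreasing :: "real \<Rightarrow> real \<Rightarrow> (nat \<Rightarrow> complex) \<Rightarrow> bool" where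
  "rapidly_decreasing \<alpha> \<beta> a \<longleftrightarrow> (\<forall>k. \<exists>M. summable M \<and>
     (\<forall>n. \<forall>t\<in>{-1..1}. norm (a n * (ivl_deriv ^^ k) (jacobi_e \<alpha> \<beta> n) t) \<le> M n))"

lemma rapid_mono:
  assumes "rapidly_decreasing \<alpha> \<beta> a" "\<And>n. norm (b n) \<le> C * norm (a n)"
  shows "rapidly_decreasing \<alpha> \<beta> b"
  unfolding rapidly_decreasing_def
proof
  fix k
  obtain M where M: "summable M" "\<forall>n. \<forall>t\<in>{-1..1}. norm (a n * (ivl_deriv ^^ k) (jacobi_e \<alpha> \<beta> n) t) \<le> M n"
    using assms(1) unfolding rapidly_decreasing_def by meson
  have "norm (b n * (ivl_deriv ^^ k) (jacobi_e \<alpha> \<beta> n) t) \<le> \<bar>C\<bar> * M n" if "t \<in> {-1..1}" for n t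
  proof -
    have "norm (b n) \<le> \<bar>C\<bar> * norm (a n)"
      using assms(2)[of n] mult_right_mono[OF abs_ge_self norm_ge_zero, of C "a n"] by linarith
    then have "norm (b n * (ivl_deriv ^^ k) (jacobi_e \<alpha> \<beta> n) t) \<le>
        \<bar>C\<bar> * norm (a n) * norm ((ivl_deriv ^^ k) (jacobi_e \<alpha> \<beta> n) t)"
      by (simp add: norm_mult mult_right_mono)
    also have "\<dots> = \<bar>C\<bar> * norm (a n * (ivl_deriv ^^ k) (jacobi_e \<alpha> \<beta> n) t)"
      by (simp add: norm_mult)
    also have "\<dots> \<le> \<bar>C\<bar> * M n"
      using M(2) that by (intro mult_left_mono) auto
    finally show ?thesis .
  qed
  then show "\<exists>M. summable M \<and> (\<forall>n. \<forall>t\<in>{-1..1}. norm (b n * (ivl_deriv ^^ k) (jacobi_e \<alpha> \<beta> n) t) \<le> M n)"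
    using M(1) by (intro exI[of _ "\<lambda>n. \<bar>C\<bar> * M n"]) (auto intro: summable_mult)
qed

lemma rapid_series:
  assumes ab: "\<alpha> > -1" "\<beta> > -1" "\<alpha> + \<beta> + 1 \<ge> 0" and a: "rapidly_decreasing \<alpha> \<beta> a"
  defines "g \<equiv> \<lambda>t. \<Sum>n. a n * jacobi_e \<alpha> \<beta> n t"
  shows "g \<in> smooth_ivl"
    and "t \<in> {-1..1} \<Longrightarrow> jacobi_diff \<alpha> \<beta> g t = (\<Sum>n. a n * (jacobi_ev \<alpha> \<beta> n * jacobi_e \<alpha> \<beta> n t))"
    and "jacobi_transform \<alpha> \<beta> g m = a m * complex_of_real (jacobi_sqnorm \<alpha> \<beta> m)"
proof -
  let ?e = "jacobi_e \<alpha> \<beta>"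
  obtain M where M: "\<And>k. summable (M k)"
     "\<And>k n t. t \<in> {-1..1} \<Longrightarrow> norm (a n * (ivl_deriv ^^ k) (?e n) t) \<le> M k n"
    using a unfolding rapidly_decreasing_def by metis
  have e: "(\<lambda>t. a n * ?e n t) \<in> smooth_ivl" for n
    by (intro smooth_ivl_cmult smooth_ivl_jacobi_e)
  have ek: "(ivl_deriv ^^ k) (\<lambda>t. a n * ?e n t) t = a n * (ivl_deriv ^^ k) (?e n) t" if "t \<in> {-1..1}" for n k t
    using smooth_ivl_lincomb(2)[of "{n}" ?e t k a] smooth_ivl_jacobi_e that by simp
  have bd: "norm ((ivl_deriv ^^ k) (\<lambda>t. a n * ?e n t) t) \<le> M k n" if "t \<in> {-1..1}" for k n t
    using M(2)[OF that] ek[OF that] by simp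
  show g: "g \<in> smooth_ivl"
    unfolding g_def by (rule smooth_ivl_series(1)[OF e M(1) bd])
  have gk: "(ivl_deriv ^^ k) g t = (\<Sum>n. a n * (ivl_deriv ^^ k) (?e n) t)" if "t \<in> {-1..1}" for k t
    using smooth_ivl_series(2)[OF e M(1) bd that, of k] ek[OF that] unfolding g_def by simp
  have sm: "summable (\<lambda>n. a n * (ivl_deriv ^^ k) (?e n) t)" if "t \<in> {-1..1}" for k t
    by (rule summable_comparison_test'[OF M(1)[of k], of 0]) (rule M(2)[OF that])
  show "jacobi_diff \<alpha> \<beta> g t = (\<Sum>n. a n * (jacobi_ev \<alpha> \<beta> n * ?e n t))" if t: "t \<in> {-1..1}"
  proof -
    define A B where "A = complex_of_real (1 - t\<^sup>2)" and "B = complex_of_real (\<beta> - \<alpha> - (\<alpha> + \<beta> + 2) * t)"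
    have "jacobi_diff \<alpha> \<beta> g t = A * (\<Sum>n. a n * (ivl_deriv ^^ 2) (?e n) t) + B * (\<Sum>n. a n * (ivl_deriv ^^ 1) (?e n) t)"
      unfolding jacobi_diff_def A_def B_def gk[OF t, symmetric] by (simp add: numeral_2_eq_2)
    also have "\<dots> = (\<Sum>n. A * (a n * (ivl_deriv ^^ 2) (?e n) t) + B * (a n * (ivl_deriv ^^ 1) (?e n) t))"
      by (subst suminf_mult[symmetric, OF sm[OF t]])+ (intro suminf_add summable_mult sm t)
    also have "\<dots> = (\<Sum>n. a n * jacobi_diff \<alpha> \<beta> (?e n) t)"
      unfolding jacobi_diff_def A_def[symmetric] B_def[symmetric]
      by (simp add: numeral_2_eq_2 distrib_left mult_ac)
    finally show ?thesis
      using jacobi_diff_jacobi_e[OF ab(1) t] by simp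
  qed
  show "jacobi_transform \<alpha> \<beta> g m = a m * complex_of_real (jacobi_sqnorm \<alpha> \<beta> m)"
  proof -
    let ?M = "jacobi_measure \<alpha> \<beta>"
    let ?f = "\<lambda>n t. a n * ?e n t * ?e m t"
    interpret finite_measure ?M by (rule finite_measure_jacobi_measure[OF ab(1,2)])
    have M0: "norm (a n * ?e n t) \<le> M 0 n" if "t \<in> {-1..1}" for n t
      using M(2)[OF that, of n 0] by simp
    have M0': "norm (?f n t) \<le> M 0 n * jacobi_sup \<alpha> \<beta> m" if "t \<in> {-1..1}" for n t
      unfolding norm_mult[of "a n * ?e n t"]
      using M0[OF that, of n] norm_jacobi_e_le[OF that, of \<alpha> \<beta> m] order_trans[OF norm_ge_zero M0[OF that, of n]]
      by (intro mult_mono) auto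
    have int: "integrable ?M (?f n)" for n
      by (intro continuous_on_integrable_jacobi_measure ab continuous_intros continuous_on_jacobi_e)
    have s1: "summable (\<lambda>n. M 0 n * jacobi_sup \<alpha> \<beta> m)" by (intro summable_mult2 M)
    have "jacobi_transform \<alpha> \<beta> g m = (\<integral>t. (\<Sum>n. ?f n t) \<partial>?M)"
      unfolding jacobi_transform_def g_def
    proof (intro Bochner_Integration.integral_cong refl)
      fix t assume "t \<in> space ?M"
      then show "(\<Sum>n. a n * ?e n t) * ?e m t = (\<Sum>n. ?f n t)"
        using sm[of t 0] by (subst suminf_mult2) auto
    qed
    also have "\<dots> = (\<Sum>n. \<integral>t. ?f n t \<partial>?M)"
    proof (rule integral_suminf[OF int])
      show "AE t in ?M. summable (\<lambda>n. norm (?f n t))"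
      proof (intro AE_I2)
        fix t assume "t \<in> space ?M"
        then have "norm (norm (?f n t)) \<le> M 0 n * jacobi_sup \<alpha> \<beta> m" for n
          using M0'[of t n] by simp
        then show "summable (\<lambda>n. norm (?f n t))"
          by (intro summable_comparison_test'[OF s1, of 0])
      qed
      have "norm (\<integral>t. norm (?f n t) \<partial>?M) \<le> M 0 n * jacobi_sup \<alpha> \<beta> m * measure ?M (space ?M)" for n
      proof -
        have "(\<integral>t. norm (?f n t) \<partial>?M) \<le> (\<integral>t. M 0 n * jacobi_sup \<alpha> \<beta> m \<partial>?M)"
          using M0'[of _ n] by (intro integral_mono integrable_norm int) auto
        moreover have "(\<integral>t. norm (?f n t) \<partial>?M) \<ge> 0" by (intro integral_nonneg_AE AE_I2) simp
        ultimately show ?thesis by (simp add: mult_ac)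
      qed
      then show "summable (\<lambda>n. \<integral>t. norm (?f n t) \<partial>?M)"
        by (intro summable_comparison_test'[OF summable_mult2[OF s1], of 0])
    qed
    also have "\<dots> = (\<Sum>n. a n * jacobi_transform \<alpha> \<beta> (?e n) m)"
      unfolding jacobi_transform_def by (simp add: mult.assoc)
    also have "\<dots> = (\<Sum>n\<in>{m}. a n * jacobi_transform \<alpha> \<beta> (?e n) m)"
      by (rule suminf_finite) (auto simp: jacobi_e_orthogonal[OF ab])
    finally show ?thesis by (simp add: jacobi_transform_self)
  qed
qed

text \<open>
  Each application of \<open>T\<close> multiplies the transform by the eigenvalue, so the transform of a smooth
  function decays faster than any power of the eigenvalue, which beats the polynomial growth of
  the polynomials and of their derivatives.
\<close>

lemma rapid_jacobi_transform:
  assumes ab: "\<alpha> > -1" "\<beta> > -1" "\<alpha> + \<beta> + 1 \<ge> 0" and f: "f \<in> smooth_ivl"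
  shows "rapidly_decreasing \<alpha> \<beta> (\<lambda>n. jacobi_transform \<alpha> \<beta> f n / complex_of_real (jacobi_sqnorm \<alpha> \<beta> n))"
  unfolding rapidly_decreasing_def
proof
  fix k
  let ?M = "jacobi_measure \<alpha> \<beta>" and ?h = "jacobi_sqnorm \<alpha> \<beta>" and ?B = "jacobi_sup \<alpha> \<beta>"
    and ?F = "jacobi_transform \<alpha> \<beta>"
  define a where "a n = ?F f n / complex_of_real (?h n)" for n
  define l where "l n = norm (jacobi_ev \<alpha> \<beta> n)" for n
  interpret finite_measure ?M by (rule finite_measure_jacobi_measure[OF ab(1,2)])
  note h = jacobi_sqnorm_pos[OF ab] and B = jacobi_sup_pos[OF ab]
  obtain C where C: "C \<ge> 0" "\<forall>n. \<forall>t\<in>{-1..1}. norm ((ivl_deriv ^^ k) (jacobi_e \<alpha> \<beta> n) t) \<le> C * (1 + l n) ^ k * ?B n"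
    using jacobi_e_deriv_bound[OF ab(1,2), of k] unfolding l_def by (elim exE conjE)
  obtain D K where D: "D > 0" "\<forall>n. (?B n)\<^sup>2 \<le> D * (1 + l n) ^ K * ?h n"
    using jacobi_sup_le_sqnorm[OF ab] unfolding l_def by (elim exE conjE)
  \<comment> \<open>\<open>k + K\<close> powers of the eigenvalue compensate the growth; one more gives the factor
    \<open>n\<^sup>-\<^sup>2\<close> that makes the bound summable.\<close>
  define j where "j = Suc (k + K)"
  define g where "g = (jacobi_diff \<alpha> \<beta> ^^ j) f"
  have gs: "(jacobi_diff \<alpha> \<beta> ^^ i) f \<in> smooth_ivl" for i
    by (induction i) (auto intro: smooth_ivl_jacobi_diff f)
  have "?F ((jacobi_diff \<alpha> \<beta> ^^ i) f) n = jacobi_ev \<alpha> \<beta> n ^ i * ?F f n" for i n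
    by (induction i) (simp_all add: jacobi_transform_diff[OF ab(1) gs ab(2)] mult.assoc del: of_real_mult of_real_minus)
  then have Fg: "l n ^ j * norm (?F f n) = norm (?F g n)" for n
    unfolding g_def l_def by (simp add: norm_mult norm_power)
  have "bounded (g ` {-1..1})"
    using smooth_ivl_continuous[OF gs[of j]] compact_continuous_image compact_imp_bounded unfolding g_def by blast
  then obtain A where A: "\<forall>t\<in>{-1..1}. norm (g t) \<le> A"
    unfolding bounded_iff by (auto simp: ball_simps)
  have A0: "A \<ge> 0" using A order_trans[OF norm_ge_zero, of "g 0" A] by simp
  define \<mu> where "\<mu> = measure ?M (space ?M)"
  have \<mu>0: "\<mu> \<ge> 0" by (simp add: \<mu>_def)
  have FB: "norm (?F g n) \<le> A * ?B n * \<mu>" for n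
  proof -
    have c: "continuous_on {-1..1} (\<lambda>t. g t * jacobi_e \<alpha> \<beta> n t)"
      unfolding g_def by (intro continuous_on_mult continuous_on_jacobi_e smooth_ivl_continuous gs)
    have "norm (?F g n) \<le> (\<integral>t. A * ?B n \<partial>?M)"
      unfolding jacobi_transform_def
    proof (rule Bochner_Integration.integral_norm_bound_integral)
      show "integrable ?M (\<lambda>t. g t * jacobi_e \<alpha> \<beta> n t)"
        by (intro continuous_on_integrable_jacobi_measure ab c)
      fix t assume "t \<in> space ?M"
      then show "norm (g t * jacobi_e \<alpha> \<beta> n t) \<le> A * ?B n"
        unfolding norm_mult using A A0 norm_jacobi_e_le[of t \<alpha> \<beta> n] by (intro mult_mono) auto
    qed simp
    then show ?thesis by (simp add: \<mu>_def mult_ac)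
  qed
  define E where "E = A * \<mu> * C * D * 2 ^ (k + K)"
  have E0: "E \<ge> 0" using A0 \<mu>0 C(1) D(1) by (simp add: E_def)
  have main: "norm (a n) * (C * (1 + l n) ^ k * ?B n) \<le> E * (1 / (real n)\<^sup>2)" if n: "n \<ge> 1" for n
  proof -
    have ln: "(real n)\<^sup>2 \<le> l n" unfolding l_def by (rule norm_jacobi_ev_ge[OF ab(3)])
    have "1 \<le> (real n)\<^sup>2" using n by simp
    then have l1: "l n \<ge> 1" using ln by linarith
    have "l n ^ j * (norm (a n) * (C * (1 + l n) ^ k * ?B n)) = norm (?F g n) / ?h n * (C * (1 + l n) ^ k * ?B n)"
      using h[of n] Fg[of n, symmetric] by (simp add: a_def norm_divide)
    also have "\<dots> \<le> A * ?B n * \<mu> / ?h n * (C * (1 + l n) ^ k * ?B n)"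
      using FB[of n] h[of n] C(1) B[of n] l1 by (intro mult_right_mono divide_right_mono mult_nonneg_nonneg) auto
    also have "\<dots> = A * \<mu> * C * (1 + l n) ^ k * ((?B n)\<^sup>2 / ?h n)"
      by (simp add: power2_eq_square)
    also have "\<dots> \<le> A * \<mu> * C * (1 + l n) ^ k * (D * (1 + l n) ^ K)"
      using D(2) h[of n] A0 \<mu>0 C(1) l1 by (intro mult_left_mono mult_nonneg_nonneg) (auto simp: pos_divide_le_eq)
    also have "\<dots> = A * \<mu> * C * D * (1 + l n) ^ (k + K)"
      by (simp add: power_add)
    also have "\<dots> \<le> A * \<mu> * C * D * (2 * l n) ^ (k + K)"
      using A0 \<mu>0 C(1) D(1) l1 by (intro mult_left_mono power_mono mult_nonneg_nonneg) auto
    also have "\<dots> = E * l n ^ (k + K)"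
      by (simp add: E_def power_mult_distrib)
    also have "\<dots> = l n ^ j * (E * (1 / l n))"
      using l1 by (simp add: j_def)
    finally have "norm (a n) * (C * (1 + l n) ^ k * ?B n) \<le> E * (1 / l n)"
      using l1 by (simp only: mult_le_cancel_left_pos zero_less_power less_le_trans[OF zero_less_one])
    also have "\<dots> \<le> E * (1 / (real n)\<^sup>2)"
      using ln n E0 l1 by (intro mult_left_mono divide_left_mono mult_pos_pos) auto
    finally show ?thesis .
  qed
  have "norm (a n * (ivl_deriv ^^ k) (jacobi_e \<alpha> \<beta> n) t) \<le> norm (a n) * (C * (1 + l n) ^ k * ?B n)"
    if "t \<in> {-1..1}" for n t
    unfolding norm_mult using C(2) that by (intro mult_left_mono) auto
  moreover have "summable (\<lambda>n. norm (a n) * (C * (1 + l n) ^ k * ?B n))"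
  proof (rule summable_comparison_test'[where N = 1])
    show "summable (\<lambda>n. E * (1 / (real n)\<^sup>2))"
      using inverse_power_summable[of 2, where ?'a = real] by (intro summable_mult) (simp add: inverse_eq_divide)
    have "0 \<le> norm (a n) * (C * (1 + l n) ^ k * ?B n)" for n
      using C(1) B[of n] by (simp add: l_def)
    then show "norm (norm (a n) * (C * (1 + l n) ^ k * ?B n)) \<le> E * (1 / (real n)\<^sup>2)" if "n \<ge> 1" for n
      using main[OF that] by (simp only: real_norm_def abs_of_nonneg)
  qed
  ultimately show "\<exists>M. summable M \<and> (\<forall>n. \<forall>t\<in>{-1..1}. norm (?F f n / complex_of_real (?h n)
      * (ivl_deriv ^^ k) (jacobi_e \<alpha> \<beta> n) t) \<le> M n)"
    unfolding a_def by blast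
qed

text \<open>The difference between \<open>f\<close> and its series has vanishing transform.\<close>

lemma jacobi_expansion:
  assumes ab: "\<alpha> > -1" "\<beta> > -1" "\<alpha> + \<beta> + 1 \<ge> 0" and f: "f \<in> smooth_ivl"
  shows "AE t in jacobi_measure \<alpha> \<beta>. f t =
    (\<Sum>n. jacobi_transform \<alpha> \<beta> f n / complex_of_real (jacobi_sqnorm \<alpha> \<beta> n) * jacobi_e \<alpha> \<beta> n t)"
proof -
  define g where "g t = (\<Sum>n. jacobi_transform \<alpha> \<beta> f n / complex_of_real (jacobi_sqnorm \<alpha> \<beta> n) * jacobi_e \<alpha> \<beta> n t)" for t
  note r = rapid_jacobi_transform[OF ab f]
  have g: "g \<in> smooth_ivl" unfolding g_def[abs_def] by (rule rapid_series(1)[OF ab r])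
  have int: "integrable (jacobi_measure \<alpha> \<beta>) u" if "u \<in> smooth_ivl" for u
    by (intro continuous_on_integrable_jacobi_measure ab smooth_ivl_continuous that)
  have "AE t in jacobi_measure \<alpha> \<beta>. f t - g t = 0"
  proof (rule AE_zero_if_jacobi_transform_zero[OF ab])
    show "integrable (jacobi_measure \<alpha> \<beta>) (\<lambda>t. f t - g t)"
      by (intro Bochner_Integration.integrable_diff int f g)
    fix n
    have "jacobi_transform \<alpha> \<beta> (\<lambda>t. f t - g t) n = jacobi_transform \<alpha> \<beta> f n - jacobi_transform \<alpha> \<beta> g n"
      unfolding jacobi_transform_def left_diff_distrib
      by (intro Bochner_Integration.integral_diff integrable_mult_continuous int f g continuous_on_jacobi_e)
    also have "jacobi_transform \<alpha> \<beta> g n = jacobi_transform \<alpha> \<beta> f n"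
      unfolding g_def[abs_def] rapid_series(3)[OF ab r] using jacobi_sqnorm_pos[OF ab, of n] by simp
    finally show "jacobi_transform \<alpha> \<beta> (\<lambda>t. f t - g t) n = 0" by simp
  qed
  then show ?thesis unfolding g_def by simp
qed

section \<open>Lp spaces and extensions of the operator\<close>

lemma Lp_measurable: "f \<in> Lp p M \<Longrightarrow> f \<in> borel_measurable M"
  by (simp add: Lp_def)

lemma Lp_infinity_AE_le_norm:
  assumes "f \<in> Lp \<infinity> M"
  shows "AE t in M. norm (f t) \<le> Lp_norm \<infinity> M f"
proof -
  have fin: "esssup M (\<lambda>t. ennreal (norm (f t))) < \<infinity>" using assms by (simp add: Lp_def)
  have "AE t in M. ennreal (norm (f t)) \<le> esssup M (\<lambda>t. ennreal (norm (f t)))" by (rule esssup_AE)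
  then show ?thesis
  proof eventually_elim
    case (elim t)
    from enn2real_mono[OF elim] fin show ?case by (simp add: Lp_norm_def)
  qed
qed

lemma Lp_infinity_iff: "f \<in> Lp \<infinity> M \<longleftrightarrow> f \<in> borel_measurable M \<and> (\<exists>C. AE t in M. norm (f t) \<le> C)"
proof
  assume "f \<in> Lp \<infinity> M"
  then show "f \<in> borel_measurable M \<and> (\<exists>C. AE t in M. norm (f t) \<le> C)"
    using Lp_infinity_AE_le_norm Lp_measurable by blast
next
  assume f: "f \<in> borel_measurable M \<and> (\<exists>C. AE t in M. norm (f t) \<le> C)"
  then obtain C where C: "AE t in M. norm (f t) \<le> C" by blast
  have "esssup M (\<lambda>t. ennreal (norm (f t))) \<le> ennreal C"
    using f C by (intro esssup_I) (auto elim!: eventually_mono intro: ennreal_leI)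
  then show "f \<in> Lp \<infinity> M" using f by (auto simp: Lp_def intro: le_less_trans)
qed

lemma ennreal_ge_1_cases:
  assumes "(1::ennreal) \<le> p"
  obtains "p = \<infinity>" | r where "p = ennreal r" "r \<ge> 1" "p \<noteq> \<infinity>" "enn2real p = r"
proof (cases p)
  case (real r)
  then show ?thesis using assms that(2)[of r] by simp
qed (use that in simp)

lemma Lp_norm_nonneg: "Lp_norm p M f \<ge> 0"
  by (simp add: Lp_norm_def)

lemma Lp_norm_cong_AE:
  assumes "f \<in> borel_measurable M" "g \<in> borel_measurable M" "AE t in M. f t = g t"
  shows "Lp_norm p M f = Lp_norm p M g"
proof (cases "p = \<infinity>")
  case True
  have "esssup M (\<lambda>t. ennreal (norm (f t))) = esssup M (\<lambda>t. ennreal (norm (g t)))"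
    using assms by (intro esssup_AE_cong) auto
  then show ?thesis using True by (simp add: Lp_norm_def)
next
  case False
  have "(\<integral>t. norm (f t) powr enn2real p \<partial>M) = (\<integral>t. norm (g t) powr enn2real p \<partial>M)"
    using assms by (intro integral_cong_AE) auto
  then show ?thesis using False by (simp add: Lp_norm_def)
qed

lemma Lp_cmult:
  assumes "f \<in> Lp p M"
  shows "(\<lambda>t. c * f t) \<in> Lp p M"
proof (cases "p = \<infinity>")
  case True
  then obtain C where C: "AE t in M. norm (f t) \<le> C" using assms unfolding True Lp_infinity_iff by blast
  have "AE t in M. norm (c * f t) \<le> norm c * C"
    using C by eventually_elim (simp add: norm_mult mult_left_mono)
  then show ?thesis using assms unfolding True Lp_infinity_iff by auto
next
  case False
  then have "integrable M (\<lambda>t. norm c powr enn2real p * norm (f t) powr enn2real p)"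
    using assms by (simp add: Lp_def)
  moreover have "(\<lambda>t. c * f t) \<in> borel_measurable M"
    using Lp_measurable[OF assms] by (intro borel_measurable_times) auto
  ultimately show ?thesis using False by (simp add: Lp_def norm_mult powr_mult)
qed

lemma Lp_add:
  assumes f: "f \<in> Lp p M" and g: "g \<in> Lp p M"
  shows "(\<lambda>t. f t + g t) \<in> Lp p M"
proof (cases "p = \<infinity>")
  case True
  then obtain C D where "AE t in M. norm (f t) \<le> C" "AE t in M. norm (g t) \<le> D"
    using assms unfolding True Lp_infinity_iff by blast
  then have "AE t in M. norm (f t + g t) \<le> C + D"
    by eventually_elim (rule norm_triangle_mono)
  then show ?thesis using assms unfolding True Lp_infinity_iff by auto
next
  case False
  let ?r = "enn2real p"
  have [measurable]: "f \<in> borel_measurable M" "g \<in> borel_measurable M"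
    using f g by (auto intro: Lp_measurable)
  have r: "?r \<ge> 0" by simp
  have "integrable M (\<lambda>t. 2 powr ?r * norm (f t) powr ?r + 2 powr ?r * norm (g t) powr ?r)"
    using f g False by (simp add: Lp_def)
  then have "integrable M (\<lambda>t. norm (f t + g t) powr ?r)"
  proof (rule Bochner_Integration.integrable_bound)
    show "AE t in M. norm (norm (f t + g t) powr ?r) \<le>
        norm (2 powr ?r * norm (f t) powr ?r + 2 powr ?r * norm (g t) powr ?r)"
    proof (intro AE_I2)
      fix t
      have "norm (f t + g t) \<le> 2 * max (norm (f t)) (norm (g t))"
        using norm_triangle_ineq[of "f t" "g t"] by linarith
      then have "norm (f t + g t) powr ?r \<le> (2 * max (norm (f t)) (norm (g t))) powr ?r"
        using r by (intro powr_mono2) auto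
      also have "\<dots> = 2 powr ?r * max (norm (f t)) (norm (g t)) powr ?r"
        by (simp add: powr_mult)
      also have "\<dots> \<le> 2 powr ?r * norm (f t) powr ?r + 2 powr ?r * norm (g t) powr ?r"
        by (cases "norm (f t) \<le> norm (g t)") (auto simp: max_def)
      finally show "norm (norm (f t + g t) powr ?r) \<le>
        norm (2 powr ?r * norm (f t) powr ?r + 2 powr ?r * norm (g t) powr ?r)" by simp
    qed
  qed measurable
  then show ?thesis using f g False by (simp add: Lp_def)
qed

lemma Lp_diff: "f \<in> Lp p M \<Longrightarrow> g \<in> Lp p M \<Longrightarrow> (\<lambda>t. f t - g t) \<in> Lp p M"
  using Lp_add[of f p M "\<lambda>t. -1 * g t"] Lp_cmult[of g p M "-1"] by simp

context finite_measure
begin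

lemma bounded_in_Lp:
  assumes p: "1 \<le> p" and [measurable]: "f \<in> borel_measurable M"
    and C: "\<And>t. t \<in> space M \<Longrightarrow> norm (f t) \<le> C" and C0: "C \<ge> 0"
  shows "f \<in> Lp p M" and "Lp_norm p M f \<le> (1 + measure M (space M)) * C"
proof -
  define \<mu> where "\<mu> = measure M (space M)"
  have \<mu>: "\<mu> \<ge> 0" by (simp add: \<mu>_def)
  have "f \<in> Lp p M \<and> Lp_norm p M f \<le> (1 + \<mu>) * C"
    using p
  proof (cases rule: ennreal_ge_1_cases)
    case 1
    have "AE t in M. norm (f t) \<le> C" using C by (intro AE_I2)
    then have 2: "f \<in> Lp p M" unfolding 1 Lp_infinity_iff by auto
    have "esssup M (\<lambda>t. ennreal (norm (f t))) \<le> ennreal C"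
      using C by (intro esssup_I AE_I2 ennreal_leI) auto
    then have "Lp_norm p M f \<le> C" using C0 unfolding Lp_norm_def 1 by (simp add: enn2real_leI)
    also have "C \<le> (1 + \<mu>) * C" using C0 \<mu> by (simp add: algebra_simps)
    finally show ?thesis using 2 by simp
  next
    case (2 r)
    have i: "integrable M (\<lambda>t. norm (f t) powr r)"
      using C 2(2) by (intro integrable_const_bound[where B = "C powr r"] AE_I2) (auto intro: powr_mono2)
    have "(\<integral>t. norm (f t) powr r \<partial>M) \<le> (\<integral>t. C powr r \<partial>M)"
      using C 2(2) by (intro integral_mono i) (auto intro: powr_mono2)
    also have "\<dots> = \<mu> * C powr r" by (simp add: \<mu>_def)
    also have "\<dots> \<le> (1 + \<mu>) powr r * C powr r"
    proof (intro mult_right_mono)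
      have "\<mu> \<le> (1 + \<mu>) powr 1" using \<mu> by simp
      also have "\<dots> \<le> (1 + \<mu>) powr r" using \<mu> 2(2) by (intro powr_mono) auto
      finally show "\<mu> \<le> (1 + \<mu>) powr r" .
    qed simp
    also have "\<dots> = ((1 + \<mu>) * C) powr r" using \<mu> C0 by (simp add: powr_mult)
    finally have "(\<integral>t. norm (f t) powr r \<partial>M) powr (1 / r) \<le> (((1 + \<mu>) * C) powr r) powr (1 / r)"
      using 2(2) by (intro powr_mono2) (auto intro: integral_nonneg_AE)
    also have "\<dots> = (1 + \<mu>) * C" using 2(2) \<mu> C0 by (simp add: powr_powr)
    finally show ?thesis using i 2 unfolding Lp_def Lp_norm_def by auto
  qed
  then show "f \<in> Lp p M" "Lp_norm p M f \<le> (1 + measure M (space M)) * C" by (auto simp: \<mu>_def)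
qed

text \<open>Applying \<open>x \<le> 1 + x\<^sup>p\<close> to \<open>\<bar>f\<bar> / \<parallel>f\<parallel>\<^sub>p\<close> gives the inclusion of \<open>L\<^sup>p\<close> in \<open>L\<^sup>1\<close> with a norm
  bound, at the price of a constant that is not optimal.\<close>

lemma Lp_imp_integrable:
  assumes p: "1 \<le> p" and f: "f \<in> Lp p M"
  shows "integrable M f" and "(\<integral>t. norm (f t) \<partial>M) \<le> (1 + measure M (space M)) * Lp_norm p M f"
proof -
  define \<mu> where "\<mu> = measure M (space M)"
  have [measurable]: "f \<in> borel_measurable M" using f by (rule Lp_measurable)
  have "integrable M f \<and> (\<integral>t. norm (f t) \<partial>M) \<le> (1 + \<mu>) * Lp_norm p M f"
    using p
  proof (cases rule: ennreal_ge_1_cases)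
    case 1
    define N where "N = Lp_norm p M f"
    have N: "AE t in M. norm (f t) \<le> N"
      using Lp_infinity_AE_le_norm f unfolding N_def 1 by blast
    have i: "integrable M f" using N by (intro integrable_const_bound) auto
    have "(\<integral>t. norm (f t) \<partial>M) \<le> (\<integral>t. N \<partial>M)"
      using N by (intro integral_mono_AE integrable_norm i) auto
    also have "\<dots> \<le> (1 + \<mu>) * N"
      using Lp_norm_nonneg[of p M f] by (simp add: \<mu>_def N_def algebra_simps)
    finally show ?thesis using i by (simp add: N_def)
  next
    case (2 r)
    have ir: "integrable M (\<lambda>t. norm (f t) powr r)" using f 2 by (simp add: Lp_def)
    have le: "x \<le> 1 + x powr r" if "x \<ge> 0" for x :: real
    proof (cases "x \<le> 1")
      case False
      then have "x powr 1 \<le> x powr r" using 2(2) by (intro powr_mono) auto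
      then show ?thesis using False by simp
    qed (simp add: add_increasing2)
    have i: "integrable M f"
    proof (rule Bochner_Integration.integrable_bound)
      show "integrable M (\<lambda>t. 1 + norm (f t) powr r)" using ir by simp
      show "AE t in M. norm (f t) \<le> norm (1 + norm (f t) powr r)"
      proof (intro AE_I2)
        fix t
        have "norm (f t) \<le> 1 + norm (f t) powr r" using le[of "norm (f t)"] by simp
        then show "norm (f t) \<le> norm (1 + norm (f t) powr r)" unfolding real_norm_def by linarith
      qed
    qed measurable
    define I N where "I = (\<integral>t. norm (f t) powr r \<partial>M)" and "N = Lp_norm p M f"
    have N: "N = I powr (1 / r)" unfolding N_def I_def Lp_norm_def using 2 by auto
    have I0: "I \<ge> 0" unfolding I_def by (intro integral_nonneg_AE AE_I2) simp
    show ?thesis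
    proof (cases "I = 0")
      case True
      then have "AE t in M. norm (f t) powr r = 0"
        unfolding I_def using ir by (subst (asm) integral_nonneg_eq_0_iff_AE) auto
      then have "(\<integral>t. norm (f t) \<partial>M) = (\<integral>t. 0 \<partial>M)"
        by (intro integral_cong_AE) auto
      then show ?thesis using i Lp_norm_nonneg[of p M f] by (simp add: \<mu>_def)
    next
      case False
      then have Np: "N > 0" using N I0 by simp
      have NI: "N powr r = I" using I0 2(2) by (simp add: N powr_powr)
      have "(\<integral>t. norm (f t) / N \<partial>M) \<le> (\<integral>t. 1 + norm (f t) powr r / I \<partial>M)"
      proof (rule integral_mono)
        show "norm (f t) / N \<le> 1 + norm (f t) powr r / I" for t
          using le[of "norm (f t) / N"] Np by (simp add: powr_divide NI)
      qed (use i ir in auto)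
      also have "\<dots> = \<mu> + 1"
        using ir False by (simp add: \<mu>_def flip: I_def)
      finally have "(\<integral>t. norm (f t) \<partial>M) \<le> (1 + \<mu>) * N"
        using Np by (simp add: pos_divide_le_eq add.commute)
      then show ?thesis using i by (simp add: N_def)
    qed
  qed
  then show "integrable M f" "(\<integral>t. norm (f t) \<partial>M) \<le> (1 + measure M (space M)) * Lp_norm p M f"
    by (auto simp: \<mu>_def)
qed

end

lemma smooth_ivl_in_Lp:
  assumes "\<alpha> > -1" "\<beta> > -1" "1 \<le> p" "f \<in> smooth_ivl"
  shows "f \<in> Lp p (jacobi_measure \<alpha> \<beta>)"
proof -
  interpret finite_measure "jacobi_measure \<alpha> \<beta>" by (rule finite_measure_jacobi_measure[OF assms(1,2)])
  have c: "continuous_on {-1..1} f" by (rule smooth_ivl_continuous[OF assms(4)])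
  then have "bounded (f ` {-1..1})"
    using compact_continuous_image compact_imp_bounded by blast
  then obtain B where B: "\<forall>t\<in>{-1..1}. norm (f t) \<le> B"
    unfolding bounded_iff by (auto simp: ball_simps)
  have "0 \<le> B" using B order_trans[OF norm_ge_zero, of "f 0" B] by simp
  then show ?thesis
    using B by (intro bounded_in_Lp(1)[where C = B] assms continuous_on_measurable_jacobi_measure c) auto
qed

text \<open>Continuity of each coefficient in the norm of \<open>L\<^sup>p\<close>: it passes the analyticity of \<open>\<phi>\<close> on to
  the transform and turns a coefficient of \<open>T\<^sup>k f\<close> into a lower bound for \<open>\<parallel>T\<^sup>k f\<parallel>\<^sub>p\<close>.\<close>

lemma Lp_jacobi_transform_bound:
  assumes ab: "\<alpha> > -1" "\<beta> > -1" and p: "1 \<le> p"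
  shows "\<exists>C>0. \<forall>f\<in>Lp p (jacobi_measure \<alpha> \<beta>).
     norm (jacobi_transform \<alpha> \<beta> f n) \<le> C * Lp_norm p (jacobi_measure \<alpha> \<beta>) f"
proof -
  let ?M = "jacobi_measure \<alpha> \<beta>"
  interpret finite_measure ?M by (rule finite_measure_jacobi_measure[OF ab])
  define S where "S = jacobi_sup \<alpha> \<beta> n"
  have S0: "S \<ge> 0" unfolding S_def using norm_jacobi_e_le[of 0 \<alpha> \<beta> n] order_trans[OF norm_ge_zero] by auto
  have "norm (jacobi_transform \<alpha> \<beta> f n) \<le> (S * (1 + measure ?M (space ?M)) + 1) * Lp_norm p ?M f"
    if f: "f \<in> Lp p ?M" for f
  proof -
    note i = Lp_imp_integrable(1)[OF p f]
    have "norm (jacobi_transform \<alpha> \<beta> f n) \<le> (\<integral>t. S * norm (f t) \<partial>?M)"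
      unfolding jacobi_transform_def
    proof (rule Bochner_Integration.integral_norm_bound_integral)
      show "integrable ?M (\<lambda>t. f t * jacobi_e \<alpha> \<beta> n t)"
        by (intro integrable_mult_continuous i continuous_on_jacobi_e)
      show "integrable ?M (\<lambda>t. S * norm (f t))" using i by simp
      fix t assume "t \<in> space ?M"
      then have "norm (jacobi_e \<alpha> \<beta> n t) \<le> S" unfolding S_def by (intro norm_jacobi_e_le) simp
      then show "norm (f t * jacobi_e \<alpha> \<beta> n t) \<le> S * norm (f t)"
        unfolding norm_mult mult.commute[of "norm (f t)"] by (intro mult_right_mono) auto
    qed
    also have "\<dots> \<le> S * ((1 + measure ?M (space ?M)) * Lp_norm p ?M f)"
      using Lp_imp_integrable(2)[OF p f] S0 by (simp add: mult_left_mono)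
    also have "\<dots> \<le> (S * (1 + measure ?M (space ?M)) + 1) * Lp_norm p ?M f"
      using Lp_norm_nonneg[of p ?M f] by (simp add: algebra_simps)
    finally show ?thesis .
  qed
  moreover have "S * (1 + measure ?M (space ?M)) + 1 > 0"
    using S0 by (intro add_nonneg_pos mult_nonneg_nonneg) auto
  ultimately show ?thesis by blast
qed

lemma jacobi_transform_lincomb:
  assumes "integrable (jacobi_measure \<alpha> \<beta>) f" "integrable (jacobi_measure \<alpha> \<beta>) g"
  shows "jacobi_transform \<alpha> \<beta> (\<lambda>t. a * f t + b * g t) n =
     a * jacobi_transform \<alpha> \<beta> f n + b * jacobi_transform \<alpha> \<beta> g n"
proof -
  note i = integrable_mult_continuous[OF _ continuous_on_jacobi_e]
  have "jacobi_transform \<alpha> \<beta> (\<lambda>t. a * f t + b * g t) n =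
    (\<integral>t. a * (f t * jacobi_e \<alpha> \<beta> n t) + b * (g t * jacobi_e \<alpha> \<beta> n t) \<partial>jacobi_measure \<alpha> \<beta>)"
    unfolding jacobi_transform_def by (simp add: algebra_simps)
  also have "\<dots> = (\<integral>t. a * (f t * jacobi_e \<alpha> \<beta> n t) \<partial>jacobi_measure \<alpha> \<beta>)
      + (\<integral>t. b * (g t * jacobi_e \<alpha> \<beta> n t) \<partial>jacobi_measure \<alpha> \<beta>)"
    by (intro Bochner_Integration.integral_add integrable_mult_right i assms)
  finally show ?thesis unfolding jacobi_transform_def by simp
qed

subsection \<open>Extensions of the Jacobi operator\<close>

lemma op_shift_iff: "(f, x) \<in> op_shift S z \<longleftrightarrow> (f, \<lambda>t. x t + z * f t) \<in> S"
proof
  assume "(f, x) \<in> op_shift S z"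
  then obtain h where h: "(f, h) \<in> S" "x = (\<lambda>t. h t - z * f t)" unfolding op_shift_def by auto
  have "(\<lambda>t. x t + z * f t) = h" by (rule ext) (simp add: h(2))
  with h(1) show "(f, \<lambda>t. x t + z * f t) \<in> S" by simp
next
  assume "(f, \<lambda>t. x t + z * f t) \<in> S"
  then show "(f, x) \<in> op_shift S z"
    unfolding op_shift_def by (auto intro!: exI[of _ f] exI[of _ "\<lambda>t. x t + z * f t"])
qed

lemma linear_operator_AE_cong:
  assumes "linear_operator p M S" "(f, h) \<in> S" "f' \<in> Lp p M" "h' \<in> Lp p M"
    "AE t in M. f' t = f t" "AE t in M. h' t = h t"
  shows "(f', h') \<in> S"
  using assms unfolding linear_operator_def by blast

lemma linear_operator_unique:
  "linear_operator p M S \<Longrightarrow> (f, h) \<in> S \<Longrightarrow> (f, h') \<in> S \<Longrightarrow> AE t in M. h t = h' t"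
  unfolding linear_operator_def by blast

lemma linear_operator_in_Lp: "linear_operator p M S \<Longrightarrow> (f, h) \<in> S \<Longrightarrow> f \<in> Lp p M \<and> h \<in> Lp p M"
  unfolding linear_operator_def by blast

lemma linear_operator_relpow_unique:
  assumes S: "linear_operator p M S"
  shows "(f, h) \<in> S ^^ k \<Longrightarrow> (f, h') \<in> S ^^ k \<Longrightarrow> AE t in M. h t = h' t"
proof (induction k arbitrary: h h')
  case (Suc k)
  from Suc.prems obtain g g' where g: "(f, g) \<in> S ^^ k" "(g, h) \<in> S" "(f, g') \<in> S ^^ k" "(g', h') \<in> S"
    by (auto simp: relcomp_unfold)
  have "AE t in M. g t = g' t" by (rule Suc.IH[OF g(1,3)])
  then have "(g, h') \<in> S"
    using linear_operator_in_Lp[OF S g(2)] linear_operator_in_Lp[OF S g(4)]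
    by (intro linear_operator_AE_cong[OF S g(4)]) auto
  then show ?case by (rule linear_operator_unique[OF S g(2)])
qed simp

text \<open>Testing the maximal operator against the Jacobi polynomials shows that every extension acts on the
  transform as multiplication by the eigenvalues.\<close>

lemma jacobi_transform_max:
  assumes "\<alpha> > -1" "(f, h) \<in> jacobi_op_max p \<alpha> \<beta>"
  shows "jacobi_transform \<alpha> \<beta> h n = jacobi_ev \<alpha> \<beta> n * jacobi_transform \<alpha> \<beta> f n"
proof -
  have "jacobi_transform \<alpha> \<beta> h n = (\<integral>t. f t * jacobi_diff \<alpha> \<beta> (jacobi_e \<alpha> \<beta> n) t \<partial>jacobi_measure \<alpha> \<beta>)"
    using assms(2) smooth_ivl_jacobi_e[of \<alpha> \<beta> n] unfolding jacobi_op_max_def jacobi_transform_def by simp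
  also have "\<dots> = (\<integral>t. jacobi_ev \<alpha> \<beta> n * (f t * jacobi_e \<alpha> \<beta> n t) \<partial>jacobi_measure \<alpha> \<beta>)"
    by (intro Bochner_Integration.integral_cong refl) (simp add: jacobi_diff_jacobi_e[OF assms(1)] del: of_real_mult of_real_minus)
  finally show ?thesis unfolding jacobi_transform_def by simp
qed

lemma jacobi_opI:
  assumes ab: "\<alpha> > -1" "\<beta> > -1" and p: "1 \<le> p" and g: "g \<in> smooth_ivl"
    and f: "f \<in> Lp p (jacobi_measure \<alpha> \<beta>)" "AE t in jacobi_measure \<alpha> \<beta>. f t = g t"
    and h: "h \<in> Lp p (jacobi_measure \<alpha> \<beta>)" "AE t in jacobi_measure \<alpha> \<beta>. h t = jacobi_diff \<alpha> \<beta> g t"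
  shows "(f, h) \<in> jacobi_op p \<alpha> \<beta>"
  unfolding jacobi_op_def using assms by blast

lemma jacobi_relpow_smooth:
  assumes ab: "\<alpha> > -1" "\<beta> > -1" and p: "1 \<le> p" and f: "f \<in> smooth_ivl" and S: "jacobi_op p \<alpha> \<beta> \<subseteq> S"
  shows "(f, (jacobi_diff \<alpha> \<beta> ^^ k) f) \<in> S ^^ k"
proof (induction k)
  case (Suc k)
  have s: "(jacobi_diff \<alpha> \<beta> ^^ i) f \<in> smooth_ivl" for i
    by (induction i) (auto intro: smooth_ivl_jacobi_diff f)
  have "((jacobi_diff \<alpha> \<beta> ^^ k) f, (jacobi_diff \<alpha> \<beta> ^^ Suc k) f) \<in> jacobi_op p \<alpha> \<beta>"
    by (rule jacobi_opI[OF ab p s[of k]]) (use smooth_ivl_in_Lp[OF ab p s[of k]] smooth_ivl_in_Lp[OF ab p s[of "Suc k"]] in auto)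
  with Suc S show ?case by (auto intro: relcompI)
qed simp

text \<open>
  If \<open>S \<phi>\<^sub>z = z \<phi>\<^sub>z\<close> then \<open>(\<lambda>\<^sub>n - z) \<F> \<phi>\<^sub>z(n) = 0\<close>. At \<open>z = \<lambda>\<^sub>n\<close> this says nothing, and
  the coefficient vanishes there because it does so at all nearby points and \<open>\<phi>\<close>, being differentiable,
  is continuous.
\<close>

lemma jacobi_op_svep:
  assumes ab: "\<alpha> > -1" "\<beta> > -1" "\<alpha> + \<beta> + 1 \<ge> 0" and p: "1 \<le> p"
    and S: "linear_operator p (jacobi_measure \<alpha> \<beta>) S" "S \<subseteq> jacobi_op_max p \<alpha> \<beta>"
  shows "has_svep p (jacobi_measure \<alpha> \<beta>) S"
  unfolding has_svep_def
proof (intro allI impI ballI, elim conjE)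
  fix U \<phi> z
  let ?M = "jacobi_measure \<alpha> \<beta>" and ?F = "jacobi_transform \<alpha> \<beta>"
  assume U: "open U" and an: "Lp_analytic_on p ?M \<phi> U" and z: "z \<in> U"
    and ker: "\<forall>z\<in>U. (\<phi> z, \<lambda>_. 0) \<in> op_shift S z"
  interpret finite_measure ?M by (rule finite_measure_jacobi_measure[OF ab(1,2)])
  have Lp: "\<phi> w \<in> Lp p ?M" if "w \<in> U" for w using an that unfolding Lp_analytic_on_def by blast
  note int = Lp_imp_integrable(1)[OF p]
  have F0: "?F (\<phi> w) n = 0" if w: "w \<in> U" "w \<noteq> jacobi_ev \<alpha> \<beta> n" for w n
  proof -
    have "(\<phi> w, \<lambda>t. 0 + w * \<phi> w t) \<in> S" using ker w(1) unfolding op_shift_iff by blast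
    then have "(\<phi> w, \<lambda>t. w * \<phi> w t) \<in> jacobi_op_max p \<alpha> \<beta>" using S(2) by auto
    then have "?F (\<lambda>t. w * \<phi> w t) n = jacobi_ev \<alpha> \<beta> n * ?F (\<phi> w) n" by (rule jacobi_transform_max[OF ab(1)])
    moreover have "?F (\<lambda>t. w * \<phi> w t) n = w * ?F (\<phi> w) n"
      by (simp add: jacobi_transform_def mult.assoc)
    ultimately show ?thesis using w(2) by (metis mult_right_cancel)
  qed
  have "?F (\<phi> z) n = 0" for n
  proof (cases "z = jacobi_ev \<alpha> \<beta> n")
    case False
    then show ?thesis using F0 z by blast
  next
    case True
    obtain d where d: "d \<in> Lp p ?M"
      "((\<lambda>w. Lp_norm p ?M (\<lambda>t. (\<phi> w t - \<phi> z t) / (w - z) - d t)) \<longlongrightarrow> 0) (at z within U)"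
      using an z unfolding Lp_analytic_on_def by blast
    obtain C where C: "C > 0" "\<forall>f\<in>Lp p ?M. norm (?F f n) \<le> C * Lp_norm p ?M f"
      using Lp_jacobi_transform_bound[OF ab(1,2) p] by blast
    have at: "at z within U = at z" by (rule at_within_open[OF z U])
    have "\<forall>\<^sub>F w in at z. norm (?F (\<phi> z) n) \<le>
        norm (w - z) * (norm (?F d n) + C * Lp_norm p ?M (\<lambda>t. (\<phi> w t - \<phi> z t) / (w - z) - d t))"
    proof -
      have "\<forall>\<^sub>F w in at z. w \<in> U \<and> w \<noteq> z"
        using eventually_at_in_open[OF U z] by (rule eventually_mono) auto
      then show ?thesis
      proof eventually_elim
        case (elim w)
        define q where "q t = (\<phi> w t - \<phi> z t) / (w - z) - d t" for t
        have q: "q \<in> Lp p ?M"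
          unfolding q_def[abs_def] divide_inverse mult.commute[of _ "inverse (w - z)"]
          by (intro Lp_diff Lp_cmult Lp d z) (use elim in auto)
        have "(\<lambda>t. (w - z) * q t + (w - z) * d t) = (\<lambda>t. 1 * \<phi> w t + (-1) * \<phi> z t)"
          using elim by (auto simp: q_def fun_eq_iff field_simps)
        then have "(w - z) * ?F q n + (w - z) * ?F d n = ?F (\<phi> w) n - ?F (\<phi> z) n"
          using jacobi_transform_lincomb[OF int[OF q] int[OF d(1)], of "w - z" "w - z" n]
            jacobi_transform_lincomb[OF int[OF Lp] int[OF Lp], of w z 1 "-1" n] elim z by simp
        moreover have "?F (\<phi> w) n = 0" using F0 elim True by blast
        ultimately have "?F (\<phi> z) n = - ((w - z) * (?F q n + ?F d n))"
          by (simp add: algebra_simps)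
        then have "norm (?F (\<phi> z) n) = norm (w - z) * norm (?F q n + ?F d n)"
          by (simp add: norm_mult)
        also have "\<dots> \<le> norm (w - z) * (norm (?F d n) + C * Lp_norm p ?M q)"
          using norm_triangle_ineq[of "?F q n" "?F d n"] C(2)[rule_format, OF q]
          by (intro mult_left_mono) auto
        finally show ?case unfolding q_def[abs_def] .
      qed
    qed
    moreover have "((\<lambda>w. norm (w - z) * (norm (?F d n) + C * Lp_norm p ?M (\<lambda>t. (\<phi> w t - \<phi> z t) / (w - z) - d t)))
       \<longlongrightarrow> norm (z - z) * (norm (?F d n) + C * 0)) (at z)"
      using d(2) unfolding at by (intro tendsto_intros)
    ultimately have "norm (?F (\<phi> z) n) \<le> norm (z - z) * (norm (?F d n) + C * 0)"
      by (intro tendsto_lowerbound[of _ _ "at z"]) auto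
    then show ?thesis by simp
  qed
  then show "AE t in ?M. \<phi> z t = 0"
    by (rule AE_zero_if_jacobi_transform_zero[OF ab int[OF Lp[OF z]]])
qed

text \<open>
  On the coefficients, solving \<open>(S - z) \<phi> = f\<close> means dividing by \<open>\<lambda>\<^sub>n - z\<close>. Only the
  eigenvalues in the support of the transform matter, and these do not accumulate; so \<open>\<bar>\<lambda>\<^sub>n - z\<bar>\<close> is
  bounded below for \<open>z\<close> near any point that is not one of them, and the divided coefficients still
  decrease rapidly and give a smooth solution.
\<close>

lemma jacobi_local_spectrum:
  assumes ab: "\<alpha> > -1" "\<beta> > -1" "\<alpha> + \<beta> + 1 \<ge> 0" and p: "1 \<le> p" and f: "f \<in> smooth_ivl"
    and S: "linear_operator p (jacobi_measure \<alpha> \<beta>) S" "jacobi_op p \<alpha> \<beta> \<subseteq> S" "S \<subseteq> jacobi_op_max p \<alpha> \<beta>"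
  shows "local_spectrum p (jacobi_measure \<alpha> \<beta>) S f =
     {jacobi_ev \<alpha> \<beta> n | n. jacobi_transform \<alpha> \<beta> f n \<noteq> 0}"
proof -
  let ?M = "jacobi_measure \<alpha> \<beta>" and ?F = "jacobi_transform \<alpha> \<beta>" and ?e = "jacobi_e \<alpha> \<beta>"
  let ?ev = "jacobi_ev \<alpha> \<beta>" and ?h = "jacobi_sqnorm \<alpha> \<beta>"
  interpret finite_measure ?M by (rule finite_measure_jacobi_measure[OF ab(1,2)])
  note fLp = smooth_ivl_in_Lp[OF ab(1,2) p f]
  have spec: "?ev n \<notin> local_resolvent_set p ?M S f" if n: "?F f n \<noteq> 0" for n
  proof
    assume "?ev n \<in> local_resolvent_set p ?M S f"
    then obtain U \<phi> where \<phi>: "?ev n \<in> U" "Lp_analytic_on p ?M \<phi> U" "\<forall>z\<in>U. (\<phi> z, f) \<in> op_shift S z"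
      unfolding local_resolvent_set_def by blast
    let ?u = "\<phi> (?ev n)"
    have u: "?u \<in> Lp p ?M" using \<phi>(1,2) unfolding Lp_analytic_on_def by blast
    have "(?u, \<lambda>t. f t + ?ev n * ?u t) \<in> jacobi_op_max p \<alpha> \<beta>"
      using \<phi>(1,3) S(3) unfolding op_shift_iff by blast
    then have "?F (\<lambda>t. f t + ?ev n * ?u t) n = ?ev n * ?F ?u n"
      by (rule jacobi_transform_max[OF ab(1)])
    then show False
      using jacobi_transform_lincomb[OF Lp_imp_integrable(1)[OF p fLp] Lp_imp_integrable(1)[OF p u], of 1 "?ev n" n] n
      by (simp del: of_real_mult of_real_minus)
  qed
  have res: "z0 \<in> local_resolvent_set p ?M S f" if z0: "\<And>n. ?F f n \<noteq> 0 \<Longrightarrow> z0 \<noteq> ?ev n" for z0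
  proof -
    define A where "A = {n. ?F f n \<noteq> 0}"
    have "\<exists>\<delta>>0. \<forall>n\<in>A. \<delta> \<le> dist z0 (?ev n)"
    proof -
      let ?V = "?ev ` {n\<in>A. norm (?ev n) \<le> norm z0 + 1}"
      have fin: "finite ?V"
        by (intro finite_imageI finite_subset[OF _ finite_jacobi_ev_bounded[OF ab(3), of "norm z0 + 1"]]) blast
      have nz: "z0 \<notin> ?V" using z0 by (auto simp: A_def simp del: of_real_mult of_real_minus norm_of_real)
      obtain \<delta> where \<delta>: "\<delta> > 0" "\<forall>x\<in>?V. x \<noteq> z0 \<longrightarrow> \<delta> \<le> dist z0 x"
        using finite_set_avoid[OF fin, of z0] by (elim exE conjE)
      have "min \<delta> 1 \<le> dist z0 (?ev n)" if n: "n \<in> A" for n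
      proof (cases "norm (?ev n) \<le> norm z0 + 1")
        case True
        then have "\<delta> \<le> dist z0 (?ev n)" using n nz by (intro \<delta>(2)[rule_format]) blast+
        then show ?thesis by linarith
      next
        case False
        then have "1 \<le> dist z0 (?ev n)"
          using norm_triangle_ineq3[of z0 "?ev n"] unfolding dist_norm by linarith
        then show ?thesis by linarith
      qed
      then show ?thesis using \<delta>(1) by (intro exI[of _ "min \<delta> 1"]) auto
    qed
    then obtain \<delta> where \<delta>: "\<delta> > 0" "\<And>n. n \<in> A \<Longrightarrow> \<delta> \<le> dist z0 (?ev n)" by blast
    define r where "r = \<delta> / 2"
    have r: "r > 0" using \<delta>(1) by (simp add: r_def)
    have far: "r \<le> norm (?ev n - z)" if "n \<in> A" "z \<in> ball z0 r" for n z
    proof -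
      have "\<delta> \<le> dist z0 z + dist z (?ev n)" using \<delta>(2)[OF that(1)] dist_triangle[of z0 "?ev n" z] by linarith
      then show ?thesis using that(2) unfolding dist_norm[of z] norm_minus_commute[of z] by (simp add: r_def)
    qed
    define a where "a n = ?F f n / complex_of_real (?h n)" for n
    have a0: "a n = 0" if "n \<notin> A" for n using that by (simp add: a_def A_def)
    have ra: "rapidly_decreasing \<alpha> \<beta> a" unfolding a_def[abs_def] by (rule rapid_jacobi_transform[OF ab f])
    define b where "b z n = a n / (?ev n - z)" for z n
    define \<phi> where "\<phi> z t = (\<Sum>n. b z n * ?e n t)" for z t
    \<comment> \<open>the termwise derivative of \<open>\<phi>\<close> with respect to \<open>z\<close>\<close>
    define d where "d z t = (\<Sum>n. a n / (?ev n - z)\<^sup>2 * ?e n t)" for z t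
    have rb: "rapidly_decreasing \<alpha> \<beta> (b z)" if "z \<in> ball z0 r" for z
    proof (rule rapid_mono[OF ra, of _ "1 / r"])
      show "norm (b z n) \<le> 1 / r * norm (a n)" for n
      proof (cases "n \<in> A")
        case True
        have "norm (b z n) = norm (a n) / norm (?ev n - z)" by (simp only: b_def norm_divide)
        also have "\<dots> \<le> norm (a n) / r"
          using far[OF True that] r by (intro divide_left_mono mult_pos_pos) auto
        finally show ?thesis by simp
      qed (simp add: b_def a0)
    qed
    have rd: "rapidly_decreasing \<alpha> \<beta> (\<lambda>n. a n / (?ev n - z)\<^sup>2)" if "z \<in> ball z0 r" for z
    proof (rule rapid_mono[OF ra, of _ "1 / r\<^sup>2"])
      show "norm (a n / (?ev n - z)\<^sup>2) \<le> 1 / r\<^sup>2 * norm (a n)" for n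
      proof (cases "n \<in> A")
        case True
        have "norm (a n / (?ev n - z)\<^sup>2) = norm (a n) / (norm (?ev n - z))\<^sup>2" by (simp only: norm_divide norm_power)
        also have "\<dots> \<le> norm (a n) / r\<^sup>2"
          using far[OF True that] r by (intro divide_left_mono mult_pos_pos power_mono zero_less_power) auto
        finally show ?thesis by simp
      qed (simp add: a0)
    qed
    have sm: "summable (\<lambda>n. c n * ?e n t)" if "rapidly_decreasing \<alpha> \<beta> c" "t \<in> {-1..1}" for c t
    proof -
      obtain M where M: "summable M" "\<forall>n. \<forall>t\<in>{-1..1}. norm (c n * (ivl_deriv ^^ 0) (?e n) t) \<le> M n"
        using \<open>rapidly_decreasing \<alpha> \<beta> c\<close> unfolding rapidly_decreasing_def by meson
      show ?thesis
        by (rule summable_comparison_test'[OF M(1), of 0]) (use M(2) that(2) in auto)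
    qed
    have \<phi>s: "\<phi> z \<in> smooth_ivl" if "z \<in> ball z0 r" for z
      unfolding \<phi>_def[abs_def] by (rule rapid_series(1)[OF ab rb[OF that]])
    have ds: "d z \<in> smooth_ivl" if "z \<in> ball z0 r" for z
      unfolding d_def[abs_def] by (rule rapid_series(1)[OF ab rd[OF that]])
    have eq: "(\<phi> z, f) \<in> op_shift S z" if z: "z \<in> ball z0 r" for z
    proof -
      have f_exp: "AE t in ?M. f t = (\<Sum>n. a n * ?e n t)"
        using jacobi_expansion[OF ab f] unfolding a_def .
      have "AE t in ?M. f t + z * \<phi> z t = jacobi_diff \<alpha> \<beta> (\<phi> z) t"
        using f_exp AE_space
      proof eventually_elim
        case (elim t)
        then have t: "t \<in> {-1..1}" by simp
        have "f t + z * \<phi> z t = (\<Sum>n. a n * ?e n t + z * (b z n * ?e n t))"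
          unfolding elim(1) \<phi>_def
          by (subst suminf_mult[symmetric, OF sm[OF rb[OF z] t]]) (intro suminf_add summable_mult sm ra rb z t)
        also have "\<dots> = (\<Sum>n. b z n * (?ev n * ?e n t))"
        proof (intro arg_cong[where f = suminf] ext)
          fix n
          show "a n * ?e n t + z * (b z n * ?e n t) = b z n * (?ev n * ?e n t)"
          proof (cases "n \<in> A")
            case True
            then have "?ev n - z \<noteq> 0" using far[OF True z] r by auto
            then have "a n = b z n * (?ev n - z)" by (simp add: b_def)
            then show ?thesis by (simp only: ring_distribs) (simp add: algebra_simps)
          qed (simp add: a0 b_def)
        qed
        also have "\<dots> = jacobi_diff \<alpha> \<beta> (\<phi> z) t"
          unfolding \<phi>_def[abs_def] by (rule rapid_series(2)[OF ab rb[OF z] t, symmetric])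
        finally show ?case .
      qed
      then have "(\<phi> z, \<lambda>t. f t + z * \<phi> z t) \<in> jacobi_op p \<alpha> \<beta>"
        using smooth_ivl_in_Lp[OF ab(1,2) p \<phi>s[OF z]] fLp
        by (intro jacobi_opI[OF ab(1,2) p \<phi>s[OF z]] Lp_add Lp_cmult) auto
      then show ?thesis unfolding op_shift_iff using S(2) by blast
    qed
    obtain M where M: "summable M" "\<forall>n. \<forall>t\<in>{-1..1}. norm (a n * (ivl_deriv ^^ 0) (?e n) t) \<le> M n"
      using ra unfolding rapidly_decreasing_def by meson
    have M0: "norm (a n * ?e n t) \<le> M n" if "t \<in> {-1..1}" for n t using M(2) that by simp
    have Mn: "M n \<ge> 0" for n using order_trans[OF norm_ge_zero M0[of 0 n]] by simp
    have quot: "norm ((\<phi> w t - \<phi> z t) / (w - z) - d z t) \<le> norm (w - z) / r ^ 3 * suminf M"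
      if z: "z \<in> ball z0 r" and w: "w \<in> ball z0 r" "w \<noteq> z" and t: "t \<in> {-1..1}" for w z t
    proof -
      define k where "k n = (w - z) / ((?ev n - w) * (?ev n - z)\<^sup>2) * (a n * ?e n t)" for n
      have "(\<phi> w t - \<phi> z t) / (w - z) - d z t
         = (\<Sum>n. (b w n * ?e n t - b z n * ?e n t) / (w - z) - a n / (?ev n - z)\<^sup>2 * ?e n t)"
        unfolding \<phi>_def d_def
        by (subst suminf_diff[OF sm[OF rb[OF w(1)] t] sm[OF rb[OF z] t]])
           (subst suminf_divide[symmetric],
            intro summable_diff sm rb w z t,
            intro suminf_diff summable_divide summable_diff sm rb rd w z t)
      also have "\<dots> = (\<Sum>n. k n)"
      proof (intro arg_cong[where f = suminf] ext)
        fix n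
        show "(b w n * ?e n t - b z n * ?e n t) / (w - z) - a n / (?ev n - z)\<^sup>2 * ?e n t = k n"
        proof (cases "n \<in> A")
          case True
          define x y e where "x = ?ev n - w" and "y = ?ev n - z" and "e = ?e n t"
          have "x \<noteq> 0" "y \<noteq> 0" using far[OF True w(1)] far[OF True z] r by (auto simp: x_def y_def)
          moreover have wz: "w - z = y - x" by (simp add: x_def y_def)
          moreover have "y - x \<noteq> 0" using w(2) wz by auto
          ultimately show ?thesis
            unfolding k_def b_def x_def[symmetric] y_def[symmetric] e_def[symmetric] wz
            by (simp add: divide_simps power2_eq_square) algebra
        qed (simp add: a0 b_def k_def)
      qed
      finally have e1: "(\<phi> w t - \<phi> z t) / (w - z) - d z t = (\<Sum>n. k n)" .
      have kb: "norm (k n) \<le> norm (w - z) / r ^ 3 * M n" for n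
      proof (cases "n \<in> A")
        case True
        have "r ^ 3 \<le> norm (?ev n - w) * (norm (?ev n - z))\<^sup>2"
          unfolding numeral_3_eq_3 power2_eq_square power_Suc power_0 mult_1_right
          using far[OF True w(1)] far[OF True z] r by (intro mult_mono) auto
        then have "norm (w - z) / (norm (?ev n - w) * (norm (?ev n - z))\<^sup>2) \<le> norm (w - z) / r ^ 3"
          using r by (intro divide_left_mono mult_pos_pos) (auto intro: less_le_trans[OF zero_less_power])
        then show ?thesis
          unfolding k_def norm_mult[of _ "a n * ?e n t"] norm_divide norm_mult[of "?ev n - w"] norm_power
          using M0[OF t, of n] r by (intro mult_mono) auto
      next
        case False
        then show ?thesis using Mn[of n] r by (simp add: k_def a0)
      qed
      have "norm (\<Sum>n. k n) \<le> (\<Sum>n. norm (w - z) / r ^ 3 * M n)"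
        by (rule norm_suminf_le[OF kb]) (intro summable_mult M)
      then show ?thesis unfolding e1 suminf_mult[OF M(1)] .
    qed
    have an: "Lp_analytic_on p ?M \<phi> (ball z0 r)"
      unfolding Lp_analytic_on_def
    proof (intro ballI conjI)
      fix z assume z: "z \<in> ball z0 r"
      show "\<phi> z \<in> Lp p ?M" by (rule smooth_ivl_in_Lp[OF ab(1,2) p \<phi>s[OF z]])
      show "\<exists>d\<in>Lp p ?M. ((\<lambda>w. Lp_norm p ?M (\<lambda>t. (\<phi> w t - \<phi> z t) / (w - z) - d t)) \<longlongrightarrow> 0) (at z within ball z0 r)"
      proof (rule bexI[of _ "d z"])
        show "d z \<in> Lp p ?M" by (rule smooth_ivl_in_Lp[OF ab(1,2) p ds[OF z]])
        show "((\<lambda>w. Lp_norm p ?M (\<lambda>t. (\<phi> w t - \<phi> z t) / (w - z) - d z t)) \<longlongrightarrow> 0) (at z within ball z0 r)"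
        proof (rule Lim_null_comparison)
          let ?g = "\<lambda>w. (1 + measure ?M (space ?M)) * (norm (w - z) / r ^ 3 * suminf M)"
          show "\<forall>\<^sub>F w in at z within ball z0 r. norm (Lp_norm p ?M (\<lambda>t. (\<phi> w t - \<phi> z t) / (w - z) - d z t)) \<le> ?g w"
          proof (unfold eventually_at_filter, intro always_eventually allI impI)
            fix w assume w: "w \<noteq> z" "w \<in> ball z0 r"
            have m: "u \<in> borel_measurable ?M" if "u \<in> smooth_ivl" for u
              by (intro continuous_on_measurable_jacobi_measure smooth_ivl_continuous that)
            have "Lp_norm p ?M (\<lambda>t. (\<phi> w t - \<phi> z t) / (w - z) - d z t) \<le> ?g w"
              using quot[OF z w(2,1)] m[OF \<phi>s[OF z]] m[OF \<phi>s[OF w(2)]] m[OF ds[OF z]] suminf_nonneg[OF M(1) Mn] r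
              by (intro bounded_in_Lp(2)[OF p]) auto
            then show "norm (Lp_norm p ?M (\<lambda>t. (\<phi> w t - \<phi> z t) / (w - z) - d z t)) \<le> ?g w"
              by (simp add: Lp_norm_nonneg)
          qed
          have "(?g \<longlongrightarrow> (1 + measure ?M (space ?M)) * (norm (z - z) / r ^ 3 * suminf M)) (at z within ball z0 r)"
            using r by (intro tendsto_intros) auto
          then show "(?g \<longlongrightarrow> 0) (at z within ball z0 r)" by simp
        qed
      qed
    qed
    show ?thesis
      unfolding local_resolvent_set_def using an eq r
      by (auto intro!: exI[of _ "ball z0 r"] exI[of _ \<phi>])
  qed
  show ?thesis
    unfolding local_spectrum_def using spec res by blast
qed

section \<open>Growth of powers\<close>

lemma powr_inverse_of_power:
  fixes c x :: real
  assumes "c \<ge> 0" "x \<ge> 0" "k > 0"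
  shows "(c * x ^ k) powr (1 / real k) = c powr (1 / real k) * x"
proof -
  have "(x ^ k) powr (1 / real k) = x"
    using assms by (cases "x = 0") (auto simp: powr_powr simp flip: powr_realpow)
  then show ?thesis using assms by (simp add: powr_mult)
qed

lemma tendsto_const_root:
  fixes c x :: real
  assumes "c > 0"
  shows "(\<lambda>k. ennreal (c powr (1 / real k) * x)) \<longlonglongrightarrow> ennreal x"
proof -
  have "(\<lambda>k. c powr (1 / real k) * x) \<longlonglongrightarrow> c powr 0 * x"
    using assms by (intro tendsto_intros lim_const_over_n) auto
  then show ?thesis using assms by (intro tendsto_ennrealI) simp
qed

text \<open>
  Each coefficient in the support bounds the growth of \<open>\<parallel>T\<^sup>k f\<parallel>\<^sub>p\<close> from below. If the eigenvalues in
  the support are bounded by \<open>\<rho>\<close>, the expansion of \<open>T\<^sup>k f\<close> is dominated by \<open>\<rho>\<^sup>k\<close> times that of \<open>f\<close>.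
\<close>

lemma jacobi_power_growth:
  assumes ab: "\<alpha> > -1" "\<beta> > -1" "\<alpha> + \<beta> + 1 \<ge> 0" and p: "1 \<le> p" and f: "f \<in> smooth_ivl"
  shows "(\<lambda>k. ennreal (Lp_norm p (jacobi_measure \<alpha> \<beta>) ((jacobi_diff \<alpha> \<beta> ^^ k) f) powr (1 / real k)))
    \<longlonglongrightarrow> (SUP z \<in> {jacobi_ev \<alpha> \<beta> n | n. jacobi_transform \<alpha> \<beta> f n \<noteq> 0}. ennreal (cmod z))"
    (is "_ \<longlonglongrightarrow> ?R")
proof (rule order_tendstoI)
  let ?M = "jacobi_measure \<alpha> \<beta>" and ?F = "jacobi_transform \<alpha> \<beta>" and ?e = "jacobi_e \<alpha> \<beta>"
  let ?ev = "jacobi_ev \<alpha> \<beta>" and ?h = "jacobi_sqnorm \<alpha> \<beta>"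
  define T where "T k = (jacobi_diff \<alpha> \<beta> ^^ k) f" for k
  interpret finite_measure ?M by (rule finite_measure_jacobi_measure[OF ab(1,2)])
  have T: "T k \<in> smooth_ivl" for k
    unfolding T_def by (induction k) (auto intro: smooth_ivl_jacobi_diff f)
  have FT: "?F (T k) n = ?ev n ^ k * ?F f n" for k n
  proof (induction k)
    case (Suc k)
    have "T (Suc k) = jacobi_diff \<alpha> \<beta> (T k)" by (simp add: T_def)
    then show ?case
      using jacobi_transform_diff[OF ab(1) T[of k] ab(2), of n] Suc by (simp only: power_Suc mult.assoc)
  qed (simp add: T_def)
  fix x :: ennreal
  show "\<forall>\<^sub>F k in sequentially. x < ennreal (Lp_norm p ?M ((jacobi_diff \<alpha> \<beta> ^^ k) f) powr (1 / real k))"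
    if xR: "x < ?R"
  proof -
    obtain n where n: "?F f n \<noteq> 0" "x < ennreal (norm (?ev n))"
      using xR unfolding less_SUP_iff by blast
    obtain C where C: "C > 0" "\<forall>f\<in>Lp p ?M. norm (?F f n) \<le> C * Lp_norm p ?M f"
      using Lp_jacobi_transform_bound[OF ab(1,2) p] by blast
    define c where "c = norm (?F f n) / C"
    have c: "c > 0" using n(1) C(1) by (simp add: c_def)
    have "\<forall>\<^sub>F k in sequentially. x < ennreal (c powr (1 / real k) * norm (?ev n))"
      using tendsto_const_root[OF c] n(2) by (rule order_tendstoD)
    then show ?thesis
      using eventually_gt_at_top[of 0]
    proof eventually_elim
      case (elim k)
      have "norm (?ev n) ^ k * norm (?F f n) \<le> C * Lp_norm p ?M (T k)"
        using C(2) smooth_ivl_in_Lp[OF ab(1,2) p T[of k]] FT[of k n] by (metis norm_mult norm_power)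
      then have "c * norm (?ev n) ^ k \<le> Lp_norm p ?M (T k)"
        using C(1) by (simp add: c_def field_simps)
      then have "(c * norm (?ev n) ^ k) powr (1 / real k) \<le> Lp_norm p ?M (T k) powr (1 / real k)"
        using c by (intro powr_mono2 mult_nonneg_nonneg) auto
      then have "c powr (1 / real k) * norm (?ev n) \<le> Lp_norm p ?M (T k) powr (1 / real k)"
        using c elim(2) by (subst (asm) powr_inverse_of_power) auto
      then show ?case
        using elim(1) unfolding T_def by (meson ennreal_leI less_le_trans)
    qed
  qed
  show "\<forall>\<^sub>F k in sequentially. ennreal (Lp_norm p ?M ((jacobi_diff \<alpha> \<beta> ^^ k) f) powr (1 / real k)) < x"
    if Rx: "?R < x"
  proof -
    have Rt: "?R < top" using less_le_trans[OF Rx top_greatest] .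
    define \<rho> where "\<rho> = enn2real ?R"
    have \<rho>: "\<rho> \<ge> 0" "?R = ennreal \<rho>"
      unfolding \<rho>_def using ennreal_enn2real[OF Rt] by (simp_all only: enn2real_nonneg)
    have le: "norm (?ev n) \<le> \<rho>" if "?F f n \<noteq> 0" for n
    proof -
      have "ennreal (norm (?ev n)) \<le> ?R" using that by (intro SUP_upper) blast
      then show ?thesis using \<rho> by simp
    qed
    define a where "a n = ?F f n / complex_of_real (?h n)" for n
    obtain M where M: "summable M" "\<forall>n. \<forall>t\<in>{-1..1}. norm (a n * (ivl_deriv ^^ 0) (?e n) t) \<le> M n"
      using rapid_jacobi_transform[OF ab f] unfolding rapidly_decreasing_def a_def by meson
    have M0: "norm (a n * ?e n t) \<le> M n" if "t \<in> {-1..1}" for n t using M(2) that by simp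
    have Mn: "M n \<ge> 0" for n using order_trans[OF norm_ge_zero M0[of 0 n]] by simp
    define D where "D = (1 + measure ?M (space ?M)) * suminf M + 1"
    have D: "D > 0"
      using suminf_nonneg[OF M(1) Mn] by (auto simp: D_def intro!: add_nonneg_pos mult_nonneg_nonneg)
    have bound: "Lp_norm p ?M (T k) \<le> D * \<rho> ^ k" for k
    proof -
      define g where "g t = (\<Sum>n. ?F (T k) n / complex_of_real (?h n) * ?e n t)" for t
      have gs: "g \<in> smooth_ivl"
        unfolding g_def[abs_def] by (rule rapid_series(1)[OF ab rapid_jacobi_transform[OF ab T]])
      have m: "u \<in> borel_measurable ?M" if "u \<in> smooth_ivl" for u
        by (intro continuous_on_measurable_jacobi_measure smooth_ivl_continuous that)
      have "Lp_norm p ?M (T k) = Lp_norm p ?M g"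
        using jacobi_expansion[OF ab T[of k]] unfolding g_def[symmetric]
        by (intro Lp_norm_cong_AE m T gs)
      also have "\<dots> \<le> (1 + measure ?M (space ?M)) * (\<rho> ^ k * suminf M)"
      proof (rule bounded_in_Lp(2)[OF p m[OF gs]])
        show "0 \<le> \<rho> ^ k * suminf M" using \<rho>(1) suminf_nonneg[OF M(1) Mn] by simp
        fix t assume "t \<in> space ?M"
        then have t: "t \<in> {-1..1}" by simp
        have "norm (?F (T k) n / complex_of_real (?h n) * ?e n t) \<le> \<rho> ^ k * M n" for n
        proof (cases "?F f n = 0")
          case True
          then show ?thesis using FT[of k n] Mn[of n] \<rho>(1) by simp
        next
          case False
          have "norm (?F (T k) n / complex_of_real (?h n) * ?e n t) = norm (?ev n) ^ k * norm (a n * ?e n t)"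
            unfolding FT a_def norm_power[symmetric] norm_mult[symmetric] by (simp only: times_divide_eq_right mult.assoc times_divide_eq_left)
          also have "\<dots> \<le> \<rho> ^ k * M n"
            using le[OF False] M0[OF t, of n] \<rho>(1) by (intro mult_mono power_mono) auto
          finally show ?thesis .
        qed
        from norm_suminf_le[OF this summable_mult[OF M(1)]]
        have "norm (g t) \<le> (\<Sum>n. \<rho> ^ k * M n)" unfolding g_def .
        then show "norm (g t) \<le> \<rho> ^ k * suminf M" unfolding suminf_mult[OF M(1)] .
      qed
      also have "\<dots> \<le> D * \<rho> ^ k" using \<rho>(1) by (simp add: D_def algebra_simps)
      finally show ?thesis .
    qed
    have "\<forall>\<^sub>F k in sequentially. ennreal (D powr (1 / real k) * \<rho>) < x"
      using tendsto_const_root[OF D] Rx[unfolded \<rho>(2)] by (rule order_tendstoD)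
    then show ?thesis
      using eventually_gt_at_top[of 0]
    proof eventually_elim
      case (elim k)
      have "Lp_norm p ?M (T k) powr (1 / real k) \<le> (D * \<rho> ^ k) powr (1 / real k)"
        using bound by (intro powr_mono2 Lp_norm_nonneg) auto
      also have "\<dots> = D powr (1 / real k) * \<rho>"
        using D \<rho>(1) elim(2) by (intro powr_inverse_of_power) auto
      finally show ?case
        using elim(1) unfolding T_def by (meson ennreal_leI le_less_trans)
    qed
  qed
qed

text \<open>The value chosen by \<^const>\<open>op_apply\<close> is an arbitrary representative, but powers of a linear
  operator are single-valued up to null sets.\<close>

lemma Lp_norm_op_apply_relpow:
  assumes ab: "\<alpha> > -1" "\<beta> > -1" and p: "1 \<le> p" and f: "f \<in> smooth_ivl"
    and S: "linear_operator p (jacobi_measure \<alpha> \<beta>) S" "jacobi_op p \<alpha> \<beta> \<subseteq> S"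
  shows "Lp_norm p (jacobi_measure \<alpha> \<beta>) (op_apply (S ^^ k) f) =
     Lp_norm p (jacobi_measure \<alpha> \<beta>) ((jacobi_diff \<alpha> \<beta> ^^ k) f)"
proof -
  let ?M = "jacobi_measure \<alpha> \<beta>"
  have T: "(f, (jacobi_diff \<alpha> \<beta> ^^ k) f) \<in> S ^^ k"
    by (rule jacobi_relpow_smooth[OF ab p f S(2)])
  then have h: "(f, op_apply (S ^^ k) f) \<in> S ^^ k" unfolding op_apply_def by (rule someI[of "\<lambda>h. (f, h) \<in> S ^^ k"])
  have Lp: "u \<in> Lp p ?M" if u: "(f, u) \<in> S ^^ k" for u
  proof (cases k)
    case 0
    then show ?thesis using u smooth_ivl_in_Lp[OF ab p f] by simp
  next
    case (Suc j)
    then obtain g where "(g, u) \<in> S" using u by auto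
    then show ?thesis using linear_operator_in_Lp[OF S(1)] by blast
  qed
  show ?thesis
    by (intro Lp_norm_cong_AE linear_operator_relpow_unique[OF S(1) h T] Lp_measurable[OF Lp[OF h]] Lp_measurable[OF Lp[OF T]])
qed

theorem theorem3p4:
  fixes p :: ennreal and \<alpha> \<beta> :: real and T\<^sub>e :: "real fun_op"
  assumes "1 \<le> p" and "\<alpha> \<ge> - (1 / 2)" and "\<beta> \<ge> - (1 / 2)"
    and "linear_operator p (jacobi_measure \<alpha> \<beta>) T\<^sub>e"
    and "jacobi_op p \<alpha> \<beta> \<subseteq> T\<^sub>e" and "T\<^sub>e \<subseteq> jacobi_op_max p \<alpha> \<beta>"
  shows "has_svep p (jacobi_measure \<alpha> \<beta>) T\<^sub>e \<and>
    (\<forall>f\<in>smooth_ivl.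
      (\<lambda>n. ennreal (Lp_norm p (jacobi_measure \<alpha> \<beta>) (op_apply (T\<^sub>e ^^ n) f) powr (1 / real n)))
        \<longlonglongrightarrow> (SUP z \<in> {complex_of_real (- (real n * (real n + \<alpha> + \<beta> + 1))) | n.
                          jacobi_transform \<alpha> \<beta> f n \<noteq> 0}. ennreal (cmod z)) \<and>
      local_spectrum p (jacobi_measure \<alpha> \<beta>) T\<^sub>e f =
        {complex_of_real (- (real n * (real n + \<alpha> + \<beta> + 1))) | n.
           jacobi_transform \<alpha> \<beta> f n \<noteq> 0} \<and>
      (\<lambda>n. ennreal (Lp_norm p (jacobi_measure \<alpha> \<beta>) (op_apply (T\<^sub>e ^^ n) f) powr (1 / real n)))
        \<longlonglongrightarrow> (SUP z \<in> local_spectrum p (jacobi_measure \<alpha> \<beta>) T\<^sub>e f. ennreal (cmod z)))"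
proof -
  have ab: "\<alpha> > -1" "\<beta> > -1" "\<alpha> + \<beta> + 1 \<ge> 0" using assms(2,3) by auto
  note p = assms(1) and S = assms(4-6)
  have lim: "(\<lambda>n. ennreal (Lp_norm p (jacobi_measure \<alpha> \<beta>) (op_apply (T\<^sub>e ^^ n) f) powr (1 / real n)))
      \<longlonglongrightarrow> (SUP z \<in> {jacobi_ev \<alpha> \<beta> n | n. jacobi_transform \<alpha> \<beta> f n \<noteq> 0}. ennreal (cmod z))"
    if "f \<in> smooth_ivl" for f
    unfolding Lp_norm_op_apply_relpow[OF ab(1,2) p that S(1,2)] by (rule jacobi_power_growth[OF ab p that])
  show ?thesis
    using jacobi_op_svep[OF ab p S(1,3)] lim jacobi_local_spectrum[OF ab p _ S] by simp
qed

end
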